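(* Let $G$ be a connected $N$-graph with assigned angles given by $\mathcal D$, and let $\{\mathcal N_n\}_{n\in\mathbb N}$, $\mathcal N_n=(G,\Gamma_n)$, be a sequence of networks in $\mathcal C_{\mathrm{Deg}}$ such that $$\limsup_{n\to\infty}\widetilde{\mathcal E}(\mathcal N_n)\le C<+\infty .$$ Then, up to passing to a subsequence and up to translations of the networks, $\mathcal N_n$ converges to some $\mathcal N_\infty\in\mathcal C_{\mathrm{Deg}}$ weakly in $H^2$ and strongly in $C^{1,\alpha}$ for every $\alpha\in(0,\tfrac12)$. In particular, if $\{\mathcal N_n\}$ is a sequence of networks in $\mathcal C_{\mathrm{Reg}}$ with this energy bound, then (up to subsequence and translations) $\mathcal N_n$ converges weakly in $H^2$ to some $\mathcal N_\infty\in\mathcal C_{\mathrm{Deg}}$.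
   Context: Fix integers $N\ge 1$, $d\ge2$. Let $I_i=[0,1]\times\{i\}$ for $i=1,\dots,N$, $E=\bigcup_i I_i$, $V=\bigcup_i\{0,1\}\times\{i\}$. An $N$-graph is a topological quotient $G=E/\sim$, where $\sim$ is an equivalence relation identifying points of $V$ only; $\pi:E\to G$ is the projection, $E_i=\pi(I_i)$ are the edges, $V_G=\pi(V)$ the vertices (junctions). For $p\in V_G$, $\pi^{-1}(p)$ is a finite set of pairs $(z,i)\in\{0,1\}\times\{1,\dots,N\}$. A subgraph $H\subseteq G$ is the union of a (possibly empty) collection of edges with the same identifications. A network is a pair $\mathcal N=(G,\Gamma)$ with $\Gamma:G\to\mathbb R^d$ continuous such that each $\gamma^i=\Gamma|_{E_i}$ (viewed as a map on $[0,1]$) is either constant (a singular curve) or an immersion of class $H^2$ (a regular curve); curves are considered up to reparametrization. $\mathrm{Sing}(\mathcal N)$ is the subgraph whose edges are those carrying singular curves; $\mathcal N$ is regular if $\mathrm{Sing}(\mathcal N)=\emptyset$. A sequence $(G,\Gamma_n)$ converges to $(G,\Gamma_\infty)$ in a given topology if for every $i$ the curves $\Gamma_n|_{E_i}$ converge to $\Gamma_\infty|_{E_i}$, up to reparametrization, in that topology. Outer tangents: for a regular curve $\gamma^i$ and $z\in\{0,1\}$, $\tau^{z,i}=(-1)^z\dot\gamma^i(z)/|\dot\gamma^i(z)|$. $G$ has assigned angles if a unit vector $d^{z,i}\in\mathbb S^{d-1}$ is given for each $(z,i)\in\{0,1\}\times\{1,\dots,N\}$; $\mathcal D$ is the collection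 of these; subgraphs inherit the assignment. Angle condition: a (possibly singular) network $(G,\Gamma)$ satisfies the angle condition if for every singular curve $\gamma^i$ there exist unit vectors $\tau^{0,i}=-\tau^{1,i}$ (virtual tangents) such that for every $p\in V_G$ there is a rotation $\mathrm R_p$ of $\mathbb R^d$ with $\tau^{z,i}=\mathrm R_p(d^{z,i})$ for all $(z,i)\in\pi^{-1}(p)$, where $\tau^{z,i}$ is the real outer tangent if $\gamma^i$ is regular and the virtual one if $\gamma^i$ is singular. $\mathcal C_{\mathrm{Reg}}$ is the class of regular networks $(G,\Gamma)$ satisfying the angle condition. Stratified straight: a subgraph $H\subseteq G$ is stratified straight if there are subgraphs $\emptyset=H_q\subset H_{q-1}\subset\dots\subset H_1\subset H_0=H$ and maps $\Sigma_j:H_j\to\mathbb R^d$ such that for $j=0,\dots,q-1$: $(H_j,\Sigma_j)$ is a network satisfying the angle condition, with (real or virtual) tangents coinciding with those associated with $(H_0,\Sigma_0)$, its regular curves are straight segments, and $H_{j+1}=\mathrm{Sing}((H_j,\Sigma_j))$. Degenerate networks: $\mathcal N=(G,\Gamma)$ belongs to $\mathcal C_{\mathrm{Deg}}$ if it satisfies the angle condition with some (real or virtual) tangents $\tau^{z,i}$ and $\mathrm{Sing}(\mathcal N)$ is a stratified straight subgraph with (real or virtual) tangents coinciding with these $\tau^{z,i}$. (So $\mathcal C_{\mathrm{Reg}}\subset\mathcal C_{\mathrm{Deg}}$.) Energy: for any network, $\widetilde{\mathcal E}(\mathcal N)=\sum_i\big(\int_{\gamma^i}|\vec k^i|^2\,ds+\ell(\gamma^i)\big)$,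 the sum being over regular curves, with $\vec k^i$ the curvature vector, $s$ arclength and $\ell$ length (singular curves contribute $0$). *)

theory Defs
  imports "HOL-Analysis.Analysis"
begin

section \<open>Sobolev and Hoelder spaces on the unit interval\<close>

text \<open>
  All function spaces are over \<open>[0,1]\<close>; values outside are irrelevant. Weak derivatives are
  tested against \<open>C\<^sup>1\<close> functions with compact support in the open interval.
\<close>

definition test_fun :: "(real \<Rightarrow> real) \<Rightarrow> bool" where
  "test_fun \<phi> \<longleftrightarrow> \<phi> C1_differentiable_on UNIV \<and> closure {t. \<phi> t \<noteq> 0} \<subseteq> {0<..<1}"

definition L2 :: "(real \<Rightarrow> 'a::euclidean_space) \<Rightarrow> bool" where
  "L2 u \<longleftrightarrow> set_borel_measurable lborel {0..1} u
     \<and> set_integrable lborel {0..1} (\<lambda>t. (norm (u t))\<^sup>2)"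

definition is_weak_deriv :: "(real \<Rightarrow> 'a::euclidean_space) \<Rightarrow> (real \<Rightarrow> 'a) \<Rightarrow> bool" where
  "is_weak_deriv u v \<longleftrightarrow> L2 v \<and>
     (\<forall>\<phi>. test_fun \<phi> \<longrightarrow>
        (LINT t:{0..1}|lborel. deriv \<phi> t *\<^sub>R u t) = - (LINT t:{0..1}|lborel. \<phi> t *\<^sub>R v t))"

text \<open>
  A representative of the weak derivative; it is determined only almost everywhere and is used
  only under integrals.
\<close>

definition weak_deriv :: "(real \<Rightarrow> 'a::euclidean_space) \<Rightarrow> real \<Rightarrow> 'a" where
  "weak_deriv u = (SOME v. is_weak_deriv u v)"

definition H2 :: "(real \<Rightarrow> 'a::euclidean_space) \<Rightarrow> bool" where
  "H2 u \<longleftrightarrow> L2 u \<and> (\<exists>v. is_weak_deriv u v \<and> (\<exists>w. is_weak_deriv v w))"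

definition H2_inner :: "(real \<Rightarrow> 'a::euclidean_space) \<Rightarrow> (real \<Rightarrow> 'a) \<Rightarrow> real" where
  "H2_inner u h = (LINT t:{0..1}|lborel. u t \<bullet> h t)
     + (LINT t:{0..1}|lborel. weak_deriv u t \<bullet> weak_deriv h t)
     + (LINT t:{0..1}|lborel. weak_deriv (weak_deriv u) t \<bullet> weak_deriv (weak_deriv h) t)"

definition weak_H2_conv ::
    "(nat \<Rightarrow> real \<Rightarrow> 'a::euclidean_space) \<Rightarrow> (real \<Rightarrow> 'a) \<Rightarrow> bool" where
  "weak_H2_conv u u' \<longleftrightarrow> (\<forall>n. H2 (u n)) \<and> H2 u' \<and>
     (\<forall>h. H2 h \<longrightarrow> (\<lambda>n. H2_inner (u n) h) \<longlonglongrightarrow> H2_inner u' h)"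

text \<open>The classical derivative on \<open>[0,1]\<close>, one-sided at the end points.\<close>

definition velocity :: "(real \<Rightarrow> 'a::euclidean_space) \<Rightarrow> real \<Rightarrow> 'a" where
  "velocity u t = vector_derivative u (at t within {0..1})"

definition C1 :: "(real \<Rightarrow> 'a::euclidean_space) \<Rightarrow> bool" where
  "C1 u \<longleftrightarrow> u differentiable_on {0..1} \<and> continuous_on {0..1} (velocity u)"

text \<open>The \<open>C\<^sup>1\<^sup>,\<^sup>\<alpha>\<close> norm, meaningful for \<open>C1\<close> functions and possibly infinite.\<close>

definition C1_holder_norm :: "real \<Rightarrow> (real \<Rightarrow> 'a::euclidean_space) \<Rightarrow> ennreal" where
  "C1_holder_norm \<alpha> u = (SUP t\<in>{0..1}. ennreal (norm (u t)))
     + (SUP t\<in>{0..1}. ennreal (norm (velocity u t)))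
     + (SUP (s, t)\<in>{(s, t). s \<in> {0..1} \<and> t \<in> {0..1} \<and> s \<noteq> t}.
          ennreal (norm (velocity u s - velocity u t) / \<bar>s - t\<bar> powr \<alpha>))"

definition C1_holder :: "real \<Rightarrow> (real \<Rightarrow> 'a::euclidean_space) \<Rightarrow> bool" where
  "C1_holder \<alpha> u \<longleftrightarrow> C1 u \<and> C1_holder_norm \<alpha> u < \<infinity>"

definition C1_holder_conv ::
    "real \<Rightarrow> (nat \<Rightarrow> real \<Rightarrow> 'a::euclidean_space) \<Rightarrow> (real \<Rightarrow> 'a) \<Rightarrow> bool" where
  "C1_holder_conv \<alpha> u u' \<longleftrightarrow> (\<forall>n. C1_holder \<alpha> (u n)) \<and> C1_holder \<alpha> u' \<and>
     (\<lambda>n. C1_holder_norm \<alpha> (\<lambda>t. u n t - u' t)) \<longlonglongrightarrow> 0"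

section \<open>Curves\<close>

definition singular_curve :: "(real \<Rightarrow> 'a::euclidean_space) \<Rightarrow> bool" where
  "singular_curve \<gamma> \<longleftrightarrow> \<gamma> constant_on {0..1}"

definition immersion :: "(real \<Rightarrow> 'a::euclidean_space) \<Rightarrow> bool" where
  "immersion \<gamma> \<longleftrightarrow> C1 \<gamma> \<and> (\<forall>t\<in>{0..1}. velocity \<gamma> t \<noteq> 0)"

definition regular_curve :: "(real \<Rightarrow> 'a::euclidean_space) \<Rightarrow> bool" where
  "regular_curve \<gamma> \<longleftrightarrow> immersion \<gamma> \<and> H2 \<gamma>"

text \<open>
  Admissible changes of parameter: orientation-preserving \<open>C\<^sup>1\<close> diffeomorphisms of \<open>[0,1]\<close> of
  class \<open>H\<^sup>2\<close>. They fix both end points, so the labels \<open>(z,i)\<close> of the ends of an edge are kept.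
\<close>

definition reparam :: "(real \<Rightarrow> real) \<Rightarrow> bool" where
  "reparam \<sigma> \<longleftrightarrow> \<sigma> 0 = 0 \<and> \<sigma> 1 = 1 \<and> C1 \<sigma> \<and> H2 \<sigma> \<and> (\<forall>t\<in>{0..1}. velocity \<sigma> t > 0)"

definition unit_tangent :: "(real \<Rightarrow> 'a::euclidean_space) \<Rightarrow> real \<Rightarrow> 'a" where
  "unit_tangent \<gamma> t = velocity \<gamma> t /\<^sub>R norm (velocity \<gamma> t)"

definition outer_tangent :: "(real \<Rightarrow> 'a::euclidean_space) \<Rightarrow> real \<Rightarrow> 'a" where
  "outer_tangent \<gamma> z = (if z = 0 then unit_tangent \<gamma> z else - unit_tangent \<gamma> z)"

text \<open>
  The curvature vector is the arclength derivative of the unit tangent, where the arclength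
  derivative is \<open>1/|\<gamma>'|\<close> times the (weak) derivative in the parameter.
\<close>

definition curvature :: "(real \<Rightarrow> 'a::euclidean_space) \<Rightarrow> real \<Rightarrow> 'a" where
  "curvature \<gamma> t = weak_deriv (unit_tangent \<gamma>) t /\<^sub>R norm (velocity \<gamma> t)"

definition curve_length :: "(real \<Rightarrow> 'a::euclidean_space) \<Rightarrow> real" where
  "curve_length \<gamma> = (LINT t:{0..1}|lborel. norm (velocity \<gamma> t))"

definition bending_energy :: "(real \<Rightarrow> 'a::euclidean_space) \<Rightarrow> real" where
  "bending_energy \<gamma> =
     (LINT t:{0..1}|lborel. (norm (curvature \<gamma> t))\<^sup>2 * norm (velocity \<gamma> t))"

text \<open>For an immersion this says that it is a monotone parametrization of a segment.\<close>

definition straight_segment :: "(real \<Rightarrow> 'a::euclidean_space) \<Rightarrow> bool" where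
  "straight_segment \<gamma> \<longleftrightarrow> \<gamma> ` {0..1} = closed_segment (\<gamma> 0) (\<gamma> 1)"

section \<open>Graphs\<close>

text \<open>
  An \<open>N\<close>-graph is given by the equivalence relation \<open>r\<close> on \<open>E = [0,1] \<times> {1..N}\<close>; its points are
  the equivalence classes, so \<open>\<pi>\<^sup>-\<^sup>1(p)\<close> is the set \<open>p\<close> itself. A subgraph is encoded by the set
  \<open>S \<subseteq> {1..N}\<close> of the indices of its edges.
\<close>

type_synonym point = "real \<times> nat"

definition edge_space :: "nat set \<Rightarrow> point set" where
  "edge_space S = {0..1} \<times> S"

definition end_points :: "nat set \<Rightarrow> point set" where
  "end_points S = {0, 1} \<times> S"

definition N_graph :: "nat \<Rightarrow> (point \<times> point) set \<Rightarrow> bool" where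
  "N_graph N r \<longleftrightarrow> N \<ge> 1 \<and> equiv (edge_space {1..N}) r
     \<and> r \<subseteq> Id \<union> end_points {1..N} \<times> end_points {1..N}"

definition proj :: "(point \<times> point) set \<Rightarrow> point \<Rightarrow> point set" where
  "proj r x = r `` {x}"

definition graph_topology :: "nat \<Rightarrow> (point \<times> point) set \<Rightarrow> point set topology" where
  "graph_topology N r = topology (\<lambda>U. U \<subseteq> edge_space {1..N} // r \<and>
     openin (top_of_set (edge_space {1..N})) {x \<in> edge_space {1..N}. proj r x \<in> U})"

lemma openin_graph_topology:
  "openin (graph_topology N r) U \<longleftrightarrow> U \<subseteq> edge_space {1..N} // r \<and>
     openin (top_of_set (edge_space {1..N})) {x \<in> edge_space {1..N}. proj r x \<in> U}"
proof -
  let ?E = "edge_space {1..N}"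
  let ?P = "\<lambda>U. U \<subseteq> ?E // r \<and> openin (top_of_set ?E) {x \<in> ?E. proj r x \<in> U}"
  have inter: "?P (S \<inter> T)" if "?P S" "?P T" for S T
  proof -
    have "{x \<in> ?E. proj r x \<in> S \<inter> T} = {x \<in> ?E. proj r x \<in> S} \<inter> {x \<in> ?E. proj r x \<in> T}"
      by auto
    then show ?thesis using that by (auto simp: openin_Int)
  qed
  have union: "?P (\<Union>K)" if "\<forall>S\<in>K. ?P S" for K
  proof -
    have "{x \<in> ?E. proj r x \<in> \<Union>K} = \<Union>((\<lambda>S. {x \<in> ?E. proj r x \<in> S}) ` K)"
      by auto
    moreover have "openin (top_of_set ?E) (\<Union>((\<lambda>S. {x \<in> ?E. proj r x \<in> S}) ` K))"
      using that by (intro openin_Union) auto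
    ultimately show ?thesis using that by auto
  qed
  have "istopology ?P"
    unfolding istopology_def using inter union by blast
  then show ?thesis
    unfolding graph_topology_def by (simp add: topology_inverse')
qed

definition subgraph_points :: "(point \<times> point) set \<Rightarrow> nat set \<Rightarrow> point set set" where
  "subgraph_points r S = proj r ` edge_space S"

text \<open>
  An assignment of angles gives the vectors \<open>d\<^sup>z\<^sup>,\<^sup>i = D (z,i)\<close>; subgraphs inherit \<open>D\<close>.
\<close>

definition angle_assignment :: "nat \<Rightarrow> (point \<Rightarrow> 'a::euclidean_space) \<Rightarrow> bool" where
  "angle_assignment N D \<longleftrightarrow> (\<forall>x\<in>end_points {1..N}. norm (D x) = 1)"

section \<open>Networks\<close>

definition edge_curve ::
    "(point \<times> point) set \<Rightarrow> (point set \<Rightarrow> 'a::euclidean_space) \<Rightarrow> nat \<Rightarrow> real \<Rightarrow> 'a" where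
  "edge_curve r \<Gamma> i t = \<Gamma> (proj r (t, i))"

text \<open>
  \<open>network N r S \<Gamma>\<close>: \<open>\<Gamma>\<close>, restricted to the subgraph \<open>S\<close>, is a network on that subgraph.
  Networks on the whole graph are obtained for \<open>S = {1..N}\<close>.
\<close>

definition network ::
    "nat \<Rightarrow> (point \<times> point) set \<Rightarrow> nat set \<Rightarrow> (point set \<Rightarrow> 'a::euclidean_space) \<Rightarrow> bool" where
  "network N r S \<Gamma> \<longleftrightarrow> S \<subseteq> {1..N}
     \<and> continuous_map (subtopology (graph_topology N r) (subgraph_points r S)) euclidean \<Gamma>
     \<and> (\<forall>i\<in>S. singular_curve (edge_curve r \<Gamma> i) \<or> regular_curve (edge_curve r \<Gamma> i))"

definition Sing ::
    "(point \<times> point) set \<Rightarrow> nat set \<Rightarrow> (point set \<Rightarrow> 'a::euclidean_space) \<Rightarrow> nat set" where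
  "Sing r S \<Gamma> = {i \<in> S. singular_curve (edge_curve r \<Gamma> i)}"

text \<open>The angle condition, with the (real or virtual) tangents \<open>\<tau>\<close> made explicit.\<close>

definition angle_condition_with ::
    "(point \<times> point) set \<Rightarrow> (point \<Rightarrow> real ^ 'd) \<Rightarrow> nat set \<Rightarrow> (point set \<Rightarrow> real ^ 'd)
      \<Rightarrow> (point \<Rightarrow> real ^ 'd) \<Rightarrow> bool" where
  "angle_condition_with r D S \<Gamma> \<tau> \<longleftrightarrow>
     (\<forall>i\<in>S. regular_curve (edge_curve r \<Gamma> i) \<longrightarrow>
        (\<forall>z\<in>{0, 1}. \<tau> (z, i) = outer_tangent (edge_curve r \<Gamma> i) z)) \<and>
     (\<forall>i\<in>S. singular_curve (edge_curve r \<Gamma> i) \<longrightarrow>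
        norm (\<tau> (0, i)) = 1 \<and> norm (\<tau> (1, i)) = 1 \<and> \<tau> (0, i) = - \<tau> (1, i)) \<and>
     (\<forall>p\<in>proj r ` end_points S. \<exists>R :: real ^ 'd ^ 'd. rotation_matrix R \<and>
        (\<forall>x\<in>end_points S. proj r x = p \<longrightarrow> \<tau> x = R *v D x))"

definition angle_condition ::
    "(point \<times> point) set \<Rightarrow> (point \<Rightarrow> real ^ 'd) \<Rightarrow> nat set \<Rightarrow> (point set \<Rightarrow> real ^ 'd) \<Rightarrow> bool"
  where "angle_condition r D S \<Gamma> \<longleftrightarrow> (\<exists>\<tau>. angle_condition_with r D S \<Gamma> \<tau>)"

text \<open>
  Stratified straight subgraphs, whose strata all share the tangents \<open>\<tau>\<close>. The case \<open>q = 0\<close> is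
  the empty subgraph.
\<close>

definition stratified_straight_with ::
    "nat \<Rightarrow> (point \<times> point) set \<Rightarrow> (point \<Rightarrow> real ^ 'd) \<Rightarrow> nat set \<Rightarrow> (point \<Rightarrow> real ^ 'd)
      \<Rightarrow> bool" where
  "stratified_straight_with N r D S \<tau> \<longleftrightarrow>
     (\<exists>(q :: nat) (H :: nat \<Rightarrow> nat set) (\<Sigma> :: nat \<Rightarrow> point set \<Rightarrow> real ^ 'd).
        H 0 = S \<and> H q = {} \<and>
        (\<forall>j<q. H (Suc j) \<subset> H j
           \<and> network N r (H j) (\<Sigma> j)
           \<and> angle_condition_with r D (H j) (\<Sigma> j) \<tau>
           \<and> (\<forall>i\<in>H j. regular_curve (edge_curve r (\<Sigma> j) i) \<longrightarrow>
                straight_segment (edge_curve r (\<Sigma> j) i))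
           \<and> H (Suc j) = Sing r (H j) (\<Sigma> j)))"

definition C_Reg ::
    "nat \<Rightarrow> (point \<times> point) set \<Rightarrow> (point \<Rightarrow> real ^ 'd) \<Rightarrow> (point set \<Rightarrow> real ^ 'd) \<Rightarrow> bool" where
  "C_Reg N r D \<Gamma> \<longleftrightarrow>
     network N r {1..N} \<Gamma> \<and> Sing r {1..N} \<Gamma> = {} \<and> angle_condition r D {1..N} \<Gamma>"

definition C_Deg ::
    "nat \<Rightarrow> (point \<times> point) set \<Rightarrow> (point \<Rightarrow> real ^ 'd) \<Rightarrow> (point set \<Rightarrow> real ^ 'd) \<Rightarrow> bool" where
  "C_Deg N r D \<Gamma> \<longleftrightarrow> network N r {1..N} \<Gamma> \<and>
     (\<exists>\<tau>. angle_condition_with r D {1..N} \<Gamma> \<tau> \<and>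
          stratified_straight_with N r D (Sing r {1..N} \<Gamma>) \<tau>)"

definition energy ::
    "nat \<Rightarrow> (point \<times> point) set \<Rightarrow> (point set \<Rightarrow> 'a::euclidean_space) \<Rightarrow> real" where
  "energy N r \<Gamma> = (\<Sum>i | i \<in> {1..N} \<and> regular_curve (edge_curve r \<Gamma> i).
     bending_energy (edge_curve r \<Gamma> i) + curve_length (edge_curve r \<Gamma> i))"

text \<open>
  Convergence of networks, up to reparametrization of the curves, with respect to a given notion
  \<open>conv\<close> of convergence of parametrized curves.
\<close>

definition network_conv ::
    "((nat \<Rightarrow> real \<Rightarrow> 'a) \<Rightarrow> (real \<Rightarrow> 'a) \<Rightarrow> bool) \<Rightarrow> nat \<Rightarrow> (point \<times> point) set
      \<Rightarrow> (nat \<Rightarrow> point set \<Rightarrow> 'a::euclidean_space) \<Rightarrow> (point set \<Rightarrow> 'a) \<Rightarrow> bool" where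
  "network_conv conv N r \<Gamma> \<Gamma>' \<longleftrightarrow> (\<forall>i\<in>{1..N}. \<exists>\<sigma> :: nat \<Rightarrow> real \<Rightarrow> real.
     (\<forall>n. reparam (\<sigma> n)) \<and> conv (\<lambda>n. edge_curve r (\<Gamma> n) i \<circ> \<sigma> n) (edge_curve r \<Gamma>' i))"

end

theory Submission
  imports Defs "HOL-Complex_Analysis.Great_Picard"
begin

text \<open>
  Why a bound on length and bending energy gives compactness up to degeneration.

  \<^emph>\<open>Each edge.\<close> Parametrize every edge by constant speed (\<open>regular_curve_const_speed\<close>). If the length is
  \<open>l\<close> and the bending energy at most \<open>K\<close>, the velocity of the new parametrization satisfies
  \<open>|c'(t) - c'(s)|\<^sup>2 \<le> (t - s) (\<Phi>(t) - \<Phi>(s))\<close> for a nondecreasing \<open>\<Phi>\<close> of total increment at most \<open>l\<^sup>3 K\<close>. So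
  the velocities are Hoelder continuous of exponent \<open>1/2\<close> with a common constant, and the theorem of Arzela
  and Ascoli yields a subsequence that converges in \<open>C\<^sup>1\<close>. The existence of such a \<open>\<Phi>\<close> characterizes
  functions with square integrable weak derivative (\<open>bounded_denergy_imp_primitive\<close>): the dyadic difference
  quotients of the function form an \<open>L\<^sup>2\<close> bounded martingale. Their energies are finite sums and pass to
  pointwise limits, so the limit is of class \<open>H\<^sup>2\<close>. The same martingale argument gives the density of step
  functions, and with it weak convergence of the second derivatives; interpolation gives convergence in
  \<open>C\<^sup>1\<^sup>,\<^sup>\<alpha>\<close> (\<open>H2_holder_convergence\<close>).

  \<^emph>\<open>The whole graph.\<close> The displacements between the ends of the edges converge. On a connected graph they
  determine the vertices up to a common translation (\<open>displacement_limit\<close>, \<open>connected_graph_constant\<close>), so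
  after one translation of each network all edges converge and fit together to a limit network. An edge
  becomes singular exactly when its length tends to zero. Its tangent turns by at most \<open>sqrt (l * K)\<close>, so
  the tangents at its ends become opposite and serve as virtual tangents, and the angle condition passes to
  the limit because the rotation group is compact.

  \<^emph>\<open>The singular part.\<close> Let \<open>\<tau>\<close> satisfy the angle condition on a subgraph and be opposite at the two ends
  of each edge. The subgraph is stratified straight with tangents \<open>\<tau>\<close> if and only if, for every \<open>e > 0\<close>, its
  vertices can be placed so that every edge has a nonzero displacement whose direction is \<open>\<tau>\<close> up to a
  relative error \<open>e\<close> (\<open>approx_straight\<close>). Given a stratification, add the successive networks with rapidly
  decreasing weights (\<open>stratified_imp_approx_straight\<close>); conversely, the orders of magnitude of the
  displacements in a sequence of better and better placements are the strata
  (\<open>approx_straight_imp_stratified\<close>). This condition suits limits. Edges that shrink to a point are almost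
  straight beforehand, hence already placed correctly by the vertices of an approximating network. Edges
  that were singular beforehand are placed correctly by an arbitrarily small perturbation of these
  vertices, because the singular part of the approximating network is stratified straight.

  Regular networks with the angle condition are degenerate networks with empty singular part, so the
  second assertion is a case of the first.
\<close>

section \<open>Square integrable functions on the unit interval\<close>

text \<open>
  A measure whose space is the unit interval itself: measurability and integrability then need no
  indicator functions, and the automation for finite measures applies.
\<close>

definition leb01 :: "real measure" where
  "leb01 = restrict_space lborel {0..1}"

lemma space_leb01 [simp]: "space leb01 = {0..1}"
  by (simp add: leb01_def space_restrict_space)

lemma borel_measurable_leb01I: "f \<in> borel_measurable borel \<Longrightarrow> f \<in> borel_measurable leb01"
  unfolding leb01_def by (metis measurable_lborel2 measurable_restrict_space1)

lemma measurable_id_leb01 [measurable (raw)]: "(\<lambda>x. x) \<in> borel_measurable leb01"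
  by (rule borel_measurable_leb01I) simp

lemma sets_leb01_Icc [measurable]: "0 \<le> a \<Longrightarrow> b \<le> 1 \<Longrightarrow> {a..b} \<in> sets leb01"
  by (auto simp: leb01_def sets_restrict_space intro!: image_eqI[of _ _ "{a..b}"])

lemma sets_leb01_iff: "A \<in> sets leb01 \<longleftrightarrow> A \<subseteq> {0..1} \<and> A \<in> sets borel"
  by (simp add: leb01_def sets_restrict_space_iff)

interpretation leb01: finite_measure leb01
  by standard (simp add: leb01_def emeasure_restrict_space space_restrict_space)

lemma measure_leb01_Ioc: "0 \<le> a \<Longrightarrow> a \<le> b \<Longrightarrow> b \<le> 1 \<Longrightarrow> measure leb01 {a<..b} = b - a"
  by (subst leb01_def, subst measure_restrict_space) auto

lemma measure_leb01_Icc: "0 \<le> a \<Longrightarrow> a \<le> b \<Longrightarrow> b \<le> 1 \<Longrightarrow> measure leb01 {a..b} = b - a"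
  by (subst leb01_def, subst measure_restrict_space) auto

lemma lint_leb01:
  fixes f :: "real \<Rightarrow> 'a::euclidean_space"
  shows "(LINT t:{0..1}|lborel. f t) = (LINT t|leb01. f t)"
  by (simp add: leb01_def integral_restrict_space set_lebesgue_integral_def)

lemma set_integrable_leb01:
  fixes f :: "real \<Rightarrow> 'a::euclidean_space"
  shows "set_integrable lborel {0..1} f \<longleftrightarrow> integrable leb01 f"
  by (simp add: leb01_def integrable_restrict_space set_integrable_def)

lemma set_borel_measurable_leb01:
  fixes f :: "real \<Rightarrow> 'a::euclidean_space"
  shows "set_borel_measurable lborel {0..1} f \<longleftrightarrow> f \<in> borel_measurable leb01"
  by (simp add: leb01_def set_borel_measurable_def borel_measurable_restrict_space_iff)

lemma continuous_on_measurable_leb01: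
  fixes f :: "real \<Rightarrow> 'a::euclidean_space"
  assumes "continuous_on {0..1} f"
  shows "f \<in> borel_measurable leb01"
  using set_measurable_continuous_on[OF _ assms] set_borel_measurable_leb01[of f]
  by (auto simp: set_borel_measurable_def)

lemma continuous_on_integrable_leb01:
  fixes f :: "real \<Rightarrow> 'a::euclidean_space"
  assumes "continuous_on {0..1} f"
  shows "integrable leb01 f"
  using borel_integrable_atLeastAtMost'[OF assms] set_integrable_leb01 by blast

lemma L2_iff:
  "L2 u \<longleftrightarrow> u \<in> borel_measurable leb01 \<and> integrable leb01 (\<lambda>t. (norm (u t))\<^sup>2)"
  by (simp add: L2_def set_integrable_leb01 set_borel_measurable_leb01)

lemma L2_measurable: "L2 u \<Longrightarrow> u \<in> borel_measurable leb01"
  by (simp add: L2_iff)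

lemma L2_sq: "L2 u \<Longrightarrow> integrable leb01 (\<lambda>t. (norm (u t))\<^sup>2)"
  by (simp add: L2_iff)

lemma L2_bound:
  fixes u :: "real \<Rightarrow> 'a::euclidean_space"
  assumes "u \<in> borel_measurable leb01" "integrable leb01 f"
    and "AE t in leb01. (norm (u t))\<^sup>2 \<le> f t"
  shows "L2 u"
proof -
  have "integrable leb01 (\<lambda>t. (norm (u t))\<^sup>2)"
    by (rule Bochner_Integration.integrable_bound[OF assms(2)])
      (use assms in \<open>auto intro: order_trans[OF _ abs_ge_self]\<close>)
  then show ?thesis using assms by (simp add: L2_iff)
qed

lemma L2_integrable:
  fixes u :: "real \<Rightarrow> 'a::euclidean_space"
  assumes "L2 u" shows "integrable leb01 u"
proof (rule Bochner_Integration.integrable_bound)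
  show "integrable leb01 (\<lambda>t. 1 + (norm (u t))\<^sup>2)" using L2_sq[OF assms] by simp
  have "norm x \<le> 1 + (norm x)\<^sup>2" for x :: 'a
  proof -
    have "0 \<le> (norm x - 1 / 2)\<^sup>2" by simp
    then show ?thesis by (simp add: power2_diff power_divide)
  qed
  then show "AE t in leb01. norm (u t) \<le> norm (1 + (norm (u t))\<^sup>2)"
    by (simp add: abs_of_nonneg)
qed (rule L2_measurable[OF assms])

lemma L2_inner_integrable:
  fixes u v :: "real \<Rightarrow> 'a::euclidean_space"
  assumes "L2 u" "L2 v" shows "integrable leb01 (\<lambda>t. u t \<bullet> v t)"
proof (rule Bochner_Integration.integrable_bound)
  show "integrable leb01 (\<lambda>t. (norm (u t))\<^sup>2 + (norm (v t))\<^sup>2)"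
    using L2_sq[OF assms(1)] L2_sq[OF assms(2)] by simp
  have "\<bar>x \<bullet> y\<bar> \<le> (norm x)\<^sup>2 + (norm y)\<^sup>2" for x y :: 'a
  proof -
    have "\<bar>x \<bullet> y\<bar> \<le> norm x * norm y" by (rule Cauchy_Schwarz_ineq2)
    also have "\<dots> \<le> (norm x)\<^sup>2 + (norm y)\<^sup>2"
    proof -
      have "0 \<le> norm x * norm y" by simp
      then show ?thesis using sum_squares_bound[of "norm x" "norm y"] by linarith
    qed
    finally show ?thesis .
  qed
  then show "AE t in leb01. norm (u t \<bullet> v t) \<le> norm ((norm (u t))\<^sup>2 + (norm (v t))\<^sup>2)"
    by (simp add: abs_of_nonneg)
  note [measurable] = L2_measurable[OF assms(1)] L2_measurable[OF assms(2)]
  show "(\<lambda>t. u t \<bullet> v t) \<in> borel_measurable leb01" by measurable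
qed

lemma norm_add_sq:
  fixes x y :: "'a::real_inner"
  shows "(norm (x + y))\<^sup>2 = (norm x)\<^sup>2 + 2 * (x \<bullet> y) + (norm y)\<^sup>2"
  by (simp add: power2_norm_eq_inner inner_add_left inner_add_right inner_commute)

lemma L2_add:
  fixes u v :: "real \<Rightarrow> 'a::euclidean_space"
  assumes "L2 u" "L2 v" shows "L2 (\<lambda>t. u t + v t)"
proof (rule L2_bound)
  show "integrable leb01 (\<lambda>t. (norm (u t))\<^sup>2 + 2 * (u t \<bullet> v t) + (norm (v t))\<^sup>2)"
    using L2_sq[OF assms(1)] L2_sq[OF assms(2)] L2_inner_integrable[OF assms] by simp
  note [measurable] = L2_measurable[OF assms(1)] L2_measurable[OF assms(2)]
  show "(\<lambda>t. u t + v t) \<in> borel_measurable leb01" by measurable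
qed (simp add: norm_add_sq)

lemma L2_scaleR:
  fixes u :: "real \<Rightarrow> 'a::euclidean_space"
  assumes "L2 u" shows "L2 (\<lambda>t. c *\<^sub>R u t)"
proof (rule L2_bound)
  note [measurable] = L2_measurable[OF assms]
  show "(\<lambda>t. c *\<^sub>R u t) \<in> borel_measurable leb01" by measurable
  show "integrable leb01 (\<lambda>t. c\<^sup>2 * (norm (u t))\<^sup>2)" using L2_sq[OF assms] by simp
qed (simp add: power_mult_distrib)

lemma L2_diff:
  fixes u v :: "real \<Rightarrow> 'a::euclidean_space"
  assumes "L2 u" "L2 v" shows "L2 (\<lambda>t. u t - v t)"
  using L2_add[OF assms(1) L2_scaleR[OF assms(2), of "-1"]] by simp

lemma L2_continuous:
  fixes u :: "real \<Rightarrow> 'a::euclidean_space"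
  assumes "continuous_on {0..1} u" shows "L2 u"
  unfolding L2_iff using assms
  by (auto intro!: continuous_on_measurable_leb01 continuous_on_integrable_leb01 continuous_intros)

text \<open>
  The quadratic polynomial \<open>l \<mapsto> \<integral> (f + l g)\<^sup>2\<close> is nonnegative; evaluate it at its minimum \<open>- b / c\<close>, or,
  if \<open>c = 0\<close>, let the remaining affine function violate nonnegativity unless \<open>b = 0\<close>.
\<close>

lemma Cauchy_Schwarz_integral:
  fixes f g :: "'b \<Rightarrow> real"
  assumes [measurable]: "f \<in> borel_measurable M" "g \<in> borel_measurable M"
    and f2: "integrable M (\<lambda>x. (f x)\<^sup>2)" and g2: "integrable M (\<lambda>x. (g x)\<^sup>2)"
  shows "integrable M (\<lambda>x. f x * g x)"
    and "(LINT x|M. f x * g x)\<^sup>2 \<le> (LINT x|M. (f x)\<^sup>2) * (LINT x|M. (g x)\<^sup>2)"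
proof -
  have bd: "\<bar>x * y\<bar> \<le> x\<^sup>2 + y\<^sup>2" for x y :: real
  proof -
    have "0 \<le> \<bar>x\<bar> * \<bar>y\<bar>" by simp
    then have "\<bar>x\<bar> * \<bar>y\<bar> \<le> \<bar>x\<bar>\<^sup>2 + \<bar>y\<bar>\<^sup>2"
      using sum_squares_bound[of "\<bar>x\<bar>" "\<bar>y\<bar>"] by linarith
    then show ?thesis by (simp add: abs_mult)
  qed
  show fg: "integrable M (\<lambda>x. f x * g x)"
    by (rule Bochner_Integration.integrable_bound[of M "\<lambda>x. (f x)\<^sup>2 + (g x)\<^sup>2"])
      (use f2 g2 bd in \<open>auto simp: abs_of_nonneg\<close>)
  define a b c where "a = (LINT x|M. (f x)\<^sup>2)" "b = (LINT x|M. f x * g x)"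
    "c = (LINT x|M. (g x)\<^sup>2)"
  have quad: "a + 2 * l * b + l\<^sup>2 * c \<ge> 0" for l
  proof -
    have "0 \<le> (LINT x|M. (f x + l * g x)\<^sup>2)" by simp
    also have "(\<lambda>x. (f x + l * g x)\<^sup>2) = (\<lambda>x. (f x)\<^sup>2 + 2 * l * (f x * g x) + l\<^sup>2 * (g x)\<^sup>2)"
      by (auto simp: power2_sum power_mult_distrib algebra_simps)
    also have "(LINT x|M. \<dots> x) = a + 2 * l * b + l\<^sup>2 * c"
      using f2 g2 fg by (simp add: a_b_c_def)
    finally show ?thesis .
  qed
  have c0: "c \<ge> 0" by (simp add: a_b_c_def)
  show "(LINT x|M. f x * g x)\<^sup>2 \<le> (LINT x|M. (f x)\<^sup>2) * (LINT x|M. (g x)\<^sup>2)"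
    unfolding a_b_c_def[symmetric]
  proof (cases "c = 0")
    case True
    have "b = 0"
    proof (rule ccontr)
      assume "b \<noteq> 0"
      with quad[of "- (a + 1) / (2 * b)"] True show False by (simp add: field_simps)
    qed
    then show "b\<^sup>2 \<le> a * c" using True by simp
  next
    case False
    with c0 have "c > 0" by simp
    with quad[of "- b / c"] show "b\<^sup>2 \<le> a * c"
      by (simp add: field_simps power2_eq_square)
  qed
qed

text \<open>
  The source of the Hoelder exponent \<open>1/2\<close> of a primitive: the factor \<open>measure leb01 A\<close> is the length of
  the interval over which the derivative is integrated.
\<close>

lemma L2_norm_integral_le:
  fixes u :: "real \<Rightarrow> 'a::euclidean_space"
  assumes "L2 u" and [measurable]: "A \<in> sets leb01"
  shows "(norm (LINT t:A|leb01. u t))\<^sup>2 \<le> measure leb01 A * (LINT t:A|leb01. (norm (u t))\<^sup>2)"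
proof -
  note [measurable] = L2_measurable[OF assms(1)]
  have i1: "integrable leb01 (\<lambda>t. (indicator A t * norm (u t))\<^sup>2)"
    using integrable_mult_indicator[OF assms(2) L2_sq[OF assms(1)]]
    by (rule back_subst[where P="integrable leb01"]) (auto simp: fun_eq_iff split: split_indicator)
  have i2: "integrable leb01 (\<lambda>t. (indicator A t :: real)\<^sup>2)"
    by (rule back_subst[where P="integrable leb01", of "indicator A"])
      (auto simp: fun_eq_iff leb01.emeasure_finite less_top[symmetric] split: split_indicator)
  have "norm (LINT t:A|leb01. u t) \<le> (LINT t:A|leb01. norm (u t))"
    unfolding set_lebesgue_integral_def
    by (rule order_trans[OF integral_norm_bound]) simp
  also have "\<dots> = (LINT t|leb01. (indicator A t * norm (u t)) * indicator A t)"
    unfolding set_lebesgue_integral_def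
    by (intro Bochner_Integration.integral_cong) (auto split: split_indicator)
  finally have "(norm (LINT t:A|leb01. u t))\<^sup>2 \<le>
      (LINT t|leb01. (indicator A t * norm (u t)) * indicator A t)\<^sup>2"
    by (intro power_mono) auto
  also have "\<dots> \<le> (LINT t|leb01. (indicator A t * norm (u t))\<^sup>2) * (LINT t|leb01. (indicator A t)\<^sup>2)"
    by (rule Cauchy_Schwarz_integral) (use i1 i2 in measurable)
  also have "(LINT t|leb01. (indicator A t * norm (u t))\<^sup>2) = (LINT t:A|leb01. (norm (u t))\<^sup>2)"
    unfolding set_lebesgue_integral_def
    by (intro Bochner_Integration.integral_cong) (auto split: split_indicator)
  also have "(LINT t|leb01. (indicator A t :: real)\<^sup>2) = (LINT t|leb01. indicator A t)"
    by (intro Bochner_Integration.integral_cong) (auto split: split_indicator)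
  also have "\<dots> = measure leb01 A"
    using sets.sets_into_space[OF assms(2)] by (simp add: Int_absorb2)
  finally show ?thesis by (simp add: mult.commute)
qed

lemma L2_inner_bound:
  fixes u v :: "real \<Rightarrow> 'a::euclidean_space"
  assumes "L2 u" "L2 v"
  shows "(LINT t|leb01. u t \<bullet> v t)\<^sup>2 \<le> (LINT t|leb01. (norm (u t))\<^sup>2) * (LINT t|leb01. (norm (v t))\<^sup>2)"
proof -
  note [measurable] = L2_measurable[OF assms(1)] L2_measurable[OF assms(2)]
  have "\<bar>LINT t|leb01. u t \<bullet> v t\<bar> \<le> (LINT t|leb01. norm (u t) * norm (v t))"
  proof -
    have "norm (LINT t|leb01. u t \<bullet> v t) \<le> (LINT t|leb01. norm (u t) * norm (v t))"
    proof (rule Bochner_Integration.integral_norm_bound_integral)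
      show "integrable leb01 (\<lambda>t. norm (u t) * norm (v t))"
        by (rule Cauchy_Schwarz_integral) (simp_all add: L2_sq assms)
    qed (simp_all add: L2_inner_integrable assms Cauchy_Schwarz_ineq2)
    then show ?thesis by simp
  qed
  then have "(LINT t|leb01. u t \<bullet> v t)\<^sup>2 \<le> (LINT t|leb01. norm (u t) * norm (v t))\<^sup>2"
    using abs_le_square_iff[of "LINT t|leb01. u t \<bullet> v t" "LINT t|leb01. norm (u t) * norm (v t)"]
    by linarith
  also have "\<dots> \<le> (LINT t|leb01. (norm (u t))\<^sup>2) * (LINT t|leb01. (norm (v t))\<^sup>2)"
    by (rule Cauchy_Schwarz_integral) (simp_all add: L2_sq assms)
  finally show ?thesis .
qed

section \<open>Primitives\<close>

definition antideriv :: "(real \<Rightarrow> 'a::euclidean_space) \<Rightarrow> real \<Rightarrow> 'a" where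
  "antideriv w t = (LINT s:{0..t}|leb01. w s)"

lemma set_integrable_leb01_sub:
  fixes f :: "real \<Rightarrow> 'a::euclidean_space"
  assumes "integrable leb01 f" "A \<in> sets leb01"
  shows "set_integrable leb01 A f"
  unfolding set_integrable_def using assms(2,1) by (rule integrable_mult_indicator)

lemma sets_leb01_Ioc [measurable]: "0 \<le> a \<Longrightarrow> b \<le> 1 \<Longrightarrow> {a<..b} \<in> sets leb01"
  by (auto simp: sets_leb01_iff)

lemma antideriv_diff:
  fixes f :: "real \<Rightarrow> 'a::euclidean_space"
  assumes "integrable leb01 f" "0 \<le> a" "a \<le> b" "b \<le> 1"
  shows "antideriv f b - antideriv f a = (LINT s:{a<..b}|leb01. f s)"
proof -
  have "{0..b} = {0..a} \<union> {a<..b}" using assms by auto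
  then have "antideriv f b = antideriv f a + (LINT s:{a<..b}|leb01. f s)"
    unfolding antideriv_def using assms
    by (simp only:) (intro set_integral_Un set_integrable_leb01_sub; auto simp: sets_leb01_iff)
  then show ?thesis by simp
qed

lemma antideriv_0 [simp]: "antideriv f 0 = 0"
proof -
  have "AE t in leb01. t \<noteq> 0"
    unfolding leb01_def by (subst AE_restrict_space_iff) (auto intro: AE_mp[OF AE_lborel_singleton[of 0]])
  then have "AE t in leb01. indicator {0..0} t *\<^sub>R f t = 0"
    by eventually_elim auto
  then show ?thesis unfolding antideriv_def set_lebesgue_integral_def
    by (rule integral_eq_zero_AE)
qed

lemma antideriv_1: "antideriv f 1 = (LINT s|leb01. f s)"
  unfolding antideriv_def set_lebesgue_integral_def
  by (intro Bochner_Integration.integral_cong) auto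

lemma antideriv_lborel:
  fixes f :: "real \<Rightarrow> 'a::euclidean_space"
  assumes "t \<in> {0..1}"
  shows "antideriv f t = (LINT s:{0..t}|lborel. f s)"
  unfolding antideriv_def set_lebesgue_integral_def leb01_def using assms
  by (subst integral_restrict_space)
    (auto intro!: Bochner_Integration.integral_cong split: split_indicator)

lemma antideriv_velocity_diff:
  fixes F :: "real \<Rightarrow> 'a::euclidean_space"
  assumes "\<And>x. x \<in> {0..1} \<Longrightarrow> (F has_vector_derivative f x) (at x within {0..1})"
    and "continuous_on {0..1} f" and "t \<in> {0..1}"
  shows "antideriv f t = F t - F 0"
  unfolding antideriv_lborel[OF assms(3)] set_lebesgue_integral_def
proof (rule integral_FTC_atLeastAtMost)
  show "continuous_on {0..t} f" using assms(2,3) by (auto elim: continuous_on_subset)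
  show "(F has_vector_derivative f x) (at x within {0..t})" if "0 \<le> x" "x \<le> t" for x
    using assms(1)[of x] assms(3) that by (auto elim: has_vector_derivative_within_subset)
qed (use assms in auto)

text \<open>
  The half lines \<open>{..a}\<close> are stable under intersection and generate the Borel sets, so the integral of
  \<open>f\<close> vanishes on every measurable set.
\<close>

lemma antideriv_zero_imp_AE_zero:
  fixes f :: "real \<Rightarrow> 'a::euclidean_space"
  assumes "integrable leb01 f" and zero: "\<And>t. t \<in> {0..1} \<Longrightarrow> antideriv f t = 0"
  shows "AE t in leb01. f t = 0"
proof (rule leb01.density_zero[OF assms(1)])
  have 1: "(LINT t:(A \<inter> {0..1})|leb01. f t) = 0" if "A \<in> sets borel" for A
  proof -
    have "Int_stable (range (\<lambda>a::real. {..a}))"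
      by (auto simp: Int_stable_def)
    moreover have "range (\<lambda>a::real. {..a}) \<subseteq> Pow UNIV" by auto
    moreover have "A \<in> sigma_sets UNIV (range (\<lambda>a::real. {..a}))"
      using that by (simp add: borel_eq_atMost)
    ultimately show ?thesis
    proof (induction rule: sigma_sets_induct_disjoint[consumes 3])
      case (basic B)
      then obtain a where B: "B = {..a}" by auto
      consider "a < 0" | "a \<in> {0..1}" | "a > 1" by fastforce
      then show ?case
      proof cases
        case 1 then have "B \<inter> {0..1} = {}" using B by auto
        then show ?thesis by (simp add: set_lebesgue_integral_def)
      next
        case 2 then have "B \<inter> {0..1} = {0..a}" using B by auto
        then show ?thesis using zero[OF 2] by (simp add: antideriv_def)
      next
        case 3 then have "B \<inter> {0..1} = {0..1}" using B by auto
        then show ?thesis using zero[of 1] by (simp add: antideriv_def)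
      qed
    next
      case empty then show ?case by (simp add: set_lebesgue_integral_def)
    next
      case (compl B)
      have B: "B \<in> sets borel" using compl by (simp add: borel_eq_atMost)
      have "(LINT t:((UNIV - B) \<inter> {0..1}) \<union> (B \<inter> {0..1})|leb01. f t)
          = (LINT t:((UNIV - B) \<inter> {0..1})|leb01. f t) + (LINT t:(B \<inter> {0..1})|leb01. f t)"
        using B by (intro set_integral_Un set_integrable_leb01_sub assms) (auto simp: sets_leb01_iff)
      moreover have "((UNIV - B) \<inter> {0..1}) \<union> (B \<inter> {0..1}) = {0..1}" by auto
      ultimately show ?case using compl zero[of 1] by (simp add: antideriv_def)
    next
      case (union B)
      have B: "B i \<in> sets borel" for i
        using union by (auto simp: borel_eq_atMost)
      have "(LINT t:(\<Union>i. B i \<inter> {0..1})|leb01. f t) = (\<Sum>i. (LINT t:(B i \<inter> {0..1})|leb01. f t))"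
      proof (rule lebesgue_integral_countable_add)
        show "set_integrable leb01 (\<Union>i. B i \<inter> {0..1}) f"
          using B by (intro set_integrable_leb01_sub assms) (auto simp: sets_leb01_iff)
      qed (use B union(1) in \<open>auto simp: sets_leb01_iff disjoint_family_on_def\<close>)
      also have "(\<Union>i. B i \<inter> {0..1}) = \<Union>(range B) \<inter> {0..1}" by auto
      finally show ?case using union by simp
    qed
  qed
  show "(LINT t:A|leb01. f t) = 0" if "A \<in> sets leb01" for A
    using 1[of A] that by (auto simp: sets_leb01_iff Int_absorb2)
qed

definition primitive :: "(real \<Rightarrow> 'a::euclidean_space) \<Rightarrow> (real \<Rightarrow> 'a) \<Rightarrow> bool" where
  "primitive u w \<longleftrightarrow> L2 w \<and> (\<forall>t\<in>{0..1}. antideriv w t = u t - u 0)"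

section \<open>Dyadic difference quotients\<close>

text \<open>
  The slopes of the piecewise linear interpolation of \<open>g\<close> at the points \<open>k / 2\<^sup>n\<close>. The step function
  \<open>dstep g n\<close> is the derivative of this interpolation and \<open>denergy g n\<close> the square of its \<open>L\<^sup>2\<close> norm.
\<close>

definition dslope :: "(real \<Rightarrow> 'a::euclidean_space) \<Rightarrow> nat \<Rightarrow> nat \<Rightarrow> 'a" where
  "dslope g n k = 2 ^ n *\<^sub>R (g (real (Suc k) / 2 ^ n) - g (real k / 2 ^ n))"

definition dstep :: "(real \<Rightarrow> 'a::euclidean_space) \<Rightarrow> nat \<Rightarrow> real \<Rightarrow> 'a" where
  "dstep g n t = (\<Sum>k<2 ^ n. indicator {real k / 2 ^ n<..real (Suc k) / 2 ^ n} t *\<^sub>R dslope g n k)"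

definition denergy :: "(real \<Rightarrow> 'a::euclidean_space) \<Rightarrow> nat \<Rightarrow> real" where
  "denergy g n = (\<Sum>k<2 ^ n. 2 ^ n * (norm (g (real (Suc k) / 2 ^ n) - g (real k / 2 ^ n)))\<^sup>2)"

lemma dyadic_bounds:
  assumes "k < 2 ^ n"
  shows "0 \<le> real k / 2 ^ n" "real k / 2 ^ n \<le> real (Suc k) / 2 ^ n" "real (Suc k) / 2 ^ n \<le> 1"
proof -
  have "real (Suc k) \<le> real (2 ^ n)" using assms by (subst of_nat_le_iff) simp
  then show "real (Suc k) / 2 ^ n \<le> 1" by simp
qed (simp_all add: divide_right_mono)

lemma L2_dstep: "L2 (dstep g n)"
proof (rule L2_bound)
  show "dstep g n \<in> borel_measurable leb01"
    by (rule borel_measurable_leb01I) (unfold dstep_def, measurable)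
  show "integrable leb01 (\<lambda>t. (\<Sum>k<2 ^ n. norm (dslope g n k))\<^sup>2)" by simp
  have "norm (dstep g n t) \<le> (\<Sum>k<2 ^ n. norm (dslope g n k))" for t
    unfolding dstep_def by (rule order_trans[OF norm_sum sum_mono]) (simp split: split_indicator)
  then show "AE t in leb01. (norm (dstep g n t))\<^sup>2 \<le> (\<Sum>k<2 ^ n. norm (dslope g n k))\<^sup>2"
    by (intro AE_I2 power_mono) auto
qed

text \<open>
  A function tested against a dyadic step function is seen only through the increments of its
  primitive over the dyadic intervals.
\<close>

lemma integral_inner_dstep:
  fixes f g :: "real \<Rightarrow> 'a::euclidean_space"
  assumes f: "integrable leb01 f"
  shows "(LINT t|leb01. f t \<bullet> dstep g n t)
    = (\<Sum>k<2 ^ n. (antideriv f (real (Suc k) / 2 ^ n) - antideriv f (real k / 2 ^ n)) \<bullet> dslope g n k)"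
proof -
  let ?J = "\<lambda>k::nat. {real k / 2 ^ n<..real (Suc k) / 2 ^ n}"
  have i: "integrable leb01 (\<lambda>t. indicator (?J k) t *\<^sub>R f t)" if "k < 2 ^ n" for k
    using dyadic_bounds[OF that] by (intro integrable_mult_indicator f sets_leb01_Ioc)
  have "(LINT t|leb01. f t \<bullet> dstep g n t)
      = (LINT t|leb01. (\<Sum>k<2 ^ n. (indicator (?J k) t *\<^sub>R f t) \<bullet> dslope g n k))"
    by (simp add: dstep_def inner_sum_right)
  also have "\<dots> = (\<Sum>k<2 ^ n. (LINT t|leb01. (indicator (?J k) t *\<^sub>R f t) \<bullet> dslope g n k))"
    by (intro Bochner_Integration.integral_sum integrable_inner_left) (use i in \<open>simp del: of_nat_Suc\<close>)
  also have "\<dots> = (\<Sum>k<2 ^ n. (LINT t:?J k|leb01. f t) \<bullet> dslope g n k)"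
    unfolding set_lebesgue_integral_def
    by (intro sum.cong refl integral_inner_left) (use i in \<open>simp del: of_nat_Suc\<close>)
  also have "\<dots> = (\<Sum>k<2 ^ n. (antideriv f (real (Suc k) / 2 ^ n) - antideriv f (real k / 2 ^ n)) \<bullet> dslope g n k)"
    using dyadic_bounds by (intro sum.cong refl) (subst antideriv_diff[OF f], auto)
  finally show ?thesis .
qed

lemma dstep_eq:
  assumes "k < 2 ^ n" "t \<in> {real k / 2 ^ n<..real (Suc k) / 2 ^ n}"
  shows "dstep g n t = dslope g n k"
proof -
  have "indicator {real j / 2 ^ n<..real (Suc j) / 2 ^ n} t = (if j = k then 1 else 0 :: real)" for j
  proof (cases "j = k")
    case False
    have t: "real k < t * 2 ^ n" "t * 2 ^ n \<le> real (Suc k)"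
      using assms(2) by (auto simp: field_simps)
    have "\<not> (real j < t * 2 ^ n \<and> t * 2 ^ n \<le> real (Suc j))"
    proof
      assume "real j < t * 2 ^ n \<and> t * 2 ^ n \<le> real (Suc j)"
      then have "real j < real (Suc k)" "real k < real (Suc j)" using t by linarith+
      with False show False by (simp del: of_nat_Suc)
    qed
    then show ?thesis using False by (auto simp: indicator_def field_simps)
  qed (use assms in auto)
  then show ?thesis using assms(1) unfolding dstep_def
    by (simp add: if_distrib[of "\<lambda>c. c *\<^sub>R _"] cong: if_cong)
qed

lemma antideriv_dstep:
  fixes g :: "real \<Rightarrow> 'a::euclidean_space"
  assumes "j \<le> 2 ^ n"
  shows "antideriv (dstep g n) (real j / 2 ^ n) = g (real j / 2 ^ n) - g 0"
  using assms
proof (induction j)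
  case (Suc j)
  let ?J = "{real j / 2 ^ n<..real (Suc j) / 2 ^ n}"
  have j: "j < 2 ^ n" using Suc by simp
  have "antideriv (dstep g n) (real (Suc j) / 2 ^ n) - antideriv (dstep g n) (real j / 2 ^ n)
      = (LINT t:?J|leb01. dstep g n t)"
    using dyadic_bounds[OF j] by (intro antideriv_diff L2_integrable L2_dstep) auto
  also have "\<dots> = (LINT t:?J|leb01. dslope g n j)"
    unfolding set_lebesgue_integral_def using dstep_eq[OF j]
    by (intro Bochner_Integration.integral_cong) (auto split: split_indicator)
  also have "\<dots> = measure leb01 ?J *\<^sub>R dslope g n j"
  proof -
    have "?J \<inter> {0..1} = ?J"
    proof (intro Int_absorb2 subsetI)
      fix x assume "x \<in> ?J"
      then have "real j / 2 ^ n < x" "x \<le> real (Suc j) / 2 ^ n" by simp_all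
      with dyadic_bounds[OF j] show "x \<in> {0..1}" by (simp only: atLeastAtMost_iff) linarith
    qed
    then show ?thesis unfolding set_lebesgue_integral_def using dyadic_bounds[OF j]
      by (simp add: leb01.emeasure_finite less_top[symmetric] sets_leb01_Ioc del: of_nat_Suc)
  qed
  also have "\<dots> = g (real (Suc j) / 2 ^ n) - g (real j / 2 ^ n)"
    using dyadic_bounds[OF j]
    by (subst measure_leb01_Ioc) (auto simp: dslope_def add_divide_distrib)
  finally show ?case using Suc j by (simp add: algebra_simps)
qed simp

lemma dslope_inner: "v \<bullet> dslope g n k = 2 ^ n * (v \<bullet> (g (real (Suc k) / 2 ^ n) - g (real k / 2 ^ n)))"
  by (simp add: dslope_def)

lemma integral_inner_dstep_primitive:
  fixes f g :: "real \<Rightarrow> 'a::euclidean_space"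
  assumes f: "integrable leb01 f"
    and F: "\<And>k. k \<le> 2 ^ n \<Longrightarrow> antideriv f (real k / 2 ^ n) = g (real k / 2 ^ n) - g 0"
  shows "(LINT t|leb01. f t \<bullet> dstep g n t) = denergy g n"
  unfolding integral_inner_dstep[OF f] denergy_def dslope_inner
  using F[of "Suc _"] F by (intro sum.cong refl) (simp add: power2_norm_eq_inner Suc_le_eq del: of_nat_Suc)

text \<open>
  The martingale property of dyadic difference quotients: the coarser one is the orthogonal projection
  of the finer one, because both have the same integral over each coarse interval.
\<close>

lemma integral_dstep_inner_dstep:
  fixes g :: "real \<Rightarrow> 'a::euclidean_space"
  assumes "n \<le> m"
  shows "(LINT t|leb01. dstep g m t \<bullet> dstep g n t) = denergy g n"
proof (rule integral_inner_dstep_primitive)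
  fix k :: nat assume k: "k \<le> 2 ^ n"
  have eq: "real k / 2 ^ n = real (k * 2 ^ (m - n)) / 2 ^ m"
  proof -
    have "(2::real) ^ m = 2 ^ n * 2 ^ (m - n)" using assms by (simp flip: power_add)
    then show ?thesis by simp
  qed
  have "k * 2 ^ (m - n) \<le> 2 ^ n * 2 ^ (m - n)" using k by simp
  also have "\<dots> = 2 ^ m" using assms by (simp flip: power_add)
  finally show "antideriv (dstep g m) (real k / 2 ^ n) = g (real k / 2 ^ n) - g 0"
    unfolding eq by (rule antideriv_dstep)
qed (intro L2_integrable L2_dstep)

lemma norm_diff_sq:
  fixes x y :: "'a::real_inner"
  shows "(norm (x - y))\<^sup>2 = (norm x)\<^sup>2 - 2 * (x \<bullet> y) + (norm y)\<^sup>2"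
  by (simp add: power2_norm_eq_inner inner_diff_left inner_diff_right inner_commute)

lemma integral_norm_diff_sq:
  fixes u v :: "real \<Rightarrow> 'a::euclidean_space"
  assumes "L2 u" "L2 v"
  shows "(LINT t|leb01. (norm (u t - v t))\<^sup>2) =
    (LINT t|leb01. (norm (u t))\<^sup>2) - 2 * (LINT t|leb01. u t \<bullet> v t) + (LINT t|leb01. (norm (v t))\<^sup>2)"
  using L2_sq[OF assms(1)] L2_sq[OF assms(2)] L2_inner_integrable[OF assms]
  by (simp add: norm_diff_sq)

lemma integral_norm_dstep_sq: "(LINT t|leb01. (norm (dstep g n t))\<^sup>2) = denergy g n"
  using integral_dstep_inner_dstep[of n n g] by (simp add: power2_norm_eq_inner)

lemma integral_norm_diff_dstep_sq:
  assumes "n \<le> m"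
  shows "(LINT t|leb01. (norm (dstep g m t - dstep g n t))\<^sup>2) = denergy g m - denergy g n"
  by (simp add: integral_norm_diff_sq L2_dstep integral_norm_dstep_sq integral_dstep_inner_dstep assms)

lemma denergy_mono:
  assumes "n \<le> m" shows "denergy g n \<le> denergy g m"
proof -
  have "0 \<le> (LINT t|leb01. (norm (dstep g m t - dstep g n t))\<^sup>2)" by simp
  then show ?thesis by (simp add: integral_norm_diff_dstep_sq[OF assms])
qed

lemma L2_Fatou:
  fixes v :: "nat \<Rightarrow> real \<Rightarrow> 'a::euclidean_space"
  assumes v: "\<And>i. L2 (v i)" and w: "w \<in> borel_measurable leb01"
    and lim: "AE t in leb01. (\<lambda>i. v i t) \<longlonglongrightarrow> w t"
    and M: "\<And>i. (LINT t|leb01. (norm (v i t))\<^sup>2) \<le> M"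
  shows "L2 w" "(LINT t|leb01. (norm (w t))\<^sup>2) \<le> M"
proof -
  note [measurable] = w L2_measurable[OF v]
  have M0: "M \<ge> 0" by (rule order_trans[OF _ M[of 0]]) simp
  have "(\<integral>\<^sup>+t. ennreal ((norm (w t))\<^sup>2) \<partial>leb01) = (\<integral>\<^sup>+t. liminf (\<lambda>i. ennreal ((norm (v i t))\<^sup>2)) \<partial>leb01)"
  proof (rule nn_integral_cong_AE, use lim in eventually_elim)
    case (elim t)
    then have "(\<lambda>i. ennreal ((norm (v i t))\<^sup>2)) \<longlonglongrightarrow> ennreal ((norm (w t))\<^sup>2)"
      by (intro tendsto_intros)
    then show ?case by (rule lim_imp_Liminf[symmetric, OF trivial_limit_sequentially])
  qed
  also have "\<dots> \<le> liminf (\<lambda>i. \<integral>\<^sup>+t. ennreal ((norm (v i t))\<^sup>2) \<partial>leb01)"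
    by (rule nn_integral_liminf) measurable
  also have "\<dots> \<le> liminf (\<lambda>i. ennreal M)"
  proof (intro Liminf_mono always_eventually allI)
    fix i
    have "(\<integral>\<^sup>+t. ennreal ((norm (v i t))\<^sup>2) \<partial>leb01) = ennreal (LINT t|leb01. (norm (v i t))\<^sup>2)"
      by (rule nn_integral_eq_integral) (simp_all add: L2_sq v)
    then show "(\<integral>\<^sup>+t. ennreal ((norm (v i t))\<^sup>2) \<partial>leb01) \<le> ennreal M"
      using M by (simp add: ennreal_leI)
  qed
  finally have le: "(\<integral>\<^sup>+t. ennreal ((norm (w t))\<^sup>2) \<partial>leb01) \<le> ennreal M" by (simp add: Liminf_const)
  then have int: "integrable leb01 (\<lambda>t. (norm (w t))\<^sup>2)"
    by (intro integrableI_bounded) (auto simp: less_top[symmetric] top_unique)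
  then show "L2 w" by (simp add: L2_iff w)
  have "ennreal (LINT t|leb01. (norm (w t))\<^sup>2) \<le> ennreal M"
    using le int by (simp add: nn_integral_eq_integral)
  then show "(LINT t|leb01. (norm (w t))\<^sup>2) \<le> M" using M0 by simp
qed

lemma antideriv_diff_norm_le:
  fixes f :: "real \<Rightarrow> 'a::euclidean_space"
  assumes "L2 f" "0 \<le> a" "a \<le> b" "b \<le> 1"
  shows "(norm (antideriv f b - antideriv f a))\<^sup>2
    \<le> (b - a) * (antideriv (\<lambda>t. (norm (f t))\<^sup>2) b - antideriv (\<lambda>t. (norm (f t))\<^sup>2) a)"
  using L2_norm_integral_le[OF assms(1), of "{a<..b}"] assms
  by (simp add: antideriv_diff L2_integrable L2_sq measure_leb01_Ioc sets_leb01_Ioc)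

lemma antideriv_nonneg_mono:
  fixes f :: "real \<Rightarrow> real"
  assumes "integrable leb01 f" "\<And>t. f t \<ge> 0" "0 \<le> a" "a \<le> b" "b \<le> 1"
  shows "antideriv f a \<le> antideriv f b"
proof -
  have "0 \<le> (LINT s:{a<..b}|leb01. f s)"
    unfolding set_lebesgue_integral_def using assms(2) by (intro integral_nonneg_AE) auto
  then show ?thesis using antideriv_diff[OF assms(1,3-5)] by linarith
qed

lemma antideriv_le_integral:
  fixes f :: "real \<Rightarrow> real"
  assumes "integrable leb01 f" "\<And>t. f t \<ge> 0" "t \<in> {0..1}"
  shows "antideriv f t \<le> (LINT s|leb01. f s)"
  using antideriv_nonneg_mono[OF assms(1,2), of t 1] assms(3) by (simp add: antideriv_1)

lemma continuous_on_antideriv: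
  fixes f :: "real \<Rightarrow> 'a::euclidean_space"
  assumes "integrable leb01 f"
  shows "continuous_on {0..1} (antideriv f)"
proof -
  have "set_integrable lborel {0..1} f" using assms by (simp add: set_integrable_leb01)
  from set_borel_integral_eq_integral(1)[OF this]
  have "continuous_on {0..1} (\<lambda>t. integral {0..t} f)"
    by (rule indefinite_integral_continuous_1)
  moreover have "antideriv f t = integral {0..t} f" if "t \<in> {0..1}" for t
    unfolding antideriv_lborel[OF that]
    by (rule set_borel_integral_eq_integral(2))
      (rule set_integrable_subset[of _ "{0..1}"], use that assms in \<open>auto simp: set_integrable_leb01\<close>)
  ultimately show ?thesis by (subst continuous_on_cong[OF refl]) auto
qed

lemma dyadic_dense_eq:
  fixes f g :: "real \<Rightarrow> 'a::euclidean_space"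
  assumes "continuous_on {0..1} f" "continuous_on {0..1} g"
    and eq: "\<And>n k. k \<le> 2 ^ n \<Longrightarrow> f (real k / 2 ^ n) = g (real k / 2 ^ n)"
    and t: "t \<in> {0..1}"
  shows "f t = g t"
proof -
  define k where "k n = nat \<lfloor>t * 2 ^ n\<rfloor>" for n :: nat
  define x where "x n = real (k n) / 2 ^ n" for n
  have rk: "real (k n) = of_int \<lfloor>t * 2 ^ n\<rfloor>" for n using t by (simp add: k_def)
  have kle: "k n \<le> 2 ^ n" for n
  proof -
    have "real (k n) \<le> t * 2 ^ n" unfolding rk by simp
    also have "\<dots> \<le> 2 ^ n" using t by (simp add: mult_left_le_one_le)
    finally have "real (k n) \<le> real (2 ^ n)" by simp
    then show ?thesis by (simp only: of_nat_le_iff)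
  qed
  have x01: "x n \<in> {0..1}" for n
  proof -
    have "real (k n) \<le> real (2 ^ n)" using kle[of n] by (simp only: of_nat_le_iff)
    then show ?thesis by (simp add: x_def)
  qed
  have bd: "norm (x n - t) \<le> (1 / 2) ^ n" for n
  proof -
    have "t * 2 ^ n - 1 \<le> real (k n)" "real (k n) \<le> t * 2 ^ n"
      unfolding rk by linarith+
    moreover have "(x n - t) * 2 ^ n = real (k n) - t * 2 ^ n"
      by (simp add: x_def left_diff_distrib)
    ultimately have "\<bar>(x n - t) * 2 ^ n\<bar> \<le> 1" by linarith
    then have "\<bar>x n - t\<bar> * 2 ^ n \<le> 1" by (simp add: abs_mult)
    then show ?thesis by (simp add: power_one_over field_simps)
  qed
  have "(\<lambda>n. x n - t) \<longlonglongrightarrow> 0"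
    by (rule Lim_null_comparison[OF always_eventually LIMSEQ_realpow_zero[of "1/2"]]) (use bd in auto)
  then have lim: "x \<longlonglongrightarrow> t" by (simp add: LIM_zero_iff)
  have "(\<lambda>n. f (x n)) \<longlonglongrightarrow> f t" "(\<lambda>n. g (x n)) \<longlonglongrightarrow> g t"
    by (rule continuous_on_tendsto_compose[OF assms(1) lim t] continuous_on_tendsto_compose[OF assms(2) lim t],
        use x01 in auto)+
  moreover have "f (x n) = g (x n)" for n unfolding x_def using kle by (rule eq)
  ultimately show ?thesis using LIMSEQ_unique by auto
qed

text \<open>
  The Hilbert space case of a theorem of F. Riesz. By orthogonality the squared distance of two dyadic
  difference quotients is the difference of their energies, so boundedness of the increasing sequence of
  energies makes them a Cauchy sequence. Their limit integrates to the increments of \<open>g\<close> between dyadic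
  points, hence by continuity between all points. That the quotients converge in \<open>L\<^sup>2\<close> is recorded because
  it also yields the density of step functions.
\<close>

theorem bounded_denergy_imp_primitive:
  fixes g :: "real \<Rightarrow> 'a::euclidean_space"
  assumes cont: "continuous_on {0..1} g" and bd: "\<And>n. denergy g n \<le> M"
  obtains w and r :: "nat \<Rightarrow> nat" where "primitive g w" "(LINT t|leb01. (norm (w t))\<^sup>2) \<le> M" "strict_mono r"
    "(\<lambda>i. LINT t|leb01. (norm (w t - dstep g (r i) t))\<^sup>2) \<longlonglongrightarrow> 0"
proof -
  let ?v = "dstep g"
  have "incseq (denergy g)" using denergy_mono by (auto simp: incseq_def)
  then obtain L where L: "denergy g \<longlonglongrightarrow> L" and L_ge: "\<And>n. denergy g n \<le> L"
    using incseq_convergent[of "denergy g" M] bd by blast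
  have L1: "(LINT t|leb01. norm (?v i t - ?v j t))\<^sup>2 \<le> \<bar>denergy g i - denergy g j\<bar>" for i j
  proof -
    have m: "measure leb01 (space leb01) = 1" using measure_leb01_Icc[of 0 1] by simp
    have "(LINT t|leb01. norm (?v i t - ?v j t) * 1)\<^sup>2 \<le>
        (LINT t|leb01. (norm (?v i t - ?v j t))\<^sup>2) * (LINT t|leb01. 1\<^sup>2)"
    proof (rule Cauchy_Schwarz_integral)
      show "(\<lambda>t. norm (?v i t - ?v j t)) \<in> borel_measurable leb01"
        by (rule borel_measurable_integrable[OF integrable_norm[OF L2_integrable[OF L2_diff[OF L2_dstep L2_dstep]]]])
      show "integrable leb01 (\<lambda>t. (norm (?v i t - ?v j t))\<^sup>2)"
        by (rule L2_sq[OF L2_diff[OF L2_dstep L2_dstep]])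
    qed simp_all
    moreover have "(LINT t|leb01. (norm (?v i t - ?v j t))\<^sup>2) = \<bar>denergy g i - denergy g j\<bar>"
      using integral_norm_diff_dstep_sq[of j i g] integral_norm_diff_dstep_sq[of i j g]
        denergy_mono[of i j g] denergy_mono[of j i g]
      by (cases "i \<le> j") (auto simp: norm_minus_commute)
    ultimately show ?thesis using m by simp
  qed
  obtain r where r: "strict_mono r" "AE t in leb01. Cauchy (\<lambda>i. ?v (r i) t)"
  proof (rule cauchy_L1_AE_cauchy_subseq)
    show "integrable leb01 (?v n)" for n by (rule L2_integrable[OF L2_dstep])
    fix e :: real assume e: "e > 0"
    have "Cauchy (denergy g)" using L by (rule LIMSEQ_imp_Cauchy)
    then obtain N where N: "\<And>i j. i \<ge> N \<Longrightarrow> j \<ge> N \<Longrightarrow> norm (denergy g i - denergy g j) < e\<^sup>2"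
      using e CauchyD[of "denergy g" "e\<^sup>2"] by auto
    have "(LINT t|leb01. norm (?v i t - ?v j t)) < e" if "i \<ge> N" "j \<ge> N" for i j
      using L1[of i j] N[OF that] e by (intro power2_less_imp_less[of _ e]) auto
    then show "\<exists>N. \<forall>i\<ge>N. \<forall>j\<ge>N. (LINT t|leb01. norm (?v i t - ?v j t)) < e" by blast
  qed (use that in auto)
  define w where "w t = lim (\<lambda>i. ?v (r i) t)" for t
  have w_meas: "w \<in> borel_measurable leb01"
    unfolding w_def by (rule borel_measurable_lim_metric) (rule L2_measurable[OF L2_dstep])
  have w_lim: "AE t in leb01. (\<lambda>i. ?v (r i) t) \<longlonglongrightarrow> w t"
    using r(2) by eventually_elim (simp add: w_def Cauchy_convergent_iff convergent_LIMSEQ_iff)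
  have wL2: "L2 w" and wM: "(LINT t|leb01. (norm (w t))\<^sup>2) \<le> M"
    using L2_Fatou[OF L2_dstep w_meas w_lim, of M] bd by (simp_all add: integral_norm_dstep_sq)
  have conv_le: "(LINT t|leb01. (norm (w t - ?v (r i) t))\<^sup>2) \<le> L - denergy g (r i)" for i
  proof (rule L2_Fatou(2))
    show "L2 (\<lambda>t. ?v (r (j + i)) t - ?v (r i) t)" for j by (intro L2_diff L2_dstep)
    show "(\<lambda>t. w t - ?v (r i) t) \<in> borel_measurable leb01"
      by (intro borel_measurable_diff w_meas L2_measurable[OF L2_dstep])
    show "AE t in leb01. (\<lambda>j. ?v (r (j + i)) t - ?v (r i) t) \<longlonglongrightarrow> w t - ?v (r i) t"
      using w_lim by eventually_elim
        (intro tendsto_diff tendsto_const LIMSEQ_ignore_initial_segment[where f="\<lambda>j. ?v (r j) _"])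
    show "(LINT t|leb01. (norm (?v (r (j + i)) t - ?v (r i) t))\<^sup>2) \<le> L - denergy g (r i)" for j
      using r(1) L_ge by (subst integral_norm_diff_dstep_sq) (auto intro: strict_mono_leD)
  qed
  have "(\<lambda>i. L - denergy g (r i)) \<longlonglongrightarrow> 0"
    using tendsto_diff[OF tendsto_const LIMSEQ_subseq_LIMSEQ[OF L r(1)], of L] by (simp add: o_def)
  then have conv: "(\<lambda>i. LINT t|leb01. (norm (w t - ?v (r i) t))\<^sup>2) \<longlonglongrightarrow> 0"
    by (rule Lim_null_comparison[rotated]) (use conv_le in \<open>auto intro!: always_eventually\<close>)
  have prim_lim: "(\<lambda>i. antideriv (?v (r i)) t) \<longlonglongrightarrow> antideriv w t" if t: "t \<in> {0..1}" for t
  proof -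
    have "(norm (antideriv w t - antideriv (?v (r i)) t))\<^sup>2
        \<le> (LINT t|leb01. (norm (w t - ?v (r i) t))\<^sup>2)" for i
    proof -
      let ?d = "\<lambda>t. w t - ?v (r i) t"
      have d: "L2 ?d" by (intro L2_diff wL2 L2_dstep)
      have "antideriv w t - antideriv (?v (r i)) t = antideriv ?d t"
        unfolding antideriv_def using t
        by (intro set_integral_diff(2)[symmetric] set_integrable_leb01_sub L2_integrable wL2 L2_dstep)
          auto
      moreover have "(norm (antideriv ?d t))\<^sup>2 \<le> t * antideriv (\<lambda>t. (norm (?d t))\<^sup>2) t"
        using antideriv_diff_norm_le[OF d, of 0 t] t by simp
      moreover have "t * antideriv (\<lambda>t. (norm (?d t))\<^sup>2) t \<le> 1 * (LINT t|leb01. (norm (?d t))\<^sup>2)"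
        using t antideriv_nonneg_mono[OF L2_sq[OF d], of 0 t]
        by (intro mult_mono antideriv_le_integral L2_sq[OF d]) auto
      ultimately show ?thesis by simp
    qed
    then have "(\<lambda>i. (norm (antideriv w t - antideriv (?v (r i)) t))\<^sup>2) \<longlonglongrightarrow> 0"
      by (intro Lim_null_comparison[OF always_eventually conv]) auto
    then have "(\<lambda>i. norm (antideriv w t - antideriv (?v (r i)) t)) \<longlonglongrightarrow> 0"
      by (metis tendsto_null_power zero_less_numeral power_tendsto_0_iff)
    then have "(\<lambda>i. antideriv w t - antideriv (?v (r i)) t) \<longlonglongrightarrow> 0"
      by (rule tendsto_norm_zero_cancel)
    then show ?thesis
      using tendsto_diff[OF tendsto_const[of "antideriv w t"]] by fastforce
  qed
  have "g t = g 0 + antideriv w t" if "t \<in> {0..1}" for t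
  proof (rule dyadic_dense_eq[OF cont _ _ that])
    show "continuous_on {0..1} (\<lambda>t. g 0 + antideriv w t)"
      by (intro continuous_intros continuous_on_antideriv L2_integrable wL2)
    fix n k :: nat assume k: "k \<le> 2 ^ n"
    have t: "real k / 2 ^ n \<in> {0..1}"
    proof -
      have "real k \<le> real (2 ^ n)" using k by (simp only: of_nat_le_iff)
      then show ?thesis by simp
    qed
    have "\<forall>\<^sub>F i in sequentially. antideriv (?v (r i)) (real k / 2 ^ n) = g (real k / 2 ^ n) - g 0"
      using eventually_ge_at_top[of n]
    proof eventually_elim
      case (elim i)
      then have ni: "n \<le> r i" using seq_suble[OF r(1), of i] by simp
      have eq: "real k / 2 ^ n = real (k * 2 ^ (r i - n)) / 2 ^ r i"
      proof -
        have "(2::real) ^ r i = 2 ^ n * 2 ^ (r i - n)" using ni by (simp flip: power_add)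
        then show ?thesis by simp
      qed
      have "k * 2 ^ (r i - n) \<le> 2 ^ n * 2 ^ (r i - n)" using k by simp
      also have "\<dots> = 2 ^ r i" using ni by (simp flip: power_add)
      finally show ?case unfolding eq by (rule antideriv_dstep)
    qed
    then have "(\<lambda>i. antideriv (?v (r i)) (real k / 2 ^ n)) \<longlonglongrightarrow> g (real k / 2 ^ n) - g 0"
      by (rule tendsto_eventually)
    then have "antideriv w (real k / 2 ^ n) = g (real k / 2 ^ n) - g 0"
      using prim_lim[OF t] LIMSEQ_unique by blast
    then show "g (real k / 2 ^ n) = g 0 + antideriv w (real k / 2 ^ n)" by simp
  qed
  then have "antideriv w t = g t - g 0" if "t \<in> {0..1}" for t
    using that by (metis add_diff_cancel_left')
  with wL2 have "primitive g w" by (simp add: primitive_def)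
  then show thesis using wM r(1) conv by (rule that)
qed

section \<open>Functions dominated by a nondecreasing function\<close>

text \<open>
  Such a \<open>\<Phi>\<close> exists if and only if \<open>g\<close> has a square integrable derivative; then \<open>\<Phi> t = \<integral>\<^sub>0\<^sup>t |g'|\<^sup>2\<close> is a
  choice. The inequality is inherited by Lipschitz images of \<open>g\<close> and by reparametrizations with no
  computation of derivatives, which is why regularity of class \<open>H\<^sup>1\<close> is expressed through it below.
\<close>

definition dominated :: "(real \<Rightarrow> 'a::euclidean_space) \<Rightarrow> (real \<Rightarrow> real) \<Rightarrow> bool" where
  "dominated g \<Phi> \<longleftrightarrow> (\<forall>s t. 0 \<le> s \<longrightarrow> s \<le> t \<longrightarrow> t \<le> 1 \<longrightarrow>
     \<Phi> s \<le> \<Phi> t \<and> (norm (g t - g s))\<^sup>2 \<le> (t - s) * (\<Phi> t - \<Phi> s))"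

lemma dominatedD:
  assumes "dominated g \<Phi>" "0 \<le> s" "s \<le> t" "t \<le> 1"
  shows "\<Phi> s \<le> \<Phi> t" "(norm (g t - g s))\<^sup>2 \<le> (t - s) * (\<Phi> t - \<Phi> s)"
  using assms by (auto simp: dominated_def)

lemma dominated_antideriv:
  assumes "L2 w"
  shows "dominated (antideriv w) (antideriv (\<lambda>t. (norm (w t))\<^sup>2))"
  unfolding dominated_def
  using antideriv_diff_norm_le[OF assms] antideriv_nonneg_mono[OF L2_sq[OF assms]] by auto

lemma dominated_holder:
  assumes "dominated g \<Phi>" "\<Phi> 1 - \<Phi> 0 \<le> K" "s \<in> {0..1}" "t \<in> {0..1}"
  shows "(norm (g t - g s))\<^sup>2 \<le> K * \<bar>t - s\<bar>"
proof -
  have *: "(norm (g t - g s))\<^sup>2 \<le> K * \<bar>t - s\<bar>" if "0 \<le> s" "s \<le> t" "t \<le> 1" for s t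
  proof -
    have "\<Phi> 0 \<le> \<Phi> s" "\<Phi> t \<le> \<Phi> 1" using dominatedD(1)[OF assms(1)] that by auto
    then have "\<Phi> t - \<Phi> s \<le> K" using assms(2) by linarith
    then have "(t - s) * (\<Phi> t - \<Phi> s) \<le> (t - s) * K" using that by (intro mult_left_mono) auto
    then show ?thesis using dominatedD(2)[OF assms(1) that] that by (simp add: mult.commute)
  qed
  show ?thesis using *[of s t] *[of t s] assms(3,4)
    by (cases "s \<le> t") (auto simp: norm_minus_commute abs_minus_commute)
qed

lemma dominated_denergy:
  assumes "dominated g \<Phi>" shows "denergy g n \<le> \<Phi> 1 - \<Phi> 0"
proof -
  have "denergy g n \<le> (\<Sum>k<2 ^ n. \<Phi> (real (Suc k) / 2 ^ n) - \<Phi> (real k / 2 ^ n))"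
    unfolding denergy_def
  proof (rule sum_mono)
    fix k :: nat assume "k \<in> {..<2 ^ n}"
    then have k: "k < 2 ^ n" by simp
    let ?a = "real k / 2 ^ n" and ?b = "real (Suc k) / 2 ^ n"
    have "2 ^ n * (norm (g ?b - g ?a))\<^sup>2 \<le> 2 ^ n * ((?b - ?a) * (\<Phi> ?b - \<Phi> ?a))"
      using dominatedD(2)[OF assms dyadic_bounds[OF k]] by (intro mult_left_mono) auto
    also have "\<dots> = \<Phi> ?b - \<Phi> ?a" by (simp add: add_divide_distrib)
    finally show "2 ^ n * (norm (g ?b - g ?a))\<^sup>2 \<le> \<Phi> ?b - \<Phi> ?a" .
  qed
  also have "\<dots> = \<Phi> 1 - \<Phi> 0"
    using sum_lessThan_telescope[of "\<lambda>k. \<Phi> (real k / 2 ^ n)" "2 ^ n"] by simp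
  finally show ?thesis .
qed

lemma holder_continuous_on:
  fixes g :: "real \<Rightarrow> 'a::euclidean_space"
  assumes "\<And>s t. s \<in> {0..1} \<Longrightarrow> t \<in> {0..1} \<Longrightarrow> (norm (g t - g s))\<^sup>2 \<le> K * \<bar>t - s\<bar>"
  shows "continuous_on {0..1} g"
  unfolding continuous_on_def
proof
  fix s :: real assume s: "s \<in> {0..1}"
  have "((\<lambda>t. K * \<bar>t - s\<bar>) \<longlongrightarrow> K * \<bar>s - s\<bar>) (at s within {0..1})"
    by (intro tendsto_intros)
  then have "((\<lambda>t. K * \<bar>t - s\<bar>) \<longlongrightarrow> 0) (at s within {0..1})" by simp
  then have "((\<lambda>t. (norm (g t - g s))\<^sup>2) \<longlongrightarrow> 0) (at s within {0..1})"
    by (rule Lim_null_comparison[rotated])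
      (use assms s in \<open>auto simp: eventually_at_filter intro!: always_eventually\<close>)
  then have "((\<lambda>t. norm (g t - g s)) \<longlongrightarrow> 0) (at s within {0..1})"
    by (metis power_tendsto_0_iff zero_less_numeral)
  then have "((\<lambda>t. g t - g s) \<longlongrightarrow> 0) (at s within {0..1})"
    by (rule tendsto_norm_zero_cancel)
  then show "(g \<longlongrightarrow> g s) (at s within {0..1})" by (simp add: LIM_zero_iff)
qed

lemma dominated_continuous: "dominated g \<Phi> \<Longrightarrow> continuous_on {0..1} g"
  by (rule holder_continuous_on[OF dominated_holder]) auto

lemma dominated_imp_primitive:
  fixes g :: "real \<Rightarrow> 'a::euclidean_space"
  assumes "dominated g \<Phi>"
  obtains w where "primitive g w" "(LINT t|leb01. (norm (w t))\<^sup>2) \<le> \<Phi> 1 - \<Phi> 0"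
  by (rule bounded_denergy_imp_primitive[OF dominated_continuous[OF assms] dominated_denergy[OF assms]])
    (rule that)

text \<open>
  The averages of \<open>f\<close> over dyadic intervals are the dyadic difference quotients of its primitive. They
  converge in \<open>L\<^sup>2\<close> to a function with the same primitive as \<open>f\<close>, that is, to \<open>f\<close>.
\<close>

lemma L2_step_approx:
  fixes f :: "real \<Rightarrow> 'a::euclidean_space"
  assumes f: "L2 f"
  obtains r :: "nat \<Rightarrow> nat"
  where "(\<lambda>i. LINT t|leb01. (norm (f t - dstep (antideriv f) (r i) t))\<^sup>2) \<longlonglongrightarrow> 0"
proof -
  note dom = dominated_antideriv[OF f]
  obtain w r where prim: "primitive (antideriv f) w"
    and lim: "(\<lambda>i. LINT t|leb01. (norm (w t - dstep (antideriv f) (r i) t))\<^sup>2) \<longlonglongrightarrow> 0"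
    by (rule bounded_denergy_imp_primitive[OF dominated_continuous[OF dom] dominated_denergy[OF dom]]) blast
  have w: "L2 w" "\<And>t. t \<in> {0..1} \<Longrightarrow> antideriv w t = antideriv f t"
    using prim by (simp_all add: primitive_def)
  have "AE t in leb01. f t - w t = 0"
  proof (rule antideriv_zero_imp_AE_zero)
    show "integrable leb01 (\<lambda>t. f t - w t)" using f w(1) by (simp add: L2_integrable)
    fix t :: real assume t: "t \<in> {0..1}"
    have "antideriv (\<lambda>t. f t - w t) t = antideriv f t - antideriv w t"
      unfolding antideriv_def using t
      by (intro set_integral_diff(2) set_integrable_leb01_sub L2_integrable w(1) f) auto
    then show "antideriv (\<lambda>t. f t - w t) t = 0" using w(2)[OF t] by simp
  qed
  then have ae: "AE t in leb01. f t = w t" by simp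
  have "(LINT t|leb01. (norm (f t - dstep (antideriv f) (r i) t))\<^sup>2)
      = (LINT t|leb01. (norm (w t - dstep (antideriv f) (r i) t))\<^sup>2)" for i
  proof (rule integral_cong_AE)
    show "AE t in leb01. (norm (f t - dstep (antideriv f) (r i) t))\<^sup>2
        = (norm (w t - dstep (antideriv f) (r i) t))\<^sup>2"
      using ae by eventually_elim simp
    show "(\<lambda>t. (norm (f t - dstep (antideriv f) (r i) t))\<^sup>2) \<in> borel_measurable leb01"
      by (rule borel_measurable_integrable[OF L2_sq[OF L2_diff[OF f L2_dstep]]])
    show "(\<lambda>t. (norm (w t - dstep (antideriv f) (r i) t))\<^sup>2) \<in> borel_measurable leb01"
      by (rule borel_measurable_integrable[OF L2_sq[OF L2_diff[OF w(1) L2_dstep]]])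
  qed
  with lim show thesis by (intro that[of r]) simp
qed

section \<open>Weak derivatives and primitives\<close>

lemma continuous_bounded_01:
  fixes f :: "real \<Rightarrow> 'a::real_normed_vector"
  assumes "continuous_on {0..1} f"
  shows "\<exists>B\<ge>0. \<forall>t\<in>{0..1}. norm (f t) \<le> B"
proof -
  have "bounded (f ` {0..1})"
    by (intro compact_imp_bounded compact_continuous_image assms compact_Icc)
  then obtain B where "\<forall>t\<in>{0..1}. norm (f t) \<le> B" by (auto simp: bounded_iff)
  moreover from this have "norm (f 0) \<le> B" by simp
  then have "B \<ge> 0" using norm_ge_zero order_trans by blast
  ultimately show ?thesis by blast
qed

lemma test_funD:
  assumes "test_fun \<phi>"
  shows "(\<phi> has_real_derivative deriv \<phi> t) (at t)" "continuous_on UNIV (deriv \<phi>)"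
    "\<phi> 0 = 0" "\<phi> 1 = 0" "continuous_on UNIV \<phi>"
proof -
  from assms obtain D where D: "\<And>x. (\<phi> has_vector_derivative D x) (at x)" "continuous_on UNIV D"
    unfolding test_fun_def C1_differentiable_on_def by auto
  then have D': "(\<phi> has_real_derivative D x) (at x)" for x
    by (simp add: has_real_derivative_iff_has_vector_derivative)
  then have eq: "deriv \<phi> = D" by (intro ext DERIV_imp_deriv)
  show "(\<phi> has_real_derivative deriv \<phi> t) (at t)" using D' eq by simp
  show "continuous_on UNIV (deriv \<phi>)" using D(2) eq by simp
  show "continuous_on UNIV \<phi>" by (rule DERIV_continuous_on) (use D' in auto)
  have "t \<notin> {0<..<1} \<Longrightarrow> \<phi> t = 0" for t
    using assms closure_subset[of "{t. \<phi> t \<noteq> 0}"] unfolding test_fun_def by auto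
  then show "\<phi> 0 = 0" "\<phi> 1 = 0" by auto
qed

lemma test_fun_cont [simp]:
  assumes "test_fun \<phi>"
  shows "continuous_on {0..1} \<phi>" "continuous_on {0..1} (deriv \<phi>)"
  using test_funD(2,5)[OF assms] by (auto elim: continuous_on_subset)

lemma antideriv_deriv_test_fun:
  assumes "test_fun \<phi>" "t \<in> {0..1}"
  shows "antideriv (deriv \<phi>) t = \<phi> t"
  using antideriv_velocity_diff[of \<phi> "deriv \<phi>" t] test_funD[OF assms(1)] assms
  by (auto intro: has_vector_derivative_at_within simp: has_real_derivative_iff_has_vector_derivative)

text \<open>
  Fubini's theorem on the triangle \<open>s \<le> t\<close>; since \<open>\<phi>\<close> vanishes at \<open>1\<close>, the inner integral of \<open>\<phi>'\<close> over
  \<open>{s<..1}\<close> is \<open>- \<phi> s\<close>.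
\<close>

lemma integral_test_fun_primitive:
  fixes w :: "real \<Rightarrow> 'a::euclidean_space"
  assumes w: "L2 w" and phi: "test_fun \<phi>"
  shows "(LINT t|leb01. deriv \<phi> t *\<^sub>R antideriv w t) = - (LINT t|leb01. \<phi> t *\<^sub>R w t)"
proof -
  interpret P: pair_sigma_finite leb01 leb01 ..
  let ?d = "deriv \<phi>"
  obtain B where B0: "B \<ge> 0" and B: "\<And>t. t \<in> {0..1} \<Longrightarrow> \<bar>?d t\<bar> \<le> B"
    using continuous_bounded_01[OF test_fun_cont(2)[OF phi]] by (metis real_norm_def)
  have dm [measurable]: "?d \<in> borel_measurable leb01" and wm [measurable]: "w \<in> borel_measurable leb01"
    using phi w by (auto intro: continuous_on_measurable_leb01 L2_measurable)
  define f where "f = (\<lambda>(t, s). (indicator {s..} t * ?d t) *\<^sub>R w s)"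
  have f_meas [measurable]: "f \<in> borel_measurable (leb01 \<Otimes>\<^sub>M leb01)"
  proof -
    have "f = (\<lambda>x. ((if snd x \<le> fst x then 1 else 0) * ?d (fst x)) *\<^sub>R w (snd x))"
      by (auto simp: f_def fun_eq_iff)
    also have "\<dots> \<in> borel_measurable (leb01 \<Otimes>\<^sub>M leb01)"
      by (intro borel_measurable_scaleR borel_measurable_times measurable_If borel_measurable_const
          borel_measurable_le measurable_compose[OF measurable_fst] measurable_compose[OF measurable_snd]
          measurable_id_leb01 dm wm)
    finally show ?thesis .
  qed
  have wi: "integrable leb01 w" by (rule L2_integrable[OF w])
  have f_le: "norm (f (t, s)) \<le> B * norm (w s)" if "t \<in> {0..1}" for t s
    using B[OF that] B0 by (auto simp: f_def mult_right_mono split: split_indicator)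
  have f_int: "integrable (leb01 \<Otimes>\<^sub>M leb01) f"
  proof (rule Bochner_Integration.integrable_bound)
    show "integrable (leb01 \<Otimes>\<^sub>M leb01) (\<lambda>(t, s). (1::real) * (B * norm (w s)))"
    proof (rule P.Fubini_integrable)
      show "(\<lambda>(t, s). (1::real) * (B * norm (w s))) \<in> borel_measurable (leb01 \<Otimes>\<^sub>M leb01)"
        using measurable_compose[OF measurable_snd wm, of leb01] by (auto simp: split_beta)
    qed (use wi in auto)
    show "AE x in leb01 \<Otimes>\<^sub>M leb01. norm (f x) \<le> norm (case x of (t, s) \<Rightarrow> (1::real) * (B * norm (w s)))"
      using f_le B0 by (intro AE_I2) (auto simp: space_pair_measure abs_mult)
  qed measurable
  have "(LINT t|leb01. ?d t *\<^sub>R antideriv w t) = (LINT t|leb01. (LINT s|leb01. f (t, s)))"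
  proof (rule Bochner_Integration.integral_cong[OF refl])
    fix t assume "t \<in> space leb01"
    have "?d t *\<^sub>R antideriv w t = (LINT s|leb01. ?d t *\<^sub>R (indicator {0..t} s *\<^sub>R w s))"
      unfolding antideriv_def set_lebesgue_integral_def by (rule integral_scaleR_right[symmetric])
    also have "\<dots> = (LINT s|leb01. f (t, s))"
      by (rule Bochner_Integration.integral_cong[OF refl]) (auto simp: f_def split: split_indicator)
    finally show "?d t *\<^sub>R antideriv w t = (LINT s|leb01. f (t, s))" .
  qed
  also have "\<dots> = (LINT s|leb01. (LINT t|leb01. f (t, s)))"
    using P.Fubini_integral[of "\<lambda>t s. f (t, s)"] f_int by simp
  also have "\<dots> = (LINT s|leb01. - (\<phi> s *\<^sub>R w s))"
  proof (rule integral_cong_AE)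
    show "AE s in leb01. (LINT t|leb01. f (t, s)) = - (\<phi> s *\<^sub>R w s)"
    proof (rule AE_I2)
      fix s assume "s \<in> space leb01"
      then have s: "s \<in> {0..1}" by simp
      have di: "integrable leb01 ?d" using phi by (simp add: continuous_on_integrable_leb01)
      have ae: "AE t in leb01. t \<noteq> s"
        unfolding leb01_def by (subst AE_restrict_space_iff) (auto intro: AE_mp[OF AE_lborel_singleton[of s]])
      have "(LINT t|leb01. f (t, s)) = (LINT t|leb01. (indicator {s<..1} t *\<^sub>R ?d t) *\<^sub>R w s)"
      proof (rule integral_cong_AE)
        show "AE t in leb01. f (t, s) = (indicator {s<..1} t *\<^sub>R ?d t) *\<^sub>R w s"
          using ae AE_space by eventually_elim (auto simp: f_def split: split_indicator)
        have "(\<lambda>t. (t, s)) \<in> leb01 \<rightarrow>\<^sub>M leb01 \<Otimes>\<^sub>M leb01" using s by (intro measurable_Pair2') simp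
        from measurable_compose[OF this f_meas] show "(\<lambda>t. f (t, s)) \<in> borel_measurable leb01" .
        show "(\<lambda>t. (indicator {s<..1} t *\<^sub>R ?d t) *\<^sub>R w s) \<in> borel_measurable leb01"
          using s by (intro borel_measurable_scaleR borel_measurable_const borel_measurable_indicator dm)
            (auto intro: sets_leb01_Ioc)
      qed
      also have "\<dots> = (LINT t:{s<..1}|leb01. ?d t) *\<^sub>R w s"
        unfolding set_lebesgue_integral_def
        by (rule integral_scaleR_left)
          (use s set_integrable_leb01_sub[OF di sets_leb01_Ioc[of s 1]] in \<open>auto simp: set_integrable_def\<close>)
      also have "(LINT t:{s<..1}|leb01. ?d t) = antideriv ?d 1 - antideriv ?d s"
        using s di by (subst antideriv_diff) auto
      also have "\<dots> = - \<phi> s"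
        using s phi test_funD(4)[OF phi] by (simp add: antideriv_deriv_test_fun)
      finally show "(LINT t|leb01. f (t, s)) = - (\<phi> s *\<^sub>R w s)" by simp
    qed
    show "(\<lambda>s. - (\<phi> s *\<^sub>R w s)) \<in> borel_measurable leb01"
      using continuous_on_measurable_leb01[OF test_fun_cont(1)[OF phi]] by measurable
  qed measurable
  finally show ?thesis by simp
qed

lemma L2_scaleR_continuous:
  fixes w :: "real \<Rightarrow> 'a::euclidean_space" and f :: "real \<Rightarrow> real"
  assumes "L2 w" "continuous_on {0..1} f"
  shows "L2 (\<lambda>t. f t *\<^sub>R w t)"
proof -
  obtain B where B: "\<And>t. t \<in> {0..1} \<Longrightarrow> \<bar>f t\<bar> \<le> B"
    using continuous_bounded_01[OF assms(2)] by (metis real_norm_def)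
  show ?thesis
  proof (rule L2_bound)
    show "integrable leb01 (\<lambda>t. B\<^sup>2 * (norm (w t))\<^sup>2)" using L2_sq[OF assms(1)] by simp
    show "AE t in leb01. (norm (f t *\<^sub>R w t))\<^sup>2 \<le> B\<^sup>2 * (norm (w t))\<^sup>2"
    proof (rule AE_I2)
      fix t assume "t \<in> space leb01"
      then have "\<bar>f t\<bar>\<^sup>2 \<le> B\<^sup>2" using B[of t] by (intro power_mono) auto
      then show "(norm (f t *\<^sub>R w t))\<^sup>2 \<le> B\<^sup>2 * (norm (w t))\<^sup>2"
        by (simp add: power_mult_distrib mult_right_mono)
    qed
    show "(\<lambda>t. f t *\<^sub>R w t) \<in> borel_measurable leb01"
      by (intro borel_measurable_scaleR continuous_on_measurable_leb01 assms L2_measurable)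
  qed
qed

lemma is_weak_deriv_iff:
  fixes u v :: "real \<Rightarrow> 'a::euclidean_space"
  shows "is_weak_deriv u v \<longleftrightarrow> L2 v \<and> (\<forall>\<phi>. test_fun \<phi> \<longrightarrow>
    (LINT t|leb01. deriv \<phi> t *\<^sub>R u t) = - (LINT t|leb01. \<phi> t *\<^sub>R v t))"
  by (simp add: is_weak_deriv_def lint_leb01)

lemma primitiveD:
  assumes "primitive u w"
  shows "L2 w" "t \<in> {0..1} \<Longrightarrow> u t = u 0 + antideriv w t"
  using assms by (simp_all add: primitive_def)

lemma integral_deriv_test_fun:
  assumes "test_fun \<phi>" shows "(LINT t|leb01. deriv \<phi> t) = 0"
  using antideriv_deriv_test_fun[OF assms, of 1] test_funD(4)[OF assms] by (simp add: antideriv_1)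

lemma primitive_imp_is_weak_deriv:
  fixes u :: "real \<Rightarrow> 'a::euclidean_space"
  assumes "primitive u w" shows "is_weak_deriv u w"
  unfolding is_weak_deriv_iff
proof (intro conjI allI impI)
  show w: "L2 w" by (rule primitiveD(1)[OF assms])
  fix \<phi> assume phi: "test_fun \<phi>"
  have i: "integrable leb01 (\<lambda>t. deriv \<phi> t *\<^sub>R c t)" if "continuous_on {0..1} c" for c :: "real \<Rightarrow> 'a"
    by (rule continuous_on_integrable_leb01[OF continuous_on_scaleR[OF test_fun_cont(2)[OF phi] that]])
  have "(LINT t|leb01. deriv \<phi> t *\<^sub>R u t) =
      (LINT t|leb01. deriv \<phi> t *\<^sub>R u 0 + deriv \<phi> t *\<^sub>R antideriv w t)"
  proof (rule Bochner_Integration.integral_cong[OF refl])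
    fix t assume "t \<in> space leb01"
    then have "u t = u 0 + antideriv w t" by (intro primitiveD(2)[OF assms]) simp
    then show "deriv \<phi> t *\<^sub>R u t = deriv \<phi> t *\<^sub>R u 0 + deriv \<phi> t *\<^sub>R antideriv w t"
      using scaleR_add_right by metis
  qed
  also have "\<dots> = (LINT t|leb01. deriv \<phi> t *\<^sub>R u 0) + (LINT t|leb01. deriv \<phi> t *\<^sub>R antideriv w t)"
    by (rule Bochner_Integration.integral_add[OF i[OF continuous_on_const] i[OF continuous_on_antideriv[OF L2_integrable[OF w]]]])
  also have "(LINT t|leb01. deriv \<phi> t *\<^sub>R u 0) = (LINT t|leb01. deriv \<phi> t) *\<^sub>R u 0"
    by (rule integral_scaleR_left) (rule continuous_on_integrable_leb01[OF test_fun_cont(2)[OF phi]])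
  finally show "(LINT t|leb01. deriv \<phi> t *\<^sub>R u t) = - (LINT t|leb01. \<phi> t *\<^sub>R w t)"
    by (simp add: integral_deriv_test_fun[OF phi] integral_test_fun_primitive[OF w phi])
qed

text \<open>
  A primitive of \<open>\<psi>\<close> is constant on either side of the support of \<open>\<psi>\<close>, and the vanishing mean makes both
  constants equal.
\<close>

lemma test_fun_of_derivative:
  fixes \<psi> :: "real \<Rightarrow> real"
  assumes cont: "continuous_on UNIV \<psi>" and h: "0 < h"
    and supp: "\<And>t. t \<notin> {h..1 - h} \<Longrightarrow> \<psi> t = 0" and mean: "(LINT t|leb01. \<psi> t) = 0"
  obtains \<phi> where "test_fun \<phi>" "deriv \<phi> = \<psi>"
proof -
  have "\<exists>F. \<forall>x::real. - \<infinity> < ereal x \<longrightarrow> ereal x < \<infinity> \<longrightarrow> (F has_vector_derivative \<psi> x) (at x)"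
    by (rule einterval_antiderivative) (use cont in \<open>auto simp: continuous_on_eq_continuous_at\<close>)
  then obtain F where F: "\<And>t. (F has_vector_derivative \<psi> t) (at t)" by auto
  define \<phi> where "\<phi> t = F t - F 0" for t
  have phi: "(\<phi> has_real_derivative \<psi> t) (at t)" for t
    using F[of t] unfolding \<phi>_def has_real_derivative_iff_has_vector_derivative[symmetric]
    by (auto intro!: derivative_eq_intros)
  have phi0: "\<phi> 0 = 0" by (simp add: \<phi>_def)
  have phi1: "\<phi> 1 = 0"
  proof -
    have "antideriv \<psi> 1 = \<phi> 1 - \<phi> 0"
    proof (rule antideriv_velocity_diff)
      show "(\<phi> has_vector_derivative \<psi> t) (at t within {0..1})" for t
        using phi[of t] by (auto simp: has_real_derivative_iff_has_vector_derivative intro: has_vector_derivative_at_within)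
      show "continuous_on {0..1} \<psi>" using cont by (rule continuous_on_subset) simp
    qed simp
    then show ?thesis using phi0 mean by (simp add: antideriv_1)
  qed
  have off: "\<phi> t = 0" if t: "t \<in> X" "s \<in> X" "\<phi> s = 0" and X: "convex X" "X \<inter> {h..1 - h} = {}" for t s X
  proof -
    have "\<exists>c. \<forall>x\<in>X. \<phi> x = c"
    proof (rule has_field_derivative_zero_constant[OF X(1)])
      fix x assume "x \<in> X"
      then have "\<psi> x = 0" using X(2) by (intro supp) auto
      then show "(\<phi> has_real_derivative 0) (at x within X)"
        using has_field_derivative_at_within[OF phi[of x]] by simp
    qed
    then show ?thesis using t by metis
  qed
  have out: "\<phi> t = 0" if "t \<notin> {h..1 - h}" for t
    using that off[of t "{..<h}" 0] off[of t "{1 - h<..}" 1] phi0 phi1 h by fastforce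
  have "closure {t. \<phi> t \<noteq> 0} \<subseteq> {h..1 - h}"
    by (rule closure_minimal) (use out in blast, simp)
  then have "closure {t. \<phi> t \<noteq> 0} \<subseteq> {0<..<1}" using h by fastforce
  moreover have "\<phi> C1_differentiable_on UNIV"
    unfolding C1_differentiable_on_def using phi cont
    by (intro exI[of _ \<psi>]) (auto simp: has_real_derivative_iff_has_vector_derivative)
  moreover have "deriv \<phi> = \<psi>" using phi by (intro ext DERIV_imp_deriv)
  ultimately show thesis by (intro that) (simp_all add: test_fun_def)
qed

text \<open>
  Test with \<open>\<phi>' = \<eta> (u - m)\<close>, where \<open>\<eta>\<close> is a cut-off function and \<open>m\<close> the mean of \<open>u\<close> with weight \<open>\<eta>\<close>:
  the choice of \<open>m\<close> makes \<open>\<phi>\<close> admissible and the hypothesis becomes \<open>\<integral> \<eta> (u - m)\<^sup>2 = 0\<close>.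
\<close>

lemma du_Bois_Reymond_real:
  fixes u :: "real \<Rightarrow> real"
  assumes cont: "continuous_on {0..1} u"
    and zero: "\<And>\<phi>. test_fun \<phi> \<Longrightarrow> (LINT t|leb01. deriv \<phi> t * u t) = 0"
    and a: "a \<in> {0<..<1}"
  shows "u a = u (1 / 2)"
proof -
  define h where "h = min a (1 - a) / 3"
  have h: "0 < h" "h < a" "a < 1 - h" "h < 1 / 2" using a by (auto simp: h_def min_def field_simps)
  define \<eta> where "\<eta> t = max 0 (min (t - h) (1 - h - t))" for t
  have \<eta>c: "continuous_on S \<eta>" for S unfolding \<eta>_def by (intro continuous_intros)
  have \<eta>0: "\<eta> t \<ge> 0" "t \<notin> {h..1 - h} \<Longrightarrow> \<eta> t = 0" for t by (auto simp: \<eta>_def)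
  have \<eta>pos: "\<eta> t > 0" if "h < t" "t < 1 - h" for t using that by (simp add: \<eta>_def)
  have int0: "g t = 0" if g: "continuous_on {0..1} g" "\<And>t. g t \<ge> 0" "(LINT t|leb01. g t) = 0" "t \<in> {0..1}"
    for g :: "real \<Rightarrow> real" and t
  proof -
    have "integral {0..1} g = 0"
      using set_borel_integral_eq_integral(2)[OF borel_integrable_atLeastAtMost'[OF g(1)]] g(3) by (simp add: lint_leb01)
    then show ?thesis using integral_eq_0_iff[OF g(1)] g(2,4) by auto
  qed
  define I where "I = (LINT t|leb01. \<eta> t)"
  have I: "I \<noteq> 0" using int0[of \<eta> "1 / 2"] \<eta>c \<eta>0(1) \<eta>pos[of "1 / 2"] h by (auto simp: I_def)
  define m where "m = (LINT t|leb01. \<eta> t * u t) / I"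
  have int: "integrable leb01 \<eta>" "integrable leb01 (\<lambda>t. \<eta> t * u t)"
    by (intro continuous_on_integrable_leb01 continuous_intros \<eta>c cont)+
  \<comment> \<open>\<open>u\<close> is only controlled on the unit interval, so it is composed with the retraction onto it\<close>
  define \<psi> where "\<psi> t = \<eta> t * (u (max 0 (min 1 t)) - m)" for t
  have \<psi>_eq: "\<psi> t = \<eta> t * (u t - m)" if "t \<in> {0..1}" for t using that by (simp add: \<psi>_def)
  have mean: "(LINT t|leb01. \<psi> t) = 0"
  proof -
    have "(LINT t|leb01. \<psi> t) = (LINT t|leb01. \<eta> t * u t - \<eta> t * m)"
      by (rule Bochner_Integration.integral_cong) (auto simp: \<psi>_eq algebra_simps)
    also have "\<dots> = (LINT t|leb01. \<eta> t * u t) - I * m" using int by (simp add: I_def)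
    finally show ?thesis using I by (simp add: m_def)
  qed
  have \<psi>c: "continuous_on UNIV \<psi>"
    unfolding \<psi>_def by (intro continuous_intros \<eta>c continuous_on_compose2[OF cont]) auto
  obtain \<phi> where \<phi>: "test_fun \<phi>" "deriv \<phi> = \<psi>"
  proof (rule test_fun_of_derivative[OF \<psi>c h(1) _ mean])
    show "\<psi> t = 0" if "t \<notin> {h..1 - h}" for t using \<eta>0(2)[OF that] by (simp add: \<psi>_def)
  qed (rule that)
  have "(LINT t|leb01. \<eta> t * (u t - m)\<^sup>2) = (LINT t|leb01. \<psi> t * u t - m * \<psi> t)"
    by (rule Bochner_Integration.integral_cong) (auto simp: \<psi>_eq power2_eq_square algebra_simps)
  also have "\<dots> = (LINT t|leb01. \<psi> t * u t) - (LINT t|leb01. m * \<psi> t)"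
    by (intro Bochner_Integration.integral_diff continuous_on_integrable_leb01 continuous_intros cont
        continuous_on_subset[OF \<psi>c]) auto
  also have "\<dots> = 0" using zero[OF \<phi>(1)] mean \<phi>(2) by simp
  finally have sq: "(LINT t|leb01. \<eta> t * (u t - m)\<^sup>2) = 0" .
  have "u t = m" if "h < t" "t < 1 - h" for t
  proof -
    have "\<eta> t * (u t - m)\<^sup>2 = 0"
      by (rule int0[OF _ _ sq]) (use h that \<eta>0 in \<open>auto intro!: continuous_intros \<eta>c cont\<close>)
    then show ?thesis using \<eta>pos[OF that] by simp
  qed
  then show ?thesis using h by simp
qed

lemma du_Bois_Reymond:
  fixes f :: "real \<Rightarrow> 'a::euclidean_space"
  assumes cont: "continuous_on {0..1} f"
    and zero: "\<And>\<phi>. test_fun \<phi> \<Longrightarrow> (LINT t|leb01. deriv \<phi> t *\<^sub>R f t) = 0"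
    and t: "t \<in> {0..1}"
  shows "f t = f 0"
proof -
  have inner: "f a = f (1 / 2)" if a: "a \<in> {0<..<1}" for a
  proof (rule euclidean_eqI)
    fix b :: 'a assume "b \<in> Basis"
    show "f a \<bullet> b = f (1 / 2) \<bullet> b"
    proof (rule du_Bois_Reymond_real[OF _ _ a])
      show "continuous_on {0..1} (\<lambda>t. f t \<bullet> b)" by (intro continuous_intros cont)
      fix \<phi> assume phi: "test_fun \<phi>"
      have "integrable leb01 (\<lambda>t. deriv \<phi> t *\<^sub>R f t)"
        by (rule continuous_on_integrable_leb01[OF continuous_on_scaleR[OF test_fun_cont(2)[OF phi] cont]])
      then have "(LINT t|leb01. (deriv \<phi> t *\<^sub>R f t) \<bullet> b) = (LINT t|leb01. deriv \<phi> t *\<^sub>R f t) \<bullet> b"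
        by (intro integral_inner_left) auto
      then show "(LINT t|leb01. deriv \<phi> t * (f t \<bullet> b)) = 0" using zero[OF phi] by simp
    qed
  qed
  have *: "f x = f (1 / 2)" if "x \<in> {0..1}" for x
  proof (rule continuous_constant_on_closure[of "{0<..<1}" f])
    show "continuous_on (closure {0<..<1}) f" using cont by simp
    show "x \<in> closure {0<..<1}" using that by simp
  qed (rule inner)
  show ?thesis using *[OF t] *[of 0] by simp
qed

text \<open>
  The primitive of \<open>v\<close> has the same weak derivative as \<open>u\<close>, so the two differ by a constant.
\<close>

lemma is_weak_deriv_imp_primitive:
  fixes u :: "real \<Rightarrow> 'a::euclidean_space"
  assumes u: "continuous_on {0..1} u" and v: "is_weak_deriv u v"
  shows "primitive u v"
proof -
  have v2: "L2 v" using v by (simp add: is_weak_deriv_iff)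
  let ?f = "\<lambda>t. u t - antideriv v t"
  have c: "continuous_on {0..1} (antideriv v)" by (intro continuous_on_antideriv L2_integrable v2)
  have "?f t = ?f 0" if "t \<in> {0..1}" for t
  proof (rule du_Bois_Reymond[OF _ _ that])
    show "continuous_on {0..1} ?f" by (intro continuous_intros u c)
    fix \<phi> assume phi: "test_fun \<phi>"
    have "(LINT t|leb01. deriv \<phi> t *\<^sub>R ?f t)
        = (LINT t|leb01. deriv \<phi> t *\<^sub>R u t) - (LINT t|leb01. deriv \<phi> t *\<^sub>R antideriv v t)"
      unfolding scaleR_diff_right
      by (intro Bochner_Integration.integral_diff continuous_on_integrable_leb01 continuous_on_scaleR
          test_fun_cont phi u c)
    also have "\<dots> = 0"
      using v phi integral_test_fun_primitive[OF v2 phi] by (simp add: is_weak_deriv_iff)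
    finally show "(LINT t|leb01. deriv \<phi> t *\<^sub>R ?f t) = 0" .
  qed
  then have "antideriv v t = u t - u 0" if "t \<in> {0..1}" for t
  proof -
    have "u t - antideriv v t = u 0" using \<open>\<And>t. t \<in> {0..1} \<Longrightarrow> ?f t = ?f 0\<close>[OF that] by simp
    then show ?thesis by (simp add: algebra_simps)
  qed
  then show ?thesis using v2 by (simp add: primitive_def)
qed

lemma is_weak_deriv_unique:
  fixes u :: "real \<Rightarrow> 'a::euclidean_space"
  assumes "is_weak_deriv u v" "is_weak_deriv u v'"
  shows "AE t in leb01. v t = v' t"
proof -
  have v: "L2 v" "L2 v'" using assms by (simp_all add: is_weak_deriv_iff)
  let ?f = "\<lambda>t. v t - v' t"
  have f: "L2 ?f" by (rule L2_diff[OF v])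
  have "antideriv ?f t = antideriv ?f 0" if "t \<in> {0..1}" for t
  proof (rule du_Bois_Reymond[OF _ _ that])
    show "continuous_on {0..1} (antideriv ?f)" by (intro continuous_on_antideriv L2_integrable f)
    fix \<phi> assume phi: "test_fun \<phi>"
    have "(LINT t|leb01. \<phi> t *\<^sub>R ?f t) = (LINT t|leb01. \<phi> t *\<^sub>R v t) - (LINT t|leb01. \<phi> t *\<^sub>R v' t)"
      unfolding scaleR_diff_right
      by (intro Bochner_Integration.integral_diff L2_integrable L2_scaleR_continuous v test_fun_cont phi)
    also have "\<dots> = 0"
    proof -
      have "- (LINT t|leb01. \<phi> t *\<^sub>R v t) = (LINT t|leb01. deriv \<phi> t *\<^sub>R u t)"
        using assms(1) phi by (simp add: is_weak_deriv_iff)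
      also have "\<dots> = - (LINT t|leb01. \<phi> t *\<^sub>R v' t)"
        using assms(2) phi by (simp add: is_weak_deriv_iff)
      finally show ?thesis by simp
    qed
    finally show "(LINT t|leb01. deriv \<phi> t *\<^sub>R antideriv ?f t) = 0"
      by (simp add: integral_test_fun_primitive[OF f phi])
  qed
  then have "AE t in leb01. ?f t = 0"
    by (intro antideriv_zero_imp_AE_zero L2_integrable f) simp
  then show ?thesis by simp
qed

lemma is_weak_deriv_cong_AE:
  fixes u u' :: "real \<Rightarrow> 'a::euclidean_space"
  assumes ae: "AE t in leb01. u t = u' t" and m: "u \<in> borel_measurable leb01" "u' \<in> borel_measurable leb01"
  shows "is_weak_deriv u v \<longleftrightarrow> is_weak_deriv u' v"
proof -
  have "(LINT t|leb01. deriv \<phi> t *\<^sub>R u t) = (LINT t|leb01. deriv \<phi> t *\<^sub>R u' t)" if "test_fun \<phi>" for \<phi>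
  proof (rule integral_cong_AE)
    show "AE t in leb01. deriv \<phi> t *\<^sub>R u t = deriv \<phi> t *\<^sub>R u' t" using ae by eventually_elim simp
  qed (intro borel_measurable_scaleR m continuous_on_measurable_leb01 test_fun_cont that)+
  then show ?thesis by (simp add: is_weak_deriv_iff)
qed

lemma weak_deriv_is_weak_deriv: "is_weak_deriv u v \<Longrightarrow> is_weak_deriv u (weak_deriv u)"
  unfolding weak_deriv_def by (rule someI[of "is_weak_deriv u"])

text \<open>
  The chosen representative of the weak derivative may be replaced under integrals by any other one.
\<close>

lemma weak_deriv_AE:
  fixes u :: "real \<Rightarrow> 'a::euclidean_space"
  assumes "is_weak_deriv u v"
  shows "AE t in leb01. weak_deriv u t = v t" "L2 (weak_deriv u)"
  using is_weak_deriv_unique[OF weak_deriv_is_weak_deriv assms, OF assms]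
    weak_deriv_is_weak_deriv[OF assms] by (auto simp: is_weak_deriv_iff)

lemma weak_deriv_AE2:
  fixes u :: "real \<Rightarrow> 'a::euclidean_space"
  assumes "is_weak_deriv u v" "is_weak_deriv v w"
  shows "AE t in leb01. weak_deriv (weak_deriv u) t = w t" "L2 (weak_deriv (weak_deriv u))"
proof -
  have "is_weak_deriv (weak_deriv u) w"
    using is_weak_deriv_cong_AE[OF weak_deriv_AE(1)[OF assms(1)], of w] assms
    by (simp add: L2_measurable weak_deriv_AE(2) is_weak_deriv_iff[of u v])
  from weak_deriv_AE[OF this] show "AE t in leb01. weak_deriv (weak_deriv u) t = w t"
    "L2 (weak_deriv (weak_deriv u))" by auto
qed

section \<open>Curves of class C1 and H2\<close>

lemma C1D:
  assumes "C1 c"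
  shows "t \<in> {0..1} \<Longrightarrow> (c has_vector_derivative velocity c t) (at t within {0..1})"
    "continuous_on {0..1} (velocity c)" "continuous_on {0..1} c"
  using assms unfolding C1_def velocity_def
  by (auto simp: vector_derivative_works differentiable_on_def differentiable_imp_continuous_on)

lemma velocity_eqI:
  fixes c :: "real \<Rightarrow> 'a::euclidean_space"
  assumes "(c has_vector_derivative v) (at t within {0..1})" "t \<in> {0..1}"
  shows "velocity c t = v"
  unfolding velocity_def
  by (rule vector_derivative_within_cbox[where a=0 and b=1, simplified]) (use assms in auto)

lemma C1I:
  fixes c :: "real \<Rightarrow> 'a::euclidean_space"
  assumes "\<And>t. t \<in> {0..1} \<Longrightarrow> (c has_vector_derivative v t) (at t within {0..1})"
    and "continuous_on {0..1} v"
  shows "C1 c"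
proof -
  have "continuous_on {0..1} (velocity c)"
    by (subst continuous_on_cong[OF refl velocity_eqI[OF assms(1)]]) (use assms in auto)
  moreover have "c differentiable_on {0..1}"
    unfolding differentiable_on_def using assms(1) differentiableI_vector by blast
  ultimately show ?thesis by (simp add: C1_def)
qed

lemma C1_primitive:
  fixes c :: "real \<Rightarrow> 'a::euclidean_space"
  assumes "C1 c" shows "primitive c (velocity c)"
  using antideriv_velocity_diff[OF C1D(1)[OF assms] C1D(2)[OF assms]] C1D(2)[OF assms]
  by (auto simp: primitive_def L2_continuous)

lemma primitive_dominated:
  fixes u :: "real \<Rightarrow> 'a::euclidean_space"
  assumes "primitive u w"
  shows "dominated u (antideriv (\<lambda>t. (norm (w t))\<^sup>2))"
proof -
  have L: "L2 w" using assms by (simp add: primitive_def)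
  have "u t - u s = antideriv w t - antideriv w s" if "s \<in> {0..1}" "t \<in> {0..1}" for s t
    using assms that by (simp add: primitive_def)
  then show ?thesis using dominated_antideriv[OF L] unfolding dominated_def by auto
qed

lemma H2I:
  fixes c :: "real \<Rightarrow> 'a::euclidean_space"
  assumes "C1 c" "primitive (velocity c) w"
  shows "H2 c" "AE t in leb01. weak_deriv c t = velocity c t"
    "AE t in leb01. weak_deriv (weak_deriv c) t = w t"
    "L2 (weak_deriv c)" "L2 (weak_deriv (weak_deriv c))"
proof -
  have 1: "is_weak_deriv c (velocity c)" using C1_primitive[OF assms(1)] by (rule primitive_imp_is_weak_deriv)
  have 2: "is_weak_deriv (velocity c) w" using assms(2) by (rule primitive_imp_is_weak_deriv)
  show "H2 c" unfolding H2_def using 1 2 L2_continuous[OF C1D(3)[OF assms(1)]] by auto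
  show "AE t in leb01. weak_deriv c t = velocity c t" "L2 (weak_deriv c)"
    by (rule weak_deriv_AE[OF 1])+
  show "AE t in leb01. weak_deriv (weak_deriv c) t = w t" "L2 (weak_deriv (weak_deriv c))"
    by (rule weak_deriv_AE2[OF 1 2])+
qed

lemma H2D:
  fixes c :: "real \<Rightarrow> 'a::euclidean_space"
  assumes "C1 c" "H2 c"
  obtains w where "primitive (velocity c) w"
proof -
  have 1: "is_weak_deriv c (velocity c)" using C1_primitive[OF assms(1)] by (rule primitive_imp_is_weak_deriv)
  obtain v w where v: "is_weak_deriv c v" "is_weak_deriv v w" using assms(2) by (auto simp: H2_def)
  have m: "v \<in> borel_measurable leb01" "velocity c \<in> borel_measurable leb01"
    using v(1) 1 by (auto simp: is_weak_deriv_iff L2_measurable)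
  have "is_weak_deriv (velocity c) w"
    using is_weak_deriv_cong_AE[OF is_weak_deriv_unique[OF v(1) 1] m] v(2) by simp
  then show thesis by (intro that is_weak_deriv_imp_primitive C1D(2) assms)
qed

text \<open>
  For curves of class \<open>C\<^sup>1\<close> this trades two weak derivatives for one pointwise inequality.
\<close>

lemma H2_iff_dominated:
  fixes c :: "real \<Rightarrow> 'a::euclidean_space"
  assumes "C1 c"
  shows "H2 c \<longleftrightarrow> (\<exists>\<Phi>. dominated (velocity c) \<Phi>)"
proof
  assume "H2 c"
  then obtain w where "primitive (velocity c) w" by (rule H2D[OF assms])
  then show "\<exists>\<Phi>. dominated (velocity c) \<Phi>" using primitive_dominated by blast
next
  assume "\<exists>\<Phi>. dominated (velocity c) \<Phi>"
  then obtain \<Phi> where "dominated (velocity c) \<Phi>" by blast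
  then obtain w where "primitive (velocity c) w"
    by (rule dominated_imp_primitive) blast
  with assms show "H2 c" by (rule H2I)
qed

section \<open>Weak H2 and Hoelder convergence\<close>

lemma tendsto_inner_uniform:
  fixes f :: "nat \<Rightarrow> real \<Rightarrow> 'a::euclidean_space"
  assumes f: "\<And>n. continuous_on {0..1} (f n)" and g: "continuous_on {0..1} g"
    and lim: "uniform_limit {0..1} f g sequentially" and h: "L2 h"
  shows "(\<lambda>n. LINT t|leb01. f n t \<bullet> h t) \<longlonglongrightarrow> (LINT t|leb01. g t \<bullet> h t)"
proof (rule tendstoI)
  fix e :: real assume e: "e > 0"
  define I where "I = (LINT t|leb01. norm (h t))"
  have I: "I \<ge> 0" by (simp add: I_def)
  have hi: "integrable leb01 (\<lambda>t. norm (h t))" by (rule integrable_norm[OF L2_integrable[OF h]])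
  define d where "d = e / (I + 1)"
  have d: "d > 0" using e I by (simp add: d_def)
  have "d * I < e" using e I by (simp add: d_def field_simps)
  from uniform_limitD[OF lim d]
  show "\<forall>\<^sub>F n in sequentially. dist (LINT t|leb01. f n t \<bullet> h t) (LINT t|leb01. g t \<bullet> h t) < e"
  proof eventually_elim
    case (elim n)
    have fi: "integrable leb01 (\<lambda>t. f n t \<bullet> h t)" and gi: "integrable leb01 (\<lambda>t. g t \<bullet> h t)"
      by (intro L2_inner_integrable L2_continuous f g h)+
    have "(LINT t|leb01. f n t \<bullet> h t) - (LINT t|leb01. g t \<bullet> h t) = (LINT t|leb01. (f n t - g t) \<bullet> h t)"
      using fi gi by (simp add: inner_diff_left)
    also have "norm \<dots> \<le> (LINT t|leb01. d * norm (h t))"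
    proof (rule Bochner_Integration.integral_norm_bound_integral)
      show "integrable leb01 (\<lambda>t. (f n t - g t) \<bullet> h t)" using fi gi by (simp add: inner_diff_left)
      show "integrable leb01 (\<lambda>t. d * norm (h t))" using hi by simp
      fix t assume "t \<in> space leb01"
      then have le: "norm (f n t - g t) \<le> d" using elim by (auto simp: dist_norm less_imp_le)
      have "norm ((f n t - g t) \<bullet> h t) \<le> norm (f n t - g t) * norm (h t)"
        using Cauchy_Schwarz_ineq2 by simp
      also have "\<dots> \<le> d * norm (h t)" by (rule mult_right_mono[OF le]) simp
      finally show "norm ((f n t - g t) \<bullet> h t) \<le> d * norm (h t)" .
    qed
    also have "\<dots> = d * I" by (simp add: I_def)
    finally show ?case using \<open>d * I < e\<close> by (simp add: dist_norm)
  qed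
qed

text \<open>
  Step functions are dense, and against a step function the integrals of \<open>w n\<close> involve only finitely
  many values of the primitives. The bound \<open>K\<close> controls the error of replacing \<open>h\<close> by a step function
  uniformly in \<open>n\<close>.
\<close>

lemma tendsto_inner_weak:
  fixes w :: "nat \<Rightarrow> real \<Rightarrow> 'a::euclidean_space"
  assumes w: "\<And>n. L2 (w n)" "\<And>n. (LINT t|leb01. (norm (w n t))\<^sup>2) \<le> K"
    and v: "L2 v" "(LINT t|leb01. (norm (v t))\<^sup>2) \<le> K"
    and lim: "\<And>t. t \<in> {0..1} \<Longrightarrow> (\<lambda>n. antideriv (w n) t) \<longlonglongrightarrow> antideriv v t"
    and h: "L2 h"
  shows "(\<lambda>n. LINT t|leb01. w n t \<bullet> h t) \<longlonglongrightarrow> (LINT t|leb01. v t \<bullet> h t)"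
proof (rule tendstoI)
  fix e :: real assume e: "e > 0"
  have K0: "K \<ge> 0" by (rule order_trans[OF _ v(2)]) simp
  obtain r where r: "(\<lambda>i. LINT t|leb01. (norm (h t - dstep (antideriv h) (r i) t))\<^sup>2) \<longlonglongrightarrow> 0"
    using L2_step_approx[OF h] .
  have "(e / 3)\<^sup>2 / (K + 1) > 0" using e K0 by simp
  from order_tendstoD(2)[OF r this] obtain i
    where i: "(LINT t|leb01. (norm (h t - dstep (antideriv h) (r i) t))\<^sup>2) < (e / 3)\<^sup>2 / (K + 1)"
    by (auto simp: eventually_sequentially)
  define s where "s = dstep (antideriv h) (r i)"
  have s: "L2 s" unfolding s_def by (rule L2_dstep)
  define D where "D = (LINT t|leb01. (norm (h t - s t))\<^sup>2)"
  have D: "D < (e / 3)\<^sup>2 / (K + 1)" "D \<ge> 0" using i by (simp_all add: D_def s_def)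
  have near: "\<bar>(LINT t|leb01. u t \<bullet> h t) - (LINT t|leb01. u t \<bullet> s t)\<bar> < e / 3"
    if u: "L2 u" "(LINT t|leb01. (norm (u t))\<^sup>2) \<le> K" for u
  proof -
    have "(LINT t|leb01. u t \<bullet> h t) - (LINT t|leb01. u t \<bullet> s t) = (LINT t|leb01. u t \<bullet> (h t - s t))"
      using L2_inner_integrable[OF u(1) h] L2_inner_integrable[OF u(1) s] by (simp add: inner_diff_right)
    then have "((LINT t|leb01. u t \<bullet> h t) - (LINT t|leb01. u t \<bullet> s t))\<^sup>2
        \<le> (LINT t|leb01. (norm (u t))\<^sup>2) * D"
      using L2_inner_bound[OF u(1) L2_diff[OF h s]] by (simp add: D_def)
    also have "\<dots> \<le> (K + 1) * D" using u(2) D(2) by (intro mult_right_mono) auto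
    also have "\<dots> < (e / 3)\<^sup>2" using D(1) K0 by (simp add: field_simps)
    finally have "\<bar>(LINT t|leb01. u t \<bullet> h t) - (LINT t|leb01. u t \<bullet> s t)\<bar>\<^sup>2 < (e / 3)\<^sup>2" by simp
    then show ?thesis by (rule power2_less_imp_less) (use e in simp)
  qed
  have "(\<lambda>n. LINT t|leb01. w n t \<bullet> s t) \<longlonglongrightarrow> (LINT t|leb01. v t \<bullet> s t)"
    unfolding s_def integral_inner_dstep[OF L2_integrable[OF w(1)]] integral_inner_dstep[OF L2_integrable[OF v(1)]]
  proof (intro tendsto_sum tendsto_inner tendsto_diff lim tendsto_const)
    fix k :: nat assume "k \<in> {..<2 ^ r i}"
    then have k: "k < 2 ^ r i" by simp
    show "real (Suc k) / 2 ^ r i \<in> {0..1}" "real k / 2 ^ r i \<in> {0..1}"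
      using order_trans[OF dyadic_bounds(1,2)[OF k]] order_trans[OF dyadic_bounds(2,3)[OF k]]
        dyadic_bounds[OF k] by (simp_all only: atLeastAtMost_iff simp_thms)
  qed
  from tendstoD[OF this, of "e / 3"] e
  have "\<forall>\<^sub>F n in sequentially. dist (LINT t|leb01. w n t \<bullet> s t) (LINT t|leb01. v t \<bullet> s t) < e / 3"
    by simp
  then show "\<forall>\<^sub>F n in sequentially. dist (LINT t|leb01. w n t \<bullet> h t) (LINT t|leb01. v t \<bullet> h t) < e"
  proof eventually_elim
    case (elim n)
    then show ?case using near[OF w(1,2)[of n]] near[OF v] unfolding dist_real_def by linarith
  qed
qed

text \<open>
  The functions \<open>\<Phi> n\<close> need not converge. What passes to the limit are the Hoelder bound and the energies
  \<open>denergy\<close>, which are finite sums.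
\<close>

lemma dominated_limit:
  fixes g :: "nat \<Rightarrow> real \<Rightarrow> 'a::euclidean_space"
  assumes dom: "\<And>n. dominated (g n) (\<Phi> n)" "\<And>n. \<Phi> n 1 - \<Phi> n 0 \<le> K"
    and lim: "\<And>t. t \<in> {0..1} \<Longrightarrow> (\<lambda>n. g n t) \<longlonglongrightarrow> f t"
  shows "\<And>s t. s \<in> {0..1} \<Longrightarrow> t \<in> {0..1} \<Longrightarrow> (norm (f t - f s))\<^sup>2 \<le> K * \<bar>t - s\<bar>"
    and "\<exists>w. primitive f w \<and> (LINT t|leb01. (norm (w t))\<^sup>2) \<le> K"
proof -
  show h: "(norm (f t - f s))\<^sup>2 \<le> K * \<bar>t - s\<bar>" if "s \<in> {0..1}" "t \<in> {0..1}" for s t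
  proof (rule LIMSEQ_le_const2)
    show "(\<lambda>n. (norm (g n t - g n s))\<^sup>2) \<longlonglongrightarrow> (norm (f t - f s))\<^sup>2"
      by (intro tendsto_intros lim that)
    show "\<exists>N. \<forall>n\<ge>N. (norm (g n t - g n s))\<^sup>2 \<le> K * \<bar>t - s\<bar>"
      using dominated_holder[OF dom that] by blast
  qed
  have c: "continuous_on {0..1} f" by (rule holder_continuous_on[OF h])
  have "denergy f m \<le> K" for m
  proof (rule LIMSEQ_le_const2)
    show "(\<lambda>n. denergy (g n) m) \<longlonglongrightarrow> denergy f m"
      unfolding denergy_def
    proof (intro tendsto_sum tendsto_mult_left tendsto_power tendsto_norm tendsto_diff lim)
      fix k :: nat assume "k \<in> {..<2 ^ m}"
      then have k: "k < 2 ^ m" by simp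
      show "real (Suc k) / 2 ^ m \<in> {0..1}" "real k / 2 ^ m \<in> {0..1}"
        using order_trans[OF dyadic_bounds(1,2)[OF k]] order_trans[OF dyadic_bounds(2,3)[OF k]]
          dyadic_bounds[OF k] by (simp_all only: atLeastAtMost_iff simp_thms)
    qed
    show "\<exists>N. \<forall>n\<ge>N. denergy (g n) m \<le> K"
      using dominated_denergy[OF dom(1)] dom(2) order_trans by blast
  qed
  then show "\<exists>w. primitive f w \<and> (LINT t|leb01. (norm (w t))\<^sup>2) \<le> K"
    by (rule bounded_denergy_imp_primitive[OF c]) blast
qed

lemma C1_holder_norm_le:
  fixes u :: "real \<Rightarrow> 'a::euclidean_space"
  assumes "A \<ge> 0" "B \<ge> 0" "H \<ge> 0"
    and "\<And>t. t \<in> {0..1} \<Longrightarrow> norm (u t) \<le> A" "\<And>t. t \<in> {0..1} \<Longrightarrow> norm (velocity u t) \<le> B"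
    and "\<And>s t. s \<in> {0..1} \<Longrightarrow> t \<in> {0..1} \<Longrightarrow> norm (velocity u s - velocity u t) \<le> H * \<bar>s - t\<bar> powr \<alpha>"
  shows "C1_holder_norm \<alpha> u \<le> ennreal (A + B + H)"
proof -
  have "C1_holder_norm \<alpha> u \<le> ennreal A + ennreal B + ennreal H"
    unfolding C1_holder_norm_def
  proof (intro add_mono SUP_least)
    fix x :: "real \<times> real" assume "x \<in> {(s, t). s \<in> {0..1} \<and> t \<in> {0..1} \<and> s \<noteq> t}"
    then obtain s t where x: "x = (s, t)" "s \<in> {0..1}" "t \<in> {0..1}" "s \<noteq> t" by auto
    then have "norm (velocity u s - velocity u t) / \<bar>s - t\<bar> powr \<alpha> \<le> H"
      using assms(6)[OF x(2,3)] by (simp add: divide_le_eq)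
    then show "(case x of (s, t) \<Rightarrow> ennreal (norm (velocity u s - velocity u t) / \<bar>s - t\<bar> powr \<alpha>)) \<le> ennreal H"
      using x(1) by (simp add: ennreal_leI)
  qed (use assms in \<open>auto intro!: ennreal_leI\<close>)
  then show ?thesis using assms(1-3) by (simp add: ennreal_plus)
qed

lemma sqrt_holder:
  fixes x :: "'a::real_normed_vector"
  assumes "(norm x)\<^sup>2 \<le> K * \<bar>d\<bar>" "K \<ge> 0"
  shows "norm x \<le> sqrt K * \<bar>d\<bar> powr (1 / 2)"
proof -
  have "norm x \<le> sqrt (K * \<bar>d\<bar>)" using assms(1) by (rule real_le_rsqrt)
  then show ?thesis by (simp add: real_sqrt_mult powr_half_sqrt)
qed

lemma C1_holder_of_half:
  fixes u :: "real \<Rightarrow> 'a::euclidean_space"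
  assumes C1: "C1 u" and K: "K \<ge> 0" and \<alpha>: "0 < \<alpha>" "\<alpha> < 1 / 2"
    and h: "\<And>s t. s \<in> {0..1} \<Longrightarrow> t \<in> {0..1} \<Longrightarrow> (norm (velocity u t - velocity u s))\<^sup>2 \<le> K * \<bar>t - s\<bar>"
  shows "C1_holder \<alpha> u"
proof -
  obtain A where A: "A \<ge> 0" "\<And>t. t \<in> {0..1} \<Longrightarrow> norm (u t) \<le> A"
    using continuous_bounded_01[OF C1D(3)[OF C1]] by blast
  obtain B where B: "B \<ge> 0" "\<And>t. t \<in> {0..1} \<Longrightarrow> norm (velocity u t) \<le> B"
    using continuous_bounded_01[OF C1D(2)[OF C1]] by blast
  have "C1_holder_norm \<alpha> u \<le> ennreal (A + B + sqrt K)"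
  proof (rule C1_holder_norm_le)
    fix s t :: real assume st: "s \<in> {0..1}" "t \<in> {0..1}"
    have "norm (velocity u s - velocity u t) \<le> sqrt K * \<bar>s - t\<bar> powr (1 / 2)"
      by (rule sqrt_holder[OF h[OF st(2,1)] K])
    also have "\<dots> \<le> sqrt K * \<bar>s - t\<bar> powr \<alpha>"
      using st \<alpha> K by (intro mult_left_mono powr_mono') auto
    finally show "norm (velocity u s - velocity u t) \<le> sqrt K * \<bar>s - t\<bar> powr \<alpha>" .
  qed (use A B K in auto)
  then show ?thesis using C1 by (auto simp: C1_holder_def intro: le_less_trans)
qed

text \<open>
  Interpolation between a bound and a Hoelder bound of exponent \<open>1/2\<close>, as \<open>2\<alpha> \<cdot> 1/2 + (1 - 2\<alpha>) \<cdot> 0 = \<alpha>\<close>.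
\<close>

lemma holder_interpolation:
  fixes x :: "'a::real_normed_vector"
  assumes "norm x \<le> a * \<bar>d\<bar> powr (1 / 2)" "norm x \<le> b" "0 < \<alpha>" "\<alpha> < 1 / 2" "a \<ge> 0" "b \<ge> 0"
  shows "norm x \<le> a powr (2 * \<alpha>) * b powr (1 - 2 * \<alpha>) * \<bar>d\<bar> powr \<alpha>"
proof (cases "norm x = 0")
  case False
  have "norm x = norm x powr (2 * \<alpha>) * norm x powr (1 - 2 * \<alpha>)"
    using False by (simp flip: powr_add)
  also have "\<dots> \<le> (a * \<bar>d\<bar> powr (1 / 2)) powr (2 * \<alpha>) * b powr (1 - 2 * \<alpha>)"
    using assms by (intro mult_mono powr_mono2) auto
  also have "(a * \<bar>d\<bar> powr (1 / 2)) powr (2 * \<alpha>) = a powr (2 * \<alpha>) * \<bar>d\<bar> powr \<alpha>"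
    using assms by (simp add: powr_mult powr_powr)
  finally show ?thesis by (simp add: mult_ac)
qed simp

lemma tendsto_0_ennrealI:
  fixes x :: "nat \<Rightarrow> ennreal"
  assumes "\<And>e. e > 0 \<Longrightarrow> \<forall>\<^sub>F n in sequentially. x n \<le> ennreal e"
  shows "x \<longlonglongrightarrow> 0"
proof (rule order_tendstoI)
  fix a :: ennreal assume "0 < a"
  then obtain y where y: "0 < y" "y < a" using dense by blast
  then obtain e where e: "y = ennreal e" "e \<ge> 0" by (cases y) auto
  then have "e > 0" using y by auto
  from assms[OF this] show "\<forall>\<^sub>F n in sequentially. x n < a"
    by eventually_elim (use y e in \<open>auto intro: le_less_trans\<close>)
qed auto

lemma velocity_diff:
  fixes u v :: "real \<Rightarrow> 'a::euclidean_space"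
  assumes "C1 u" "C1 v" "t \<in> {0..1}"
  shows "velocity (\<lambda>t. u t - v t) t = velocity u t - velocity v t"
  by (intro velocity_eqI has_vector_derivative_diff C1D(1) assms)

lemma H2_inner_primitive:
  fixes u h :: "real \<Rightarrow> 'a::euclidean_space"
  assumes u: "C1 u" "primitive (velocity u) z" and h: "H2 h"
  shows "H2_inner u h = (LINT t|leb01. u t \<bullet> h t) + (LINT t|leb01. velocity u t \<bullet> weak_deriv h t)
      + (LINT t|leb01. z t \<bullet> weak_deriv (weak_deriv h) t)"
proof -
  obtain v w where vw: "is_weak_deriv h v" "is_weak_deriv v w" using h by (auto simp: H2_def)
  have h1: "L2 (weak_deriv h)" "L2 (weak_deriv (weak_deriv h))"
    using weak_deriv_AE[OF vw(1)] weak_deriv_AE2[OF vw] by auto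
  note H = H2I[OF u]
  have "(LINT t|leb01. weak_deriv u t \<bullet> weak_deriv h t) = (LINT t|leb01. velocity u t \<bullet> weak_deriv h t)"
  proof (rule integral_cong_AE)
    show "AE t in leb01. weak_deriv u t \<bullet> weak_deriv h t = velocity u t \<bullet> weak_deriv h t"
      using H(2) by eventually_elim simp
  qed (rule borel_measurable_inner; rule L2_measurable; rule h1 H L2_continuous[OF C1D(2)[OF u(1)]])+
  moreover have "(LINT t|leb01. weak_deriv (weak_deriv u) t \<bullet> weak_deriv (weak_deriv h) t)
      = (LINT t|leb01. z t \<bullet> weak_deriv (weak_deriv h) t)"
  proof (rule integral_cong_AE)
    show "AE t in leb01. weak_deriv (weak_deriv u) t \<bullet> weak_deriv (weak_deriv h) t = z t \<bullet> weak_deriv (weak_deriv h) t"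
      using H(3) by eventually_elim simp
  qed (rule borel_measurable_inner; rule L2_measurable; rule h1 H primitiveD(1)[OF u(2)])+
  ultimately show ?thesis by (simp add: H2_inner_def lint_leb01)
qed

lemma weak_H2_convI:
  fixes c :: "nat \<Rightarrow> real \<Rightarrow> 'a::euclidean_space"
  assumes C1: "\<And>n. C1 (c n)" and C1': "C1 c'"
    and w: "\<And>n. primitive (velocity (c n)) (w n)" "\<And>n. (LINT t|leb01. (norm (w n t))\<^sup>2) \<le> K"
    and v: "primitive (velocity c') v" "(LINT t|leb01. (norm (v t))\<^sup>2) \<le> K"
    and lim: "uniform_limit {0..1} c c' sequentially"
    and vlim: "uniform_limit {0..1} (\<lambda>n. velocity (c n)) (velocity c') sequentially"
  shows "weak_H2_conv c c'"
  unfolding weak_H2_conv_def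
proof (intro conjI allI impI)
  show "H2 (c n)" for n by (rule H2I(1)[OF C1 w(1)])
  show "H2 c'" by (rule H2I(1)[OF C1' v(1)])
  fix h :: "real \<Rightarrow> 'a" assume h: "H2 h"
  obtain h1 h2 where hh: "is_weak_deriv h h1" "is_weak_deriv h1 h2" using h by (auto simp: H2_def)
  have hL: "L2 h" "L2 (weak_deriv h)" "L2 (weak_deriv (weak_deriv h))"
    using h weak_deriv_AE[OF hh(1)] weak_deriv_AE2[OF hh] by (auto simp: H2_def)
  show "(\<lambda>n. H2_inner (c n) h) \<longlonglongrightarrow> H2_inner c' h"
    unfolding H2_inner_primitive[OF C1 w(1) h] H2_inner_primitive[OF C1' v(1) h]
  proof (intro tendsto_add)
    show "(\<lambda>n. LINT t|leb01. c n t \<bullet> h t) \<longlonglongrightarrow> (LINT t|leb01. c' t \<bullet> h t)"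
      by (rule tendsto_inner_uniform[OF C1D(3)[OF C1] C1D(3)[OF C1'] lim hL(1)])
    show "(\<lambda>n. LINT t|leb01. velocity (c n) t \<bullet> weak_deriv h t) \<longlonglongrightarrow> (LINT t|leb01. velocity c' t \<bullet> weak_deriv h t)"
      by (rule tendsto_inner_uniform[OF C1D(2)[OF C1] C1D(2)[OF C1'] vlim hL(2)])
    show "(\<lambda>n. LINT t|leb01. w n t \<bullet> weak_deriv (weak_deriv h) t)
        \<longlonglongrightarrow> (LINT t|leb01. v t \<bullet> weak_deriv (weak_deriv h) t)"
    proof (rule tendsto_inner_weak[OF primitiveD(1)[OF w(1)] w(2) primitiveD(1)[OF v(1)] v(2) _ hL(3)])
      fix t :: real assume t: "t \<in> {0..1}"
      have "(\<lambda>n. velocity (c n) t - velocity (c n) 0) \<longlonglongrightarrow> velocity c' t - velocity c' 0"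
        using t by (intro tendsto_diff tendsto_uniform_limitI[OF vlim]) auto
      then show "(\<lambda>n. antideriv (w n) t) \<longlonglongrightarrow> antideriv v t"
        using w(1) v(1) t by (simp add: primitive_def)
    qed
  qed
qed

lemma C1_holder_convI:
  fixes c :: "nat \<Rightarrow> real \<Rightarrow> 'a::euclidean_space"
  assumes C1: "\<And>n. C1 (c n)" and C1': "C1 c'" and K: "K \<ge> 0" and \<alpha>: "0 < \<alpha>" "\<alpha> < 1 / 2"
    and hold: "\<And>n s t. s \<in> {0..1} \<Longrightarrow> t \<in> {0..1} \<Longrightarrow>
      (norm (velocity (c n) t - velocity (c n) s))\<^sup>2 \<le> K * \<bar>t - s\<bar>"
    and hold': "\<And>s t. s \<in> {0..1} \<Longrightarrow> t \<in> {0..1} \<Longrightarrow>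
      (norm (velocity c' t - velocity c' s))\<^sup>2 \<le> K * \<bar>t - s\<bar>"
    and lim: "uniform_limit {0..1} c c' sequentially"
    and vlim: "uniform_limit {0..1} (\<lambda>n. velocity (c n)) (velocity c') sequentially"
  shows "C1_holder_conv \<alpha> c c'"
  unfolding C1_holder_conv_def
proof (intro conjI allI)
  show "C1_holder \<alpha> (c n)" for n by (rule C1_holder_of_half[OF C1 K \<alpha> hold])
  show "C1_holder \<alpha> c'" by (rule C1_holder_of_half[OF C1' K \<alpha> hold'])
  show "(\<lambda>n. C1_holder_norm \<alpha> (\<lambda>t. c n t - c' t)) \<longlonglongrightarrow> 0"
  proof (rule tendsto_0_ennrealI)
    fix e :: real assume e: "e > 0"
    define a where "a = (2 * sqrt K) powr (2 * \<alpha>)"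
    have a: "a \<ge> 0" by (simp add: a_def)
    \<comment> \<open>chosen so that the Hoelder seminorm of the difference is below e / 3\<close>
    define b where "b = ((e / 3) / (a + 1)) powr (1 / (1 - 2 * \<alpha>))"
    have b0: "b > 0" using e a by (simp add: b_def)
    have bpow: "b powr (1 - 2 * \<alpha>) = (e / 3) / (a + 1)"
      using e a \<alpha> by (simp add: b_def powr_powr)
    have ab: "a * b powr (1 - 2 * \<alpha>) \<le> e / 3"
      unfolding bpow using e a by (simp add: field_simps)
    have "min (e / 3) (b / 2) > 0" "e / 3 > 0" using e b0 by auto
    from uniform_limitD[OF vlim this(1)] uniform_limitD[OF lim this(2)]
    show "\<forall>\<^sub>F n in sequentially. C1_holder_norm \<alpha> (\<lambda>t. c n t - c' t) \<le> ennreal e"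
    proof eventually_elim
      case (elim n)
      note vd = velocity_diff[OF C1[of n] C1']
      have d1: "norm (velocity (c n) t - velocity c' t) \<le> e / 3"
        "norm (velocity (c n) t - velocity c' t) \<le> b / 2" if "t \<in> {0..1}" for t
        using elim(1) that by (auto simp: dist_norm less_imp_le)
      have "C1_holder_norm \<alpha> (\<lambda>t. c n t - c' t) \<le> ennreal (e / 3 + e / 3 + a * b powr (1 - 2 * \<alpha>))"
      proof (rule C1_holder_norm_le)
        fix s t :: real assume st: "s \<in> {0..1}" "t \<in> {0..1}"
        let ?x = "velocity (c n) s - velocity c' s - (velocity (c n) t - velocity c' t)"
        have "norm ?x \<le> a * b powr (1 - 2 * \<alpha>) * \<bar>s - t\<bar> powr \<alpha>"
          unfolding a_def
        proof (rule holder_interpolation)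
          have "norm ?x \<le> norm (velocity (c n) s - velocity (c n) t) + norm (velocity c' s - velocity c' t)"
            using norm_triangle_ineq4[of "velocity (c n) s - velocity (c n) t" "velocity c' s - velocity c' t"]
            by (simp add: algebra_simps)
          also have "\<dots> \<le> sqrt K * \<bar>s - t\<bar> powr (1 / 2) + sqrt K * \<bar>s - t\<bar> powr (1 / 2)"
            by (intro add_mono sqrt_holder[OF hold[OF st(2,1)] K] sqrt_holder[OF hold'[OF st(2,1)] K])
          finally show "norm ?x \<le> 2 * sqrt K * \<bar>s - t\<bar> powr (1 / 2)" by simp
          show "norm ?x \<le> b"
            using norm_triangle_ineq4[of "velocity (c n) s - velocity c' s" "velocity (c n) t - velocity c' t"]
              d1(2)[OF st(1)] d1(2)[OF st(2)] by linarith
        qed (use K b0 \<alpha> in auto)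
        then show "norm (velocity (\<lambda>t. c n t - c' t) s - velocity (\<lambda>t. c n t - c' t) t)
            \<le> a * b powr (1 - 2 * \<alpha>) * \<bar>s - t\<bar> powr \<alpha>"
          by (simp add: vd[OF st(1)] vd[OF st(2)])
      next
        fix t :: real assume t: "t \<in> {0..1}"
        show "norm (velocity (\<lambda>t. c n t - c' t) t) \<le> e / 3" using d1(1)[OF t] by (simp add: vd[OF t])
        show "norm (c n t - c' t) \<le> e / 3" using elim(2) t by (auto simp: dist_norm less_imp_le)
      qed (use e a in auto)
      also have "\<dots> \<le> ennreal e" using ab by (intro ennreal_leI) linarith
      finally show ?case .
    qed
  qed
qed

text \<open>
  Uniform convergence of the velocities identifies the weak limit of the second derivatives, since it
  is convergence of their primitives. The common bound \<open>K\<close> provides the weak compactness and, by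
  interpolation, the convergence in all Hoelder norms of exponent less than \<open>1/2\<close>.
\<close>

theorem H2_holder_convergence:
  fixes c :: "nat \<Rightarrow> real \<Rightarrow> 'a::euclidean_space"
  assumes C1: "\<And>n. C1 (c n)" and C1': "C1 c'"
    and dom: "\<And>n. dominated (velocity (c n)) (\<Phi> n)" "\<And>n. \<Phi> n 1 - \<Phi> n 0 \<le> K"
    and lim: "uniform_limit {0..1} c c' sequentially"
    and vlim: "uniform_limit {0..1} (\<lambda>n. velocity (c n)) (velocity c') sequentially"
  shows "weak_H2_conv c c'" "\<alpha> \<in> {0<..<1/2} \<Longrightarrow> C1_holder_conv \<alpha> c c'" "H2 c'"
proof -
  have K: "K \<ge> 0" using dom(2)[of 0] dominatedD(1)[OF dom(1)[of 0], of 0 1] by simp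
  have vpt: "(\<lambda>n. velocity (c n) t) \<longlonglongrightarrow> velocity c' t" if "t \<in> {0..1}" for t
    by (rule tendsto_uniform_limitI[OF vlim that])
  have hold: "(norm (velocity (c n) t - velocity (c n) s))\<^sup>2 \<le> K * \<bar>t - s\<bar>"
    if "s \<in> {0..1}" "t \<in> {0..1}" for n s t
    by (rule dominated_holder[OF dom that])
  have hold': "(norm (velocity c' t - velocity c' s))\<^sup>2 \<le> K * \<bar>t - s\<bar>"
    if "s \<in> {0..1}" "t \<in> {0..1}" for s t
    by (rule dominated_limit(1)[of "\<lambda>n. velocity (c n)" \<Phi> K "velocity c'", OF dom vpt that])
  obtain v where v: "primitive (velocity c') v" "(LINT t|leb01. (norm (v t))\<^sup>2) \<le> K"
    using dominated_limit(2)[of "\<lambda>n. velocity (c n)" \<Phi> K "velocity c'", OF dom vpt] by blast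
  have "\<exists>w. primitive (velocity (c n)) w \<and> (LINT t|leb01. (norm (w t))\<^sup>2) \<le> K" for n
  proof -
    obtain w where "primitive (velocity (c n)) w" "(LINT t|leb01. (norm (w t))\<^sup>2) \<le> \<Phi> n 1 - \<Phi> n 0"
      by (rule dominated_imp_primitive[OF dom(1)])
    then show ?thesis using dom(2)[of n] order_trans by blast
  qed
  then obtain w where w: "\<And>n. primitive (velocity (c n)) (w n)" "\<And>n. (LINT t|leb01. (norm (w n t))\<^sup>2) \<le> K"
    by metis
  show "weak_H2_conv c c'" by (rule weak_H2_convI[OF C1 C1' w v lim vlim])
  show "H2 c'" by (rule H2I(1)[OF C1' v(1)])
  show "C1_holder_conv \<alpha> c c'" if "\<alpha> \<in> {0<..<1/2}"
    by (rule C1_holder_convI[OF C1 C1' K _ _ hold hold' lim vlim]) (use that in auto)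
qed

section \<open>Constant speed parametrizations\<close>

lemma dominated_compose:
  assumes dom: "dominated g \<Phi>"
    and \<sigma>: "\<And>t. t \<in> {0..1} \<Longrightarrow> \<sigma> t \<in> {0..1}"
    and lip: "\<And>s t. 0 \<le> s \<Longrightarrow> s \<le> t \<Longrightarrow> t \<le> 1 \<Longrightarrow> \<sigma> s \<le> \<sigma> t \<and> \<sigma> t - \<sigma> s \<le> L * (t - s)"
    and L: "L \<ge> 0"
  shows "dominated (\<lambda>t. g (\<sigma> t)) (\<lambda>t. L * \<Phi> (\<sigma> t))"
  unfolding dominated_def
proof (intro allI impI)
  fix s t :: real assume st: "0 \<le> s" "s \<le> t" "t \<le> 1"
  have s: "\<sigma> s \<in> {0..1}" and t: "\<sigma> t \<in> {0..1}" using \<sigma> st by auto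
  note l = lip[OF st]
  note D = dominatedD[OF dom, of "\<sigma> s" "\<sigma> t"]
  have mono: "\<Phi> (\<sigma> s) \<le> \<Phi> (\<sigma> t)" using D(1) s t l by auto
  have "(norm (g (\<sigma> t) - g (\<sigma> s)))\<^sup>2 \<le> (\<sigma> t - \<sigma> s) * (\<Phi> (\<sigma> t) - \<Phi> (\<sigma> s))"
    using D(2) s t l by auto
  also have "\<dots> \<le> L * (t - s) * (\<Phi> (\<sigma> t) - \<Phi> (\<sigma> s))"
    using l mono by (intro mult_right_mono) auto
  finally show "L * \<Phi> (\<sigma> s) \<le> L * \<Phi> (\<sigma> t) \<and>
      (norm (g (\<sigma> t) - g (\<sigma> s)))\<^sup>2 \<le> (t - s) * (L * \<Phi> (\<sigma> t) - L * \<Phi> (\<sigma> s))"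
    using mono L by (auto simp: mult_left_mono algebra_simps)
qed

lemma dominated_lipschitz:
  assumes dom: "dominated g \<Phi>" and C: "C \<ge> 0"
    and lip: "\<And>s t. s \<in> {0..1} \<Longrightarrow> t \<in> {0..1} \<Longrightarrow> norm (f t - f s) \<le> C * norm (g t - g s)"
  shows "dominated f (\<lambda>t. C\<^sup>2 * \<Phi> t)"
  unfolding dominated_def
proof (intro allI impI)
  fix s t :: real assume st: "0 \<le> s" "s \<le> t" "t \<le> 1"
  have "norm (f t - f s) \<le> C * norm (g t - g s)" using lip[of s t] st by auto
  then have "(norm (f t - f s))\<^sup>2 \<le> (C * norm (g t - g s))\<^sup>2" by (rule power_mono) simp
  also have "\<dots> = C\<^sup>2 * (norm (g t - g s))\<^sup>2" by (simp add: power_mult_distrib)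
  also have "\<dots> \<le> C\<^sup>2 * ((t - s) * (\<Phi> t - \<Phi> s))"
    using dominatedD(2)[OF dom st] by (intro mult_left_mono) auto
  also have "\<dots> = (t - s) * (C\<^sup>2 * \<Phi> t - C\<^sup>2 * \<Phi> s)" by (simp add: algebra_simps)
  finally show "C\<^sup>2 * \<Phi> s \<le> C\<^sup>2 * \<Phi> t \<and> (norm (f t - f s))\<^sup>2 \<le> (t - s) * (C\<^sup>2 * \<Phi> t - C\<^sup>2 * \<Phi> s)"
    using dominatedD(1)[OF dom st] by (simp add: mult_left_mono)
qed

text \<open>
  One-sided at the end points, where the inverse function theorem on open sets does not apply: invert
  the difference quotient of \<open>f\<close> along \<open>x = \<sigma> y\<close>.
\<close>

lemma has_vector_derivative_inverse_within:
  fixes f \<sigma> :: "real \<Rightarrow> real"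
  assumes f: "(f has_vector_derivative d) (at (\<sigma> b) within S)" and d: "d \<noteq> 0"
    and \<sigma>: "continuous_on T \<sigma>" "\<And>y. y \<in> T \<Longrightarrow> \<sigma> y \<in> S" "\<And>y. y \<in> T \<Longrightarrow> f (\<sigma> y) = y"
    and b: "b \<in> T"
  shows "(\<sigma> has_vector_derivative 1 / d) (at b within T)"
proof -
  have "((\<lambda>x. (f x - f (\<sigma> b)) / (x - \<sigma> b)) \<longlongrightarrow> d) (at (\<sigma> b) within S)"
    using f by (simp add: has_real_derivative_iff_has_vector_derivative[symmetric] has_field_derivative_iff)
  moreover have "filterlim \<sigma> (at (\<sigma> b) within S) (at b within T)"
    unfolding filterlim_at
  proof (intro conjI)
    show "(\<sigma> \<longlongrightarrow> \<sigma> b) (at b within T)" using \<sigma>(1) b by (simp add: continuous_on_def)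
    have "\<sigma> y \<noteq> \<sigma> b" if "y \<in> T" "y \<noteq> b" for y using \<sigma>(3)[OF b] \<sigma>(3)[OF that(1)] that(2) by metis
    then show "\<forall>\<^sub>F y in at b within T. \<sigma> y \<in> S \<and> \<sigma> y \<noteq> \<sigma> b"
      using \<sigma>(2) by (auto simp: eventually_at_filter)
  qed
  ultimately have "((\<lambda>y. (f (\<sigma> y) - f (\<sigma> b)) / (\<sigma> y - \<sigma> b)) \<longlongrightarrow> d) (at b within T)"
    by (rule filterlim_compose)
  then have "((\<lambda>y. inverse ((f (\<sigma> y) - f (\<sigma> b)) / (\<sigma> y - \<sigma> b))) \<longlongrightarrow> inverse d) (at b within T)"
    by (rule tendsto_inverse) (rule d)
  moreover have "\<forall>\<^sub>F y in at b within T. inverse ((f (\<sigma> y) - f (\<sigma> b)) / (\<sigma> y - \<sigma> b)) = (\<sigma> y - \<sigma> b) / (y - b)"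
    using \<sigma>(3) b by (auto simp: eventually_at_filter)
  ultimately have "((\<lambda>y. (\<sigma> y - \<sigma> b) / (y - b)) \<longlongrightarrow> inverse d) (at b within T)"
    by (rule Lim_transform_eventually)
  then show ?thesis
    by (simp add: has_real_derivative_iff_has_vector_derivative[symmetric] has_field_derivative_iff inverse_eq_divide)
qed

lemma antideriv_has_vector_derivative:
  fixes p :: "real \<Rightarrow> 'a::euclidean_space"
  assumes p: "continuous_on {0..1} p" and t: "t \<in> {0..1}"
  shows "(antideriv p has_vector_derivative p t) (at t within {0..1})"
proof -
  have "((\<lambda>t. integral {0..t} p) has_vector_derivative p t) (at t within {0..1})"
    by (rule integral_has_vector_derivative[OF p t])
  moreover have "antideriv p s = integral {0..s} p" if "s \<in> {0..1}" for s
    unfolding antideriv_lborel[OF that]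
    by (rule set_borel_integral_eq_integral(2))
      (rule borel_integrable_atLeastAtMost', rule continuous_on_subset[OF p], use that in auto)
  ultimately show ?thesis
    using t by (rule_tac has_vector_derivative_transform[of t "{0..1}" _ "\<lambda>t. integral {0..t} p"]) auto
qed

text \<open>
  With \<open>p\<close> the speed of a curve, \<open>\<sigma>\<close> is the parameter change to constant speed: arclength increases by
  \<open>l * t\<close> in time \<open>t\<close>.
\<close>

lemma speed_inverse:
  fixes p :: "real \<Rightarrow> real"
  assumes p: "continuous_on {0..1} p" and pos: "\<And>t. t \<in> {0..1} \<Longrightarrow> p t > 0"
  defines "l \<equiv> (LINT t|leb01. p t)"
  obtains \<sigma> where "l > 0" "\<sigma> 0 = 0" "\<sigma> 1 = 1" "\<And>t. t \<in> {0..1} \<Longrightarrow> \<sigma> t \<in> {0..1}"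
    "\<And>t. t \<in> {0..1} \<Longrightarrow> antideriv p (\<sigma> t) = l * t"
    "\<And>t. t \<in> {0..1} \<Longrightarrow> (\<sigma> has_vector_derivative l / p (\<sigma> t)) (at t within {0..1})"
    "continuous_on {0..1} \<sigma>"
proof -
  let ?L = "antideriv p"
  have Lc: "continuous_on {0..1} ?L" by (rule continuous_on_antideriv[OF continuous_on_integrable_leb01[OF p]])
  have Ld: "(?L has_vector_derivative p t) (at t within {0..1})" if "t \<in> {0..1}" for t
    by (rule antideriv_has_vector_derivative[OF p that])
  have Lmono: "?L s < ?L t" if st: "0 \<le> s" "s < t" "t \<le> 1" for s t
  proof (rule DERIV_pos_imp_increasing_open[OF st(2)])
    show "\<exists>y. DERIV ?L x :> y \<and> y > 0" if x: "s < x" "x < t" for x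
    proof (intro exI conjI)
      have "(?L has_vector_derivative p x) (at x within {0..1})" using Ld[of x] x st by auto
      then show "DERIV ?L x :> p x"
        using x st by (simp add: has_real_derivative_iff_has_vector_derivative at_within_Icc_at)
      show "p x > 0" using pos[of x] x st by auto
    qed
    show "continuous_on {s..t} ?L" using Lc by (rule continuous_on_subset) (use st in auto)
  qed
  have L1: "?L 1 = l" by (simp add: l_def antideriv_1)
  have l: "l > 0" using Lmono[of 0 1] L1 by simp
  have inj: "inj_on ?L {0..1}"
  proof (rule linorder_inj_onI)
    show "?L x \<noteq> ?L y" if "x < y" "x \<in> {0..1}" "y \<in> {0..1}" for x y using Lmono[of x y] that by auto
  qed auto
  define \<sigma> where "\<sigma> t = inv_into {0..1} ?L (l * t)" for t
  have surj: "l * t \<in> ?L ` {0..1}" if "t \<in> {0..1}" for t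
  proof -
    have "l * t \<le> l" using that l by (simp add: mult_left_le)
    then have "\<exists>x\<ge>0. x \<le> 1 \<and> ?L x = l * t"
      using that l L1 by (intro IVT'[of ?L 0 _ 1] Lc) auto
    then show ?thesis by (metis atLeastAtMost_iff image_eqI)
  qed
  have \<sigma>01: "\<sigma> t \<in> {0..1}" if "t \<in> {0..1}" for t
    unfolding \<sigma>_def by (rule inv_into_into[OF surj[OF that]])
  have L\<sigma>: "?L (\<sigma> t) = l * t" if "t \<in> {0..1}" for t
    unfolding \<sigma>_def by (rule f_inv_into_f[OF surj[OF that]])
  have "\<sigma> 0 = 0" using inv_into_f_f[OF inj, of 0] by (simp add: \<sigma>_def)
  moreover have "\<sigma> 1 = 1" using inv_into_f_f[OF inj, of 1] L1 by (simp add: \<sigma>_def)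
  moreover have \<sigma>c: "continuous_on {0..1} \<sigma>"
  proof -
    have "continuous_on (?L ` {0..1}) (inv_into {0..1} ?L)"
      by (rule continuous_on_inv[OF Lc]) (use inj in \<open>auto simp: inv_into_f_f\<close>)
    then show ?thesis unfolding \<sigma>_def
      by (rule continuous_on_compose2) (use surj in \<open>auto intro!: continuous_intros\<close>)
  qed
  moreover have "(\<sigma> has_vector_derivative l / p (\<sigma> t)) (at t within {0..1})" if t: "t \<in> {0..1}" for t
  proof -
    have "(\<sigma> has_vector_derivative 1 / (p (\<sigma> t) / l)) (at t within {0..1})"
    proof (rule has_vector_derivative_inverse_within)
      show "((\<lambda>x. ?L x / l) has_vector_derivative p (\<sigma> t) / l) (at (\<sigma> t) within {0..1})"
        by (rule has_vector_derivative_divide[OF Ld[OF \<sigma>01[OF t]]])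
      show "?L (\<sigma> y) / l = y" if "y \<in> {0..1}" for y using L\<sigma>[OF that] l by simp
    qed (use \<sigma>c \<sigma>01 t l pos[OF \<sigma>01[OF t]] in auto)
    then show ?thesis by simp
  qed
  ultimately show thesis using that l \<sigma>01 L\<sigma> by blast
qed

lemma reparamI:
  fixes \<sigma> :: "real \<Rightarrow> real"
  assumes "\<sigma> 0 = 0" "\<sigma> 1 = 1"
    and d: "\<And>t. t \<in> {0..1} \<Longrightarrow> (\<sigma> has_vector_derivative q t) (at t within {0..1})"
    and q: "dominated q \<Phi>" "\<And>t. t \<in> {0..1} \<Longrightarrow> q t > 0"
  shows "reparam \<sigma>"
proof -
  have C1: "C1 \<sigma>" by (rule C1I[OF d dominated_continuous[OF q(1)]])
  have vel: "velocity \<sigma> t = q t" if "t \<in> {0..1}" for t by (rule velocity_eqI[OF d[OF that] that])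
  have "dominated (velocity \<sigma>) \<Phi>" using q(1) vel by (auto simp: dominated_def)
  then have "H2 \<sigma>" using H2_iff_dominated[OF C1] by blast
  then show ?thesis using assms(1,2) C1 q(2) vel by (simp add: reparam_def)
qed

text \<open>
  The map to the unit sphere is Lipschitz away from the origin, so the unit tangent of an immersion of
  class \<open>H\<^sup>2\<close> is again of class \<open>H\<^sup>1\<close>.
\<close>

lemma normalize_lipschitz:
  fixes a b :: "'a::real_normed_vector"
  assumes "m > 0" "norm a \<ge> m" "norm b \<ge> m"
  shows "norm (a /\<^sub>R norm a - b /\<^sub>R norm b) \<le> 2 / m * norm (a - b)"
proof -
  have pos: "norm a > 0" "norm b > 0" using assms by linarith+
  have eq: "a /\<^sub>R norm a - b /\<^sub>R norm b = (a - b) /\<^sub>R norm a + ((norm b - norm a) / (norm a * norm b)) *\<^sub>R b"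
    using pos by (simp add: scaleR_diff_right scaleR_diff_left diff_divide_distrib divide_inverse algebra_simps)
  have "norm (a /\<^sub>R norm a - b /\<^sub>R norm b) \<le> norm ((a - b) /\<^sub>R norm a) + norm (((norm b - norm a) / (norm a * norm b)) *\<^sub>R b)"
    unfolding eq by (rule norm_triangle_ineq)
  also have "\<dots> = norm (a - b) / norm a + \<bar>norm b - norm a\<bar> / norm a"
    using pos by (simp add: divide_inverse abs_mult)
  also have "\<dots> \<le> norm (a - b) / norm a + norm (a - b) / norm a"
    using pos norm_triangle_ineq3[of b a] by (intro add_mono divide_right_mono) (auto simp: norm_minus_commute)
  also have "\<dots> = 2 * norm (a - b) / norm a" by simp
  also have "\<dots> \<le> 2 * norm (a - b) / m" using assms pos by (intro divide_left_mono mult_pos_pos) auto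
  finally show ?thesis by simp
qed

lemma immersion_speed_bound:
  fixes \<gamma> :: "real \<Rightarrow> 'a::euclidean_space"
  assumes "immersion \<gamma>"
  obtains m where "m > 0" "\<And>t. t \<in> {0..1} \<Longrightarrow> m \<le> norm (velocity \<gamma> t)"
proof -
  have c: "continuous_on {0..1} (\<lambda>t. norm (velocity \<gamma> t))"
    using assms C1D(2) by (auto simp: immersion_def intro: continuous_on_norm)
  obtain x where x: "x \<in> {0..1}" "\<And>t. t \<in> {0..1} \<Longrightarrow> norm (velocity \<gamma> x) \<le> norm (velocity \<gamma> t)"
    using continuous_attains_inf[OF _ _ c] by auto
  show thesis by (rule that[OF _ x(2)]) (use x assms in \<open>auto simp: immersion_def\<close>)
qed

text \<open>
  The vectors \<open>a\<close> and \<open>b\<close> are the outer tangents at the two ends, whence the sign at \<open>1\<close>. The increment of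
  \<open>\<Phi>\<close> bounds the squared \<open>L\<^sup>2\<close> norm of the second derivative, and this is \<open>l\<^sup>3 K\<close> for a curve of length \<open>l\<close>
  and bending energy \<open>K\<close> in constant speed parametrization. A constant curve has \<open>l = 0\<close>, and then \<open>a\<close>
  and \<open>b\<close> are arbitrary: this is how virtual tangents are treated together with real ones.
\<close>

definition const_speed :: "(real \<Rightarrow> 'a::euclidean_space) \<Rightarrow> real \<Rightarrow> real \<Rightarrow> 'a \<Rightarrow> 'a \<Rightarrow> bool" where
  "const_speed c l K a b \<longleftrightarrow> C1 c \<and> l \<ge> 0 \<and> (\<forall>t\<in>{0..1}. norm (velocity c t) = l)
     \<and> (\<exists>\<Phi>. dominated (velocity c) \<Phi> \<and> \<Phi> 1 - \<Phi> 0 \<le> l ^ 3 * K)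
     \<and> velocity c 0 = l *\<^sub>R a \<and> velocity c 1 = - (l *\<^sub>R b)"

text \<open>
  The number \<open>\<beta> t\<close> is the bending energy of the part of \<open>\<gamma>\<close> up to the parameter \<open>t\<close>. The Cauchy-Schwarz
  inequality is applied with the weight \<open>|\<gamma>'|\<close>, so that both factors on the right are geometric quantities.
  This makes a change of variables in the energy integral unnecessary.
\<close>

lemma bending_energy_tangent:
  fixes \<gamma> :: "real \<Rightarrow> 'a::euclidean_space"
  assumes reg: "regular_curve \<gamma>"
  obtains \<beta> where "\<And>a b. 0 \<le> a \<Longrightarrow> a \<le> b \<Longrightarrow> b \<le> 1 \<Longrightarrow> \<beta> a \<le> \<beta> b"
    "\<beta> 0 = 0" "\<beta> 1 = bending_energy \<gamma>"
    "\<And>a b. 0 \<le> a \<Longrightarrow> a \<le> b \<Longrightarrow> b \<le> 1 \<Longrightarrow> (norm (unit_tangent \<gamma> b - unit_tangent \<gamma> a))\<^sup>2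
      \<le> (antideriv (\<lambda>t. norm (velocity \<gamma> t)) b - antideriv (\<lambda>t. norm (velocity \<gamma> t)) a) * (\<beta> b - \<beta> a)"
    "continuous_on {0..1} (unit_tangent \<gamma>)"
proof -
  have C1: "C1 \<gamma>" and H2: "H2 \<gamma>" and imm: "immersion \<gamma>"
    using reg by (auto simp: regular_curve_def immersion_def)
  let ?p = "\<lambda>t. norm (velocity \<gamma> t)" and ?T = "unit_tangent \<gamma>"
  obtain m where m: "m > 0" "\<And>t. t \<in> {0..1} \<Longrightarrow> m \<le> ?p t" using immersion_speed_bound[OF imm] by blast
  have pc: "continuous_on {0..1} ?p" by (intro continuous_on_norm C1D(2) C1)
  have ppos: "?p t > 0" if "t \<in> {0..1}" for t using m that by fastforce
  obtain \<Phi> where \<Phi>: "dominated (velocity \<gamma>) \<Phi>" using H2_iff_dominated[OF C1] H2 by blast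
  have Tdom: "dominated ?T (\<lambda>t. (2 / m)\<^sup>2 * \<Phi> t)"
  proof (rule dominated_lipschitz[OF \<Phi>])
    show "norm (?T t - ?T s) \<le> 2 / m * norm (velocity \<gamma> t - velocity \<gamma> s)"
      if "s \<in> {0..1}" "t \<in> {0..1}" for s t
      unfolding unit_tangent_def by (rule normalize_lipschitz) (use m that in auto)
  qed (use m in simp)
  have Tc: "continuous_on {0..1} ?T" by (rule dominated_continuous[OF Tdom])
  obtain w where w: "primitive ?T w" by (rule dominated_imp_primitive[OF Tdom])
  have wd: "is_weak_deriv ?T w" by (rule primitive_imp_is_weak_deriv[OF w])
  have wdT: "is_weak_deriv ?T (weak_deriv ?T)" by (rule weak_deriv_is_weak_deriv[OF wd])
  define v where "v = weak_deriv ?T"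
  have v: "primitive ?T v" unfolding v_def by (rule is_weak_deriv_imp_primitive[OF Tc wdT])
  have vL: "L2 v" by (rule primitiveD(1)[OF v])
  have sc: "continuous_on {0..1} (\<lambda>t. 1 / sqrt (?p t))"
    using ppos by (intro continuous_on_divide continuous_on_const continuous_on_real_sqrt pc) fastforce
  have fL: "L2 (\<lambda>t. (1 / sqrt (?p t)) *\<^sub>R v t)" by (rule L2_scaleR_continuous[OF vL sc])
  have f2eq: "(norm ((1 / sqrt (?p t)) *\<^sub>R v t))\<^sup>2 = (norm (v t))\<^sup>2 / ?p t" for t
    by (simp add: power_divide divide_inverse power_mult_distrib power_inverse)
  have f2: "integrable leb01 (\<lambda>t. (norm (v t))\<^sup>2 / ?p t)" using L2_sq[OF fL] unfolding f2eq .
  define \<beta> where "\<beta> = antideriv (\<lambda>t. (norm (v t))\<^sup>2 / ?p t)"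
  have "\<beta> 1 = bending_energy \<gamma>"
    unfolding \<beta>_def antideriv_1 bending_energy_def lint_leb01 curvature_def v_def
  proof (rule Bochner_Integration.integral_cong[OF refl])
    fix t assume "t \<in> space leb01"
    then have "?p t > 0" using ppos by simp
    then show "(norm (weak_deriv ?T t))\<^sup>2 / ?p t = (norm (weak_deriv ?T t /\<^sub>R ?p t))\<^sup>2 * ?p t"
      by (simp add: power_mult_distrib power2_eq_square field_simps)
  qed
  moreover have "\<beta> 0 = 0" by (simp add: \<beta>_def)
  moreover have "\<beta> a \<le> \<beta> b" if "0 \<le> a" "a \<le> b" "b \<le> 1" for a b
    unfolding \<beta>_def by (rule antideriv_nonneg_mono[OF f2 _ that]) simp
  moreover have "(norm (?T b - ?T a))\<^sup>2 \<le> (antideriv ?p b - antideriv ?p a) * (\<beta> b - \<beta> a)"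
    if ab: "0 \<le> a" "a \<le> b" "b \<le> 1" for a b
  proof -
    let ?A = "{a<..b}"
    have A: "?A \<in> sets leb01" using ab by (intro sets_leb01_Ioc) auto
    have pi: "integrable leb01 ?p" by (rule continuous_on_integrable_leb01[OF pc])
    have vn: "integrable leb01 (\<lambda>t. norm (v t))" by (rule integrable_norm[OF L2_integrable[OF vL]])
    let ?F = "\<lambda>t. indicator ?A t * (norm (v t) / sqrt (?p t))" and ?G = "\<lambda>t. indicator ?A t * sqrt (?p t)"
    have F2: "(?F t)\<^sup>2 = indicator ?A t *\<^sub>R ((norm (v t))\<^sup>2 / ?p t)"
      and G2: "(?G t)\<^sup>2 = indicator ?A t *\<^sub>R ?p t" for t
      by (auto simp: power_divide split: split_indicator)
    have vm: "v \<in> borel_measurable leb01" by (rule L2_measurable[OF vL])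
    have pm: "?p \<in> borel_measurable leb01" by (rule continuous_on_measurable_leb01[OF pc])
    have sqm: "(\<lambda>t. sqrt (?p t)) \<in> borel_measurable leb01"
      by (rule continuous_on_measurable_leb01) (intro continuous_on_real_sqrt pc)
    have "?T b - ?T a = antideriv v b - antideriv v a"
      using v ab by (simp add: primitive_def)
    also have "\<dots> = (LINT t:?A|leb01. v t)" by (rule antideriv_diff[OF L2_integrable[OF vL] ab])
    finally have "norm (?T b - ?T a) \<le> (LINT t|leb01. norm (indicator ?A t *\<^sub>R v t))"
      unfolding set_lebesgue_integral_def by (simp only: integral_norm_bound)
    also have "\<dots> = (LINT t|leb01. ?F t * ?G t)"
    proof (rule Bochner_Integration.integral_cong[OF refl])
      fix t assume "t \<in> space leb01"
      then have "?p t > 0" using ppos by simp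
      then show "norm (indicator ?A t *\<^sub>R v t) = ?F t * ?G t"
        by (auto split: split_indicator)
    qed
    finally have "(norm (?T b - ?T a))\<^sup>2 \<le> (LINT t|leb01. ?F t * ?G t)\<^sup>2" by (rule power_mono) simp
    also have "\<dots> \<le> (LINT t|leb01. (?F t)\<^sup>2) * (LINT t|leb01. (?G t)\<^sup>2)"
    proof (rule Cauchy_Schwarz_integral)
      have ind: "(indicator ?A :: real \<Rightarrow> real) \<in> borel_measurable leb01" using A by simp
      show "?F \<in> borel_measurable leb01"
        by (intro borel_measurable_times ind borel_measurable_divide sqm borel_measurable_integrable[OF vn])
      show "?G \<in> borel_measurable leb01" by (intro borel_measurable_times ind sqm)
      show "integrable leb01 (\<lambda>t. (?F t)\<^sup>2)" unfolding F2 by (rule integrable_mult_indicator[OF A f2])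
      show "integrable leb01 (\<lambda>t. (?G t)\<^sup>2)" unfolding G2 by (rule integrable_mult_indicator[OF A pi])
    qed
    also have "(LINT t|leb01. (?F t)\<^sup>2) = \<beta> b - \<beta> a"
      unfolding F2 \<beta>_def antideriv_diff[OF f2 ab] set_lebesgue_integral_def ..
    also have "(LINT t|leb01. (?G t)\<^sup>2) = antideriv ?p b - antideriv ?p a"
      unfolding G2 antideriv_diff[OF pi ab] set_lebesgue_integral_def ..
    finally show ?thesis by (simp add: mult.commute)
  qed
  ultimately show thesis using Tc that by blast
qed

text \<open>
  After the parameter change, the increment of arclength over \<open>[s, t]\<close> in the preceding estimate is
  \<open>l * (t - s)\<close>, and the velocity is \<open>l\<close> times the unit tangent.
\<close>

theorem regular_curve_const_speed:
  fixes \<gamma> :: "real \<Rightarrow> 'a::euclidean_space"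
  assumes reg: "regular_curve \<gamma>" and K: "bending_energy \<gamma> \<le> K"
  obtains \<sigma> where "reparam \<sigma>" "curve_length \<gamma> > 0"
    "const_speed (\<gamma> \<circ> \<sigma>) (curve_length \<gamma>) K (outer_tangent \<gamma> 0) (outer_tangent \<gamma> 1)"
proof -
  have C1: "C1 \<gamma>" and H2: "H2 \<gamma>" and imm: "immersion \<gamma>"
    using reg by (auto simp: regular_curve_def immersion_def)
  let ?p = "\<lambda>t. norm (velocity \<gamma> t)" and ?T = "unit_tangent \<gamma>"
  obtain m where m: "m > 0" "\<And>t. t \<in> {0..1} \<Longrightarrow> m \<le> ?p t" using immersion_speed_bound[OF imm] by blast
  have pc: "continuous_on {0..1} ?p" by (intro continuous_on_norm C1D(2) C1)
  have ppos: "?p t > 0" if "t \<in> {0..1}" for t using m that by fastforce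
  define l where "l = curve_length \<gamma>"
  have l_int: "l = (LINT t|leb01. ?p t)" by (simp add: l_def curve_length_def lint_leb01)
  obtain \<sigma> where l0: "l > 0" and \<sigma>: "\<sigma> 0 = 0" "\<sigma> 1 = 1" "\<And>t. t \<in> {0..1} \<Longrightarrow> \<sigma> t \<in> {0..1}"
    "\<And>t. t \<in> {0..1} \<Longrightarrow> antideriv ?p (\<sigma> t) = l * t"
    "\<And>t. t \<in> {0..1} \<Longrightarrow> (\<sigma> has_vector_derivative l / ?p (\<sigma> t)) (at t within {0..1})"
    "continuous_on {0..1} \<sigma>"
    using speed_inverse[OF pc ppos] unfolding l_int by blast
  have mono: "\<sigma> s \<le> \<sigma> t \<and> \<sigma> t - \<sigma> s \<le> (l / m) * (t - s)" if st: "0 \<le> s" "s \<le> t" "t \<le> 1" for s t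
  proof (cases "s = t")
    case False
    then have lt: "s < t" using st by simp
    have "(\<sigma> has_derivative (\<lambda>h. h * (l / ?p (\<sigma> x)))) (at x within {s..t})" if "x \<in> {s..t}" for x
    proof -
      have "(\<sigma> has_vector_derivative l / ?p (\<sigma> x)) (at x within {0..1})" using \<sigma>(5)[of x] st that by auto
      then have "(\<sigma> has_vector_derivative l / ?p (\<sigma> x)) (at x within {s..t})"
        by (rule has_vector_derivative_within_subset) (use st in auto)
      then show ?thesis by (simp add: has_vector_derivative_def)
    qed
    then have "\<exists>x\<in>{s<..<t}. \<sigma> t - \<sigma> s = (t - s) * (l / ?p (\<sigma> x))"
      by (intro mvt_simple[OF lt]) auto
    then obtain x where x: "s < x" "x < t" "\<sigma> t - \<sigma> s = (t - s) * (l / ?p (\<sigma> x))" by auto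
    have mx: "m \<le> ?p (\<sigma> x)" using m(2)[OF \<sigma>(3)[of x]] x st by auto
    have "l / ?p (\<sigma> x) \<le> l / m" using mx m(1) l0 by (intro divide_left_mono mult_pos_pos) auto
    then have "\<sigma> t - \<sigma> s \<le> (t - s) * (l / m)" unfolding x(3) using st by (intro mult_left_mono) auto
    moreover have "0 \<le> \<sigma> t - \<sigma> s" unfolding x(3) using l0 st by simp
    ultimately show ?thesis by (simp add: mult.commute)
  qed simp
  obtain \<Phi> where \<Phi>: "dominated (velocity \<gamma>) \<Phi>" using H2_iff_dominated[OF C1] H2 by blast
  have lm: "l / m \<ge> 0" using l0 m by simp
  have "dominated (\<lambda>t. velocity \<gamma> (\<sigma> t)) (\<lambda>t. l / m * \<Phi> (\<sigma> t))"
    by (rule dominated_compose[OF \<Phi> \<sigma>(3) mono lm])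
  then have qdom: "dominated (\<lambda>t. l / ?p (\<sigma> t)) (\<lambda>t. (l / m\<^sup>2)\<^sup>2 * (l / m * \<Phi> (\<sigma> t)))"
  proof (rule dominated_lipschitz)
    fix s t :: real assume st: "s \<in> {0..1}" "t \<in> {0..1}"
    let ?a = "velocity \<gamma> (\<sigma> t)" and ?b = "velocity \<gamma> (\<sigma> s)"
    have ab: "m \<le> norm ?a" "m \<le> norm ?b" using m(2) \<sigma>(3) st by auto
    have pos: "norm ?a > 0" "norm ?b > 0" using ab m by linarith+
    have "l / norm ?a - l / norm ?b = l * (norm ?b - norm ?a) / (norm ?a * norm ?b)"
      using pos by (simp add: field_simps)
    then have "norm (l / norm ?a - l / norm ?b) = l * \<bar>norm ?b - norm ?a\<bar> / (norm ?a * norm ?b)"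
      using l0 by (simp add: abs_mult)
    also have "\<dots> \<le> l * norm (?a - ?b) / (m * m)"
      using l0 ab m pos norm_triangle_ineq3[of ?b ?a]
      by (intro frac_le mult_left_mono mult_mono) (auto simp: norm_minus_commute)
    finally show "norm (l / norm ?a - l / norm ?b) \<le> l / m\<^sup>2 * norm (?a - ?b)"
      by (simp add: power2_eq_square)
  qed (use l0 in simp)
  have rep: "reparam \<sigma>"
    by (rule reparamI[OF \<sigma>(1,2,5) qdom]) (use l0 ppos \<sigma>(3) in auto)
  have cd: "((\<gamma> \<circ> \<sigma>) has_vector_derivative l *\<^sub>R ?T (\<sigma> t)) (at t within {0..1})" if t: "t \<in> {0..1}" for t
  proof -
    have im: "\<sigma> ` {0..1} \<subseteq> {0..1}" using \<sigma>(3) by blast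
    have "(\<gamma> has_vector_derivative velocity \<gamma> (\<sigma> t)) (at (\<sigma> t) within \<sigma> ` {0..1})"
      by (rule has_vector_derivative_within_subset[OF C1D(1)[OF C1 \<sigma>(3)[OF t]] im])
    from vector_diff_chain_within[OF \<sigma>(5)[OF t] this]
    show ?thesis using ppos[OF \<sigma>(3)[OF t]] by (simp add: unit_tangent_def divide_inverse)
  qed
  obtain \<beta> where \<beta>: "\<And>a b. 0 \<le> a \<Longrightarrow> a \<le> b \<Longrightarrow> b \<le> 1 \<Longrightarrow> \<beta> a \<le> \<beta> b"
    "\<beta> 0 = 0" "\<beta> 1 = bending_energy \<gamma>"
    "\<And>a b. 0 \<le> a \<Longrightarrow> a \<le> b \<Longrightarrow> b \<le> 1 \<Longrightarrow> (norm (?T b - ?T a))\<^sup>2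
      \<le> (antideriv ?p b - antideriv ?p a) * (\<beta> b - \<beta> a)"
    and Tc: "continuous_on {0..1} ?T"
    using bending_energy_tangent[OF reg] by blast
  have Tsc: "continuous_on {0..1} (\<lambda>t. l *\<^sub>R ?T (\<sigma> t))"
    by (intro continuous_on_scaleR continuous_on_const continuous_on_compose2[OF Tc \<sigma>(6)]) (use \<sigma>(3) in auto)
  have cC1: "C1 (\<gamma> \<circ> \<sigma>)" by (rule C1I[OF cd Tsc])
  have cv: "velocity (\<gamma> \<circ> \<sigma>) t = l *\<^sub>R ?T (\<sigma> t)" if "t \<in> {0..1}" for t
    by (rule velocity_eqI[OF cd[OF that] that])
  have Tn: "norm (?T t) = 1" if "t \<in> {0..1}" for t using ppos[OF that] by (simp add: unit_tangent_def)
  have dom: "dominated (velocity (\<gamma> \<circ> \<sigma>)) (\<lambda>t. l ^ 3 * \<beta> (\<sigma> t))"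
    unfolding dominated_def
  proof (intro allI impI)
    fix s t :: real assume st: "0 \<le> s" "s \<le> t" "t \<le> 1"
    have s01: "\<sigma> s \<in> {0..1}" "\<sigma> t \<in> {0..1}" using \<sigma>(3) st by auto
    have le: "\<sigma> s \<le> \<sigma> t" using mono[OF st] by simp
    have b: "\<beta> (\<sigma> s) \<le> \<beta> (\<sigma> t)" using \<beta>(1) s01 le by auto
    have "(norm (?T (\<sigma> t) - ?T (\<sigma> s)))\<^sup>2 \<le> (l * t - l * s) * (\<beta> (\<sigma> t) - \<beta> (\<sigma> s))"
      using \<beta>(4)[of "\<sigma> s" "\<sigma> t"] s01 le \<sigma>(4)[of s] \<sigma>(4)[of t] st by auto
    then have *: "l\<^sup>2 * (norm (?T (\<sigma> t) - ?T (\<sigma> s)))\<^sup>2 \<le> l\<^sup>2 * ((l * t - l * s) * (\<beta> (\<sigma> t) - \<beta> (\<sigma> s)))"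
      by (intro mult_left_mono) auto
    have "velocity (\<gamma> \<circ> \<sigma>) t - velocity (\<gamma> \<circ> \<sigma>) s = l *\<^sub>R (?T (\<sigma> t) - ?T (\<sigma> s))"
      using cv[of s] cv[of t] st by (simp add: scaleR_diff_right)
    then have "(norm (velocity (\<gamma> \<circ> \<sigma>) t - velocity (\<gamma> \<circ> \<sigma>) s))\<^sup>2 = l\<^sup>2 * (norm (?T (\<sigma> t) - ?T (\<sigma> s)))\<^sup>2"
      by (simp add: power_mult_distrib)
    also note *
    also have "l\<^sup>2 * ((l * t - l * s) * (\<beta> (\<sigma> t) - \<beta> (\<sigma> s))) = (t - s) * (l ^ 3 * \<beta> (\<sigma> t) - l ^ 3 * \<beta> (\<sigma> s))"
      by (simp add: power2_eq_square power3_eq_cube algebra_simps)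
    finally show "l ^ 3 * \<beta> (\<sigma> s) \<le> l ^ 3 * \<beta> (\<sigma> t) \<and>
        (norm (velocity (\<gamma> \<circ> \<sigma>) t - velocity (\<gamma> \<circ> \<sigma>) s))\<^sup>2 \<le> (t - s) * (l ^ 3 * \<beta> (\<sigma> t) - l ^ 3 * \<beta> (\<sigma> s))"
      using b l0 by simp
  qed
  have "const_speed (\<gamma> \<circ> \<sigma>) l K (outer_tangent \<gamma> 0) (outer_tangent \<gamma> 1)"
    unfolding const_speed_def
  proof (intro conjI)
    show "\<exists>\<Phi>. dominated (velocity (\<gamma> \<circ> \<sigma>)) \<Phi> \<and> \<Phi> 1 - \<Phi> 0 \<le> l ^ 3 * K"
      using dom \<beta>(2,3) \<sigma>(1,2) K l0 by (intro exI[of _ "\<lambda>t. l ^ 3 * \<beta> (\<sigma> t)"]) simp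
    show "\<forall>t\<in>{0..1}. norm (velocity (\<gamma> \<circ> \<sigma>) t) = l" using cv Tn \<sigma>(3) l0 by simp
  qed (use cC1 l0 cv[of 0] cv[of 1] \<sigma>(1,2) in \<open>auto simp: outer_tangent_def\<close>)
  then show thesis using that rep l0 unfolding l_def by blast
qed

lemma singular_curve_velocity:
  fixes \<gamma> :: "real \<Rightarrow> 'a::euclidean_space"
  assumes "singular_curve \<gamma>"
  shows "C1 \<gamma>" "t \<in> {0..1} \<Longrightarrow> velocity \<gamma> t = 0"
proof -
  obtain a where a: "\<And>t. t \<in> {0..1} \<Longrightarrow> \<gamma> t = a"
    using assms by (auto simp: singular_curve_def constant_on_def)
  have d: "(\<gamma> has_vector_derivative 0) (at t within {0..1})" if "t \<in> {0..1}" for t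
    by (rule has_vector_derivative_transform[OF that a has_vector_derivative_const])
  show "C1 \<gamma>" by (rule C1I[OF d]) simp_all
  show "t \<in> {0..1} \<Longrightarrow> velocity \<gamma> t = 0" by (rule velocity_eqI[OF d])
qed

lemma reparam_id: "reparam (\<lambda>t. t)"
  by (rule reparamI[of _ "\<lambda>_. 1" "\<lambda>_. 0"]) (auto simp: dominated_def)

lemma singular_curve_const_speed:
  fixes \<gamma> :: "real \<Rightarrow> 'a::euclidean_space"
  assumes "singular_curve \<gamma>"
  shows "const_speed \<gamma> 0 K a b"
proof -
  have "dominated (velocity \<gamma>) (\<lambda>_. 0)"
    using singular_curve_velocity(2)[OF assms] by (auto simp: dominated_def)
  then show ?thesis using singular_curve_velocity[OF assms]
    by (auto simp: const_speed_def intro!: exI[of _ "\<lambda>_. 0"])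
qed

lemma singular_not_regular:
  fixes \<gamma> :: "real \<Rightarrow> 'a::euclidean_space"
  assumes "singular_curve \<gamma>" shows "\<not> regular_curve \<gamma>"
  using singular_curve_velocity(2)[OF assms, of 0] by (auto simp: regular_curve_def immersion_def)

lemma const_speed_velocity_diff:
  assumes "const_speed c l K a b" "s \<in> {0..1}" "t \<in> {0..1}"
  shows "(norm (velocity c t - velocity c s))\<^sup>2 \<le> l ^ 3 * K * \<bar>t - s\<bar>"
proof -
  obtain \<Phi> where "dominated (velocity c) \<Phi>" "\<Phi> 1 - \<Phi> 0 \<le> l ^ 3 * K"
    using assms(1) by (auto simp: const_speed_def)
  from dominated_holder[OF this assms(2,3)] show ?thesis .
qed

lemma const_speed_K_nonneg:
  assumes "const_speed c l K a b" "l > 0" shows "K \<ge> 0"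
proof -
  obtain \<Phi> where "dominated (velocity c) \<Phi>" "\<Phi> 1 - \<Phi> 0 \<le> l ^ 3 * K"
    using assms(1) by (auto simp: const_speed_def)
  then have "0 \<le> l ^ 3 * K" using dominatedD(1)[of _ \<Phi> 0 1] by force
  then show ?thesis using assms(2) by (simp add: zero_le_mult_iff)
qed

text \<open>
  The tangent of a constant speed curve turns by at most \<open>sqrt (l * K)\<close>. Hence for a short curve the two
  outer tangents are almost opposite, and the chord is almost aligned with them.
\<close>

lemma const_speed_tangents:
  fixes c :: "real \<Rightarrow> 'a::euclidean_space"
  assumes "const_speed c l K a b" "l > 0"
  shows "(norm (a + b))\<^sup>2 \<le> l * K"
proof -
  have "(norm (velocity c 1 - velocity c 0))\<^sup>2 \<le> l ^ 3 * K"
    using const_speed_velocity_diff[OF assms(1), of 0 1] by simp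
  moreover have "velocity c 1 - velocity c 0 = - (l *\<^sub>R (a + b))"
    using assms(1) by (simp add: const_speed_def scaleR_add_right)
  then have "(norm (velocity c 1 - velocity c 0))\<^sup>2 = l\<^sup>2 * (norm (a + b))\<^sup>2"
    by (simp add: power_mult_distrib)
  moreover have "l ^ 3 * K = l\<^sup>2 * (l * K)" by (simp add: power2_eq_square power3_eq_cube)
  ultimately have "l\<^sup>2 * (norm (a + b))\<^sup>2 \<le> l\<^sup>2 * (l * K)" by simp
  then show ?thesis using assms(2) by (simp add: mult_le_cancel_left_pos)
qed

lemma const_speed_chord:
  fixes c :: "real \<Rightarrow> 'a::euclidean_space"
  assumes c: "const_speed c l K a b" and l: "l > 0"
  shows "(norm (c 1 - c 0 - l *\<^sub>R a))\<^sup>2 \<le> l ^ 3 * K"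
proof -
  have C1: "C1 c" using c by (simp add: const_speed_def)
  have K: "K \<ge> 0" by (rule const_speed_K_nonneg[OF c l])
  let ?v = "\<lambda>t. velocity c t - l *\<^sub>R a"
  have vc: "continuous_on {0..1} ?v" by (intro continuous_intros C1D(2) C1)
  have "antideriv ?v 1 = (c 1 - 1 *\<^sub>R (l *\<^sub>R a)) - (c 0 - 0 *\<^sub>R (l *\<^sub>R a))"
    by (rule antideriv_velocity_diff[OF _ vc])
      (auto intro!: derivative_eq_intros C1D(1)[OF C1])
  then have eq: "c 1 - c 0 - l *\<^sub>R a = (LINT t|leb01. ?v t)" by (simp add: antideriv_1)
  have "norm (LINT t|leb01. ?v t) \<le> (LINT t|leb01. sqrt (l ^ 3 * K))"
  proof (rule Bochner_Integration.integral_norm_bound_integral)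
    show "integrable leb01 ?v" by (rule continuous_on_integrable_leb01[OF vc])
    fix t assume "t \<in> space leb01"
    then have t: "t \<in> {0..1}" by simp
    have "(norm (velocity c t - velocity c 0))\<^sup>2 \<le> l ^ 3 * K * \<bar>t - 0\<bar>"
      by (rule const_speed_velocity_diff[OF c _ t]) simp
    also have "\<dots> \<le> l ^ 3 * K" using t l K by (simp add: mult_left_le)
    finally have "norm (velocity c t - velocity c 0) \<le> sqrt (l ^ 3 * K)" by (rule real_le_rsqrt)
    moreover have "velocity c 0 = l *\<^sub>R a" using c by (simp add: const_speed_def)
    ultimately show "norm (?v t) \<le> sqrt (l ^ 3 * K)" by simp
  qed simp
  also have "\<dots> = sqrt (l ^ 3 * K)" using measure_leb01_Icc[of 0 1] by simp
  finally have "(norm (c 1 - c 0 - l *\<^sub>R a))\<^sup>2 \<le> (sqrt (l ^ 3 * K))\<^sup>2"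
    unfolding eq by (intro power_mono) auto
  then show ?thesis using l K by simp
qed

lemma regular_curveI:
  fixes u :: "real \<Rightarrow> 'a::euclidean_space"
  assumes "C1 u" "dominated (velocity u) \<Phi>" "\<And>t. t \<in> {0..1} \<Longrightarrow> velocity u t \<noteq> 0"
  shows "regular_curve u"
  using assms H2_iff_dominated[OF assms(1)] by (auto simp: regular_curve_def immersion_def)

section \<open>Convergent subsequences and displacements\<close>

text \<open>
  Subsequences are extracted for one index after the other; heredity of \<open>Q\<close> keeps what was gained
  before.
\<close>

lemma finite_common_subseq:
  fixes Q :: "'i \<Rightarrow> (nat \<Rightarrow> nat) \<Rightarrow> bool"
  assumes "finite A"
    and sub: "\<And>a s. a \<in> A \<Longrightarrow> strict_mono s \<Longrightarrow> \<exists>s' :: nat \<Rightarrow> nat. strict_mono s' \<and> Q a (s \<circ> s')"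
    and hered: "\<And>a s (s' :: nat \<Rightarrow> nat). a \<in> A \<Longrightarrow> Q a s \<Longrightarrow> strict_mono s' \<Longrightarrow> Q a (s \<circ> s')"
  shows "\<exists>s. strict_mono s \<and> (\<forall>a\<in>A. Q a s)"
  using assms
proof (induction A rule: finite_induct)
  case empty
  then show ?case by (intro exI[of _ id]) (auto simp: strict_mono_def)
next
  case (insert a A)
  have "\<exists>s. strict_mono s \<and> (\<forall>a\<in>A. Q a s)"
  proof (rule insert.IH)
    show "\<exists>s' :: nat \<Rightarrow> nat. strict_mono s' \<and> Q b (s \<circ> s')" if "b \<in> A" "strict_mono s" for b and s :: "nat \<Rightarrow> nat"
      by (rule insert.prems(1)) (use that in auto)
    show "Q b (s \<circ> s')" if "b \<in> A" "Q b s" "strict_mono s'" for b s and s' :: "nat \<Rightarrow> nat"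
      by (rule insert.prems(2)) (use that in auto)
  qed
  then obtain s where s: "strict_mono s" "\<forall>a\<in>A. Q a s" by blast
  have "\<exists>s' :: nat \<Rightarrow> nat. strict_mono s' \<and> Q a (s \<circ> s')" by (rule insert.prems(1)[OF _ s(1)]) simp
  then obtain s' where s': "strict_mono s'" "Q a (s \<circ> s')" by blast
  have "strict_mono (s \<circ> s')" using s(1) s'(1) by (rule strict_mono_o)
  moreover have "Q b (s \<circ> s')" if "b \<in> A" for b
    by (rule insert.prems(2)) (use s(2) s'(1) that in auto)
  ultimately show ?case using s'(2) by blast
qed

lemma finite_compact_subseq:
  fixes f :: "nat \<Rightarrow> 'i \<Rightarrow> 'a::metric_space"
  assumes "finite A" "\<And>n a. a \<in> A \<Longrightarrow> f n a \<in> K a" "\<And>a. a \<in> A \<Longrightarrow> compact (K a)"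
  obtains s :: "nat \<Rightarrow> nat" and l where "strict_mono s" "\<And>a. a \<in> A \<Longrightarrow> l a \<in> K a"
    "\<And>a. a \<in> A \<Longrightarrow> (\<lambda>n. f (s n) a) \<longlonglongrightarrow> l a"
proof -
  have "\<exists>s. strict_mono s \<and> (\<forall>a\<in>A. \<exists>l. l \<in> K a \<and> (\<lambda>n. f (s n) a) \<longlonglongrightarrow> l)"
  proof (rule finite_common_subseq[OF assms(1)])
    fix a and s :: "nat \<Rightarrow> nat" assume a: "a \<in> A"
    have mem: "\<forall>n. f (s n) a \<in> K a" using assms(2)[OF a] by blast
    then obtain l s' where "l \<in> K a" "strict_mono s'" "((\<lambda>n. f (s n) a) \<circ> s') \<longlonglongrightarrow> l"
      by (rule seq_compactE[OF compact_imp_seq_compact[OF assms(3)[OF a]]]) blast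
    then show "\<exists>s'. strict_mono s' \<and> (\<exists>l. l \<in> K a \<and> (\<lambda>n. f ((s \<circ> s') n) a) \<longlonglongrightarrow> l)"
      by (auto simp: o_def)
  next
    fix a and s s' :: "nat \<Rightarrow> nat" assume "\<exists>l. l \<in> K a \<and> (\<lambda>n. f (s n) a) \<longlonglongrightarrow> l" and s': "strict_mono s'"
    then obtain l where "l \<in> K a" "(\<lambda>n. f (s n) a) \<longlonglongrightarrow> l" by blast
    then show "\<exists>l. l \<in> K a \<and> (\<lambda>n. f ((s \<circ> s') n) a) \<longlonglongrightarrow> l"
      using LIMSEQ_subseq_LIMSEQ[OF _ s'] by (auto simp: o_def)
  qed
  then obtain s where s: "strict_mono s" "\<forall>a\<in>A. \<exists>l. l \<in> K a \<and> (\<lambda>n. f (s n) a) \<longlonglongrightarrow> l" by blast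
  from bchoice[OF s(2)] obtain l where "\<forall>a\<in>A. l a \<in> K a \<and> (\<lambda>n. f (s n) a) \<longlonglongrightarrow> l a" by blast
  then show thesis by (intro that[OF s(1), of l]) blast+
qed

text \<open>
  Positions are recovered from convergent displacements along the edges, here added one at a time. An
  edge that closes a cycle imposes nothing new. An edge that joins two components is accommodated by
  shifting one of them. Two points lie in the same component if every function that is constant along the
  edges takes the same value at both, so no paths are needed.
\<close>

lemma displacement_limit:
  fixes P :: "nat \<Rightarrow> 'v \<Rightarrow> 'a::real_normed_vector" and src tgt :: "'e \<Rightarrow> 'v"
  assumes "finite S" and "\<And>i. i \<in> S \<Longrightarrow> convergent (\<lambda>n. P n (tgt i) - P n (src i))"
  shows "\<exists>Q. (\<forall>n. \<forall>i\<in>S. Q n (tgt i) - Q n (src i) = P n (tgt i) - P n (src i)) \<and> (\<forall>v. convergent (\<lambda>n. Q n v))"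
  using assms
proof (induction S rule: finite_induct)
  case empty
  show ?case by (intro exI[of _ "\<lambda>_ _. 0"]) (simp add: convergent_const)
next
  case (insert e S)
  have "\<exists>Q. (\<forall>n. \<forall>i\<in>S. Q n (tgt i) - Q n (src i) = P n (tgt i) - P n (src i)) \<and> (\<forall>v. convergent (\<lambda>n. Q n v))"
    by (rule insert.IH) (rule insert.prems, simp)
  then obtain Q where Q: "\<And>n i. i \<in> S \<Longrightarrow> Q n (tgt i) - Q n (src i) = P n (tgt i) - P n (src i)"
    and Qc: "\<And>v. convergent (\<lambda>n. Q n v)" by blast
  define inv where "inv g \<longleftrightarrow> (\<forall>i\<in>S. g (tgt i) = g (src i))" for g :: "'v \<Rightarrow> 'a"
  show ?case
  proof (cases "\<forall>g. inv g \<longrightarrow> g (tgt e) = g (src e)")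
    case True
    have "Q n (tgt e) - Q n (src e) = P n (tgt e) - P n (src e)" for n
    proof -
      have "P n (tgt i) - Q n (tgt i) = P n (src i) - Q n (src i)" if "i \<in> S" for i
        using Q[OF that, of n] by (simp add: algebra_simps)
      then have "inv (\<lambda>v. P n v - Q n v)" by (simp add: inv_def)
      then have "P n (tgt e) - Q n (tgt e) = P n (src e) - Q n (src e)" using True by blast
      then show ?thesis by (simp add: algebra_simps)
    qed
    then show ?thesis using Q Qc by (intro exI[of _ Q]) auto
  next
    case False
    \<comment> \<open>the points that the edges of \<open>S\<close> connect to the target of \<open>e\<close>\<close>
    define K where "K = {v. \<forall>g. inv g \<longrightarrow> g v = g (tgt e)}"
    have K: "tgt e \<in> K" "src e \<notin> K" using False by (auto simp: K_def)
    have KS: "tgt i \<in> K \<longleftrightarrow> src i \<in> K" if "i \<in> S" for i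
      using that by (auto simp: K_def inv_def)
    define d where "d n = (P n (tgt e) - P n (src e)) - (Q n (tgt e) - Q n (src e))" for n
    define R where "R n v = Q n v + (if v \<in> K then d n else 0)" for n v
    have "R n (tgt i) - R n (src i) = P n (tgt i) - P n (src i)" if "i \<in> insert e S" for n i
      using that K KS Q[of i n] by (cases "i = e") (auto simp: R_def d_def)
    moreover have "convergent d"
      unfolding d_def by (rule convergent_diff[OF insert.prems convergent_diff[OF Qc Qc]]) simp
    then have "convergent (\<lambda>n. R n v)" for v
      unfolding R_def using Qc by (cases "v \<in> K") (simp_all add: convergent_add)
    ultimately show ?thesis by blast
  qed
qed

section \<open>Curves and functions on the graph\<close>

lemma proj_eq_iff:
  assumes "N_graph N r" "x \<in> edge_space {1..N}" "y \<in> edge_space {1..N}"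
  shows "proj r x = proj r y \<longleftrightarrow> (x, y) \<in> r"
  using assms eq_equiv_class_iff[of "edge_space {1..N}" r x y] by (simp add: N_graph_def proj_def)

lemma continuous_on_edge_space:
  fixes F :: "point \<Rightarrow> 'a::topological_space"
  assumes "\<And>i. i \<in> {1..N} \<Longrightarrow> continuous_on {0..1} (\<lambda>t. F (t, i))"
  shows "continuous_on (edge_space {1..N}) F"
proof -
  have "edge_space {1..N} = (\<Union>i\<in>{1..N}. {0..1} \<times> {i})" by (auto simp: edge_space_def)
  also have "continuous_on \<dots> F"
  proof (rule continuous_on_closed_Union)
    fix i assume i: "i \<in> {1..N}"
    have "continuous_on ({0..1} \<times> {i}) (\<lambda>x. F (fst x, i))"
      by (rule continuous_on_compose2[OF assms[OF i] continuous_on_fst[OF continuous_on_id]]) auto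
    then show "continuous_on ({0..1} \<times> {i}) F"
      by (rule continuous_on_eq) auto
    show "closed ({0..1::real} \<times> {i})" by (intro closed_Times) auto
  qed simp
  finally show ?thesis .
qed

lemma topspace_graph_topology: "topspace (graph_topology N r) = edge_space {1..N} // r"
proof -
  have "openin (graph_topology N r) (edge_space {1..N} // r)"
  proof -
    have "{x \<in> edge_space {1..N}. proj r x \<in> edge_space {1..N} // r} = edge_space {1..N}"
      by (auto simp: proj_def intro: quotientI)
    then show ?thesis by (simp add: openin_graph_topology)
  qed
  then show ?thesis
    by (metis openin_graph_topology openin_subset openin_topspace subset_antisym)
qed

text \<open>
  Curves whose end points depend only on the vertex of the graph define a function on the disjoint union
  of the intervals that respects the identifications, and hence a continuous function on the quotient.
\<close>

lemma glue_curves: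
  fixes c :: "nat \<Rightarrow> real \<Rightarrow> 'a::euclidean_space"
  assumes G: "N_graph N r"
    and cont: "\<And>i. i \<in> {1..N} \<Longrightarrow> continuous_on {0..1} (c i)"
    and ends: "\<And>i. i \<in> {1..N} \<Longrightarrow> c i 0 = P (proj r (0, i))" "\<And>i. i \<in> {1..N} \<Longrightarrow> c i 1 = P (proj r (1, i))"
  obtains \<Gamma> where "continuous_map (graph_topology N r) euclidean \<Gamma>"
    "\<And>i t. i \<in> {1..N} \<Longrightarrow> t \<in> {0..1} \<Longrightarrow> edge_curve r \<Gamma> i t = c i t"
proof -
  let ?E = "edge_space {1..N}"
  define F where "F x = c (snd x) (fst x)" for x :: point
  have eqv: "equiv ?E r" and rsub: "r \<subseteq> Id \<union> end_points {1..N} \<times> end_points {1..N}"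
    using G by (auto simp: N_graph_def)
  have Fr: "F x = F y" if "(x, y) \<in> r" for x y
  proof (cases "x = y")
    case False
    then have xy: "x \<in> end_points {1..N}" "y \<in> end_points {1..N}" using that rsub by auto
    have end_val: "F x = P (proj r x)" if "x \<in> end_points {1..N}" for x
      using that ends by (auto simp: F_def end_points_def)
    have "proj r x = proj r y" using equiv_class_eq[OF eqv that] by (simp add: proj_def)
    then show ?thesis using end_val xy by simp
  qed simp
  define \<Gamma> where "\<Gamma> p = F (SOME x. x \<in> p)" for p
  have val: "\<Gamma> (proj r x) = F x" if "x \<in> ?E" for x
  proof -
    have "x \<in> proj r x" using equiv_class_self[OF eqv that] by (simp add: proj_def)
    then have "(SOME y. y \<in> proj r x) \<in> proj r x" by (rule someI)
    then have "(x, SOME y. y \<in> proj r x) \<in> r" by (simp add: proj_def)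
    from Fr[OF this] show ?thesis by (simp add: \<Gamma>_def)
  qed
  have Fc: "continuous_on ?E F"
    by (rule continuous_on_edge_space) (use cont in \<open>simp add: F_def\<close>)
  have "continuous_map (graph_topology N r) euclidean \<Gamma>"
    unfolding continuous_map_openin_preimage_eq
  proof (intro conjI allI impI)
    fix U :: "'a set" assume "openin euclidean U"
    then have U: "open U" by simp
    have "{x \<in> ?E. proj r x \<in> topspace (graph_topology N r) \<inter> \<Gamma> -` U} = ?E \<inter> F -` U"
      using val by (auto simp: topspace_graph_topology proj_def intro: quotientI)
    moreover have "openin (top_of_set ?E) (?E \<inter> F -` U)"
      using Fc U by (rule continuous_openin_preimage_gen)
    ultimately show "openin (graph_topology N r) (topspace (graph_topology N r) \<inter> \<Gamma> -` U)"
      by (simp add: openin_graph_topology topspace_graph_topology)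
  qed auto
  moreover have "edge_curve r \<Gamma> i t = c i t" if "i \<in> {1..N}" "t \<in> {0..1}" for i t
    using val[of "(t, i)"] that by (simp add: edge_curve_def edge_space_def F_def)
  ultimately show thesis by (rule that)
qed

text \<open>
  The argument \<open>P\<close> may be any function on the points of the graph; only its values at vertices enter. In
  this way every such function is a system of vertex positions that respects the identifications.
\<close>

definition disp :: "(point \<times> point) set \<Rightarrow> (point set \<Rightarrow> 'a::real_vector) \<Rightarrow> nat \<Rightarrow> 'a" where
  "disp r P i = P (proj r (1, i)) - P (proj r (0, i))"

lemma disp_limit:
  fixes P :: "nat \<Rightarrow> point set \<Rightarrow> 'a::real_normed_vector"
  assumes "finite S" "\<And>i. i \<in> S \<Longrightarrow> convergent (\<lambda>n. disp r (P n) i)"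
  shows "\<exists>Q Q'. (\<forall>n. \<forall>i\<in>S. disp r (Q n) i = disp r (P n) i) \<and> (\<forall>v. (\<lambda>n. Q n v) \<longlonglongrightarrow> Q' v)"
proof -
  have "\<exists>Q. (\<forall>n. \<forall>i\<in>S. Q n (proj r (1, i)) - Q n (proj r (0, i)) = P n (proj r (1, i)) - P n (proj r (0, i)))
      \<and> (\<forall>v. convergent (\<lambda>n. Q n v))"
    by (rule displacement_limit[OF assms(1)]) (rule assms(2)[unfolded disp_def])
  then obtain Q where Q: "\<forall>n. \<forall>i\<in>S. disp r (Q n) i = disp r (P n) i" "\<forall>v. convergent (\<lambda>n. Q n v)"
    unfolding disp_def by blast
  have "(\<lambda>n. Q n v) \<longlonglongrightarrow> lim (\<lambda>n. Q n v)" for v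
    using Q(2) by (simp add: convergent_LIMSEQ_iff)
  with Q(1) show ?thesis by (intro exI[of _ Q] exI[of _ "\<lambda>v. lim (\<lambda>n. Q n v)"]) blast
qed

text \<open>
  Otherwise the edges on which \<open>g\<close> has the vertex value \<open>c\<close> and the remaining edges would split the graph
  into two nonempty open sets: no vertex belongs to edges of both kinds, and in the disjoint union of the
  intervals any union of whole intervals is open.
\<close>

lemma connected_graph_constant:
  fixes g :: "point set \<Rightarrow> 'a::real_vector"
  assumes G: "N_graph N r" and conn: "connected_space (graph_topology N r)"
    and zero: "\<And>i. i \<in> {1..N} \<Longrightarrow> disp r g i = 0"
    and x: "x \<in> end_points {1..N}" "y \<in> end_points {1..N}"
  shows "g (proj r x) = g (proj r y)"
proof -
  let ?E = "edge_space {1..N}"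
  have rsub: "r \<subseteq> Id \<union> end_points {1..N} \<times> end_points {1..N}"
    using G by (auto simp: N_graph_def)
  define a where "a i = g (proj r (0, i))" for i
  have ga: "g (proj r x) = a (snd x)" if "x \<in> end_points {1..N}" for x
    using that zero by (auto simp: end_points_def a_def disp_def)
  define c where "c = a (snd x)"
  define U where "U T = proj r ` edge_space T" for T
  have open_U: "openin (graph_topology N r) (U T)"
    and pre_U: "{x \<in> ?E. proj r x \<in> U T} = edge_space T"
    if T: "T = {i \<in> {1..N}. Q (a i)}" for T Q
  proof -
    have TN: "edge_space T \<subseteq> ?E" using T by (auto simp: edge_space_def)
    show pre: "{x \<in> ?E. proj r x \<in> U T} = edge_space T"
    proof (intro equalityI subsetI)
      fix u assume "u \<in> {x \<in> ?E. proj r x \<in> U T}"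
      then obtain v where u: "u \<in> ?E" and v: "v \<in> edge_space T" "proj r u = proj r v" by (auto simp: U_def)
      then have "(u, v) \<in> r" using proj_eq_iff[OF G u, of v] TN by blast
      then consider "u = v" | "u \<in> end_points {1..N}" "v \<in> end_points {1..N}" using rsub by auto
      then show "u \<in> edge_space T"
      proof cases
        case 2
        then have "a (snd u) = a (snd v)" using ga v(2) by metis
        then show ?thesis using u v(1) T by (auto simp: edge_space_def)
      qed (use v in simp)
    next
      fix u assume "u \<in> edge_space T"
      then show "u \<in> {x \<in> ?E. proj r x \<in> U T}" using TN by (auto simp: U_def)
    qed
    have "edge_space T = ?E \<inter> UNIV \<times> T" using T by (auto simp: edge_space_def)
    moreover have "open (UNIV \<times> T :: point set)" by (intro open_Times) (auto simp: open_discrete)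
    ultimately have "openin (top_of_set ?E) (edge_space T)" by (auto simp: openin_open)
    moreover have "U T \<subseteq> ?E // r" using TN by (auto simp: U_def proj_def intro: quotientI)
    ultimately show "openin (graph_topology N r) (U T)"
      unfolding openin_graph_topology pre by simp
  qed
  let ?T = "{i \<in> {1..N}. a i = c}" and ?T' = "{i \<in> {1..N}. a i \<noteq> c}"
  have O: "openin (graph_topology N r) (U ?T)" "openin (graph_topology N r) (U ?T')"
    using open_U[of ?T "\<lambda>b. b = c"] open_U[of ?T' "\<lambda>b. b \<noteq> c"] by simp_all
  have pre: "{x \<in> ?E. proj r x \<in> U ?T} = edge_space ?T" "{x \<in> ?E. proj r x \<in> U ?T'} = edge_space ?T'"
    using pre_U[of ?T "\<lambda>b. b = c"] pre_U[of ?T' "\<lambda>b. b \<noteq> c"] by simp_all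
  have disj: "U ?T \<inter> U ?T' = {}"
  proof (rule ccontr)
    assume "U ?T \<inter> U ?T' \<noteq> {}"
    then obtain u where u: "u \<in> edge_space ?T" "proj r u \<in> U ?T'" by (auto simp: U_def)
    then have "u \<in> ?E" by (auto simp: edge_space_def)
    with u(2) have "u \<in> {x \<in> ?E. proj r x \<in> U ?T'}" by blast
    then have "u \<in> edge_space ?T'" unfolding pre(2) .
    then show False using u(1) by (auto simp: edge_space_def)
  qed
  have cover: "topspace (graph_topology N r) \<subseteq> U ?T \<union> U ?T'"
  proof -
    have "edge_space ?T \<union> edge_space ?T' = ?E" by (auto simp: edge_space_def)
    then have "U ?T \<union> U ?T' = proj r ` ?E" unfolding U_def by (metis image_Un)
    moreover have "?E // r = proj r ` ?E" by (auto simp: quotient_def proj_def)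
    ultimately show ?thesis by (simp add: topspace_graph_topology)
  qed
  have "x \<in> edge_space ?T" using x(1) by (auto simp: c_def edge_space_def end_points_def)
  then have xT: "proj r x \<in> U ?T" unfolding U_def by (rule imageI)
  moreover have "\<not> (U ?T \<noteq> {} \<and> U ?T' \<noteq> {})"
    using conn[unfolded connected_space_def] O disj cover by meson
  ultimately have "U ?T' = {}" by blast
  then have "?T' = {}" by (auto simp: U_def edge_space_def)
  then have "a (snd y) = c" using x(2) by (auto simp: end_points_def)
  then show ?thesis using ga x by (simp add: c_def)
qed

section \<open>Stratified straight subgraphs\<close>

text \<open>
  The strict inequality makes the condition open in \<open>\<delta>\<close> and excludes \<open>\<delta> = 0\<close>; it is also invariant under
  scaling of \<open>\<delta>\<close>.
\<close>

definition aligned :: "real \<Rightarrow> 'a::real_normed_vector \<Rightarrow> 'a \<Rightarrow> bool" where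
  "aligned e \<delta> \<tau> \<longleftrightarrow> norm (\<delta> - norm \<delta> *\<^sub>R \<tau>) < e * norm \<delta>"

text \<open>
  For unit tangents that are opposite along each edge and satisfy the angle condition, this is equivalent
  to stratified straightness; it mentions a single scale and is stable under limits of \<open>\<tau>\<close>.
\<close>

definition approx_straight :: "(point \<times> point) set \<Rightarrow> nat set \<Rightarrow> (point \<Rightarrow> 'a::real_normed_vector) \<Rightarrow> bool" where
  "approx_straight r S \<tau> \<longleftrightarrow> (\<forall>e>0. \<exists>P. \<forall>i\<in>S. aligned e (disp r P i) (\<tau> (0, i)))"

lemma aligned_scaleR: "h > 0 \<Longrightarrow> aligned e (h *\<^sub>R \<delta>) \<tau> \<longleftrightarrow> aligned e \<delta> \<tau>"
proof -
  assume h: "h > 0"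
  have "h *\<^sub>R \<delta> - norm (h *\<^sub>R \<delta>) *\<^sub>R \<tau> = h *\<^sub>R (\<delta> - norm \<delta> *\<^sub>R \<tau>)"
    using h by (simp add: scaleR_diff_right)
  then have "norm (h *\<^sub>R \<delta> - norm (h *\<^sub>R \<delta>) *\<^sub>R \<tau>) = h * norm (\<delta> - norm \<delta> *\<^sub>R \<tau>)"
    using h by simp
  then have "aligned e (h *\<^sub>R \<delta>) \<tau> \<longleftrightarrow> h * norm (\<delta> - norm \<delta> *\<^sub>R \<tau>) < h * (e * norm \<delta>)"
    using h by (simp add: aligned_def mult.left_commute)
  also have "\<dots> \<longleftrightarrow> aligned e \<delta> \<tau>" using h by (simp add: aligned_def)
  finally show ?thesis .
qed

lemma aligned_nonzero: "aligned e \<delta> \<tau> \<Longrightarrow> \<delta> \<noteq> 0"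
  by (auto simp: aligned_def)

lemma aligned_perturb:
  fixes \<delta> :: "'a::real_normed_vector"
  assumes "aligned e \<delta> \<tau>"
  shows "\<forall>\<^sub>F h in at_right 0. aligned e (\<delta> + h *\<^sub>R y) \<tau>"
proof -
  let ?f = "\<lambda>h. e * norm (\<delta> + h *\<^sub>R y) - norm (\<delta> + h *\<^sub>R y - norm (\<delta> + h *\<^sub>R y) *\<^sub>R \<tau>)"
  have "(?f \<longlongrightarrow> e * norm (\<delta> + 0 *\<^sub>R y) - norm (\<delta> + 0 *\<^sub>R y - norm (\<delta> + 0 *\<^sub>R y) *\<^sub>R \<tau>)) (at_right 0)"
    by (intro tendsto_intros)
  moreover have "0 < e * norm (\<delta> + 0 *\<^sub>R y) - norm (\<delta> + 0 *\<^sub>R y - norm (\<delta> + 0 *\<^sub>R y) *\<^sub>R \<tau>)"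
    using assms by (simp add: aligned_def)
  ultimately have "\<forall>\<^sub>F h in at_right 0. 0 < ?f h" by (rule order_tendstoD)
  then show ?thesis by eventually_elim (simp add: aligned_def)
qed

text \<open>
  Take \<open>P + h P'\<close> with \<open>h > 0\<close> small: alignment of the first kind of edges is an open condition, and that of
  the second kind is invariant under scaling by \<open>h\<close>.
\<close>

lemma aligned_merge:
  fixes P P' :: "point set \<Rightarrow> 'a::real_normed_vector"
  assumes "finite S"
    and P: "\<And>i. i \<in> S \<Longrightarrow> aligned e (disp r P i) (\<tau> i) \<or> (disp r P i = 0 \<and> aligned e (disp r P' i) (\<tau> i))"
  shows "\<exists>P''. \<forall>i\<in>S. aligned e (disp r P'' i) (\<tau> i)"
proof -
  have d: "disp r (\<lambda>v. P v + h *\<^sub>R P' v) i = disp r P i + h *\<^sub>R disp r P' i" for h i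
    by (simp add: disp_def algebra_simps)
  have "\<forall>\<^sub>F h in at_right 0. \<forall>i\<in>S. aligned e (disp r (\<lambda>v. P v + h *\<^sub>R P' v) i) (\<tau> i)"
  proof (rule eventually_ball_finite[OF assms(1)], rule ballI)
    fix i assume "i \<in> S"
    from P[OF this] show "\<forall>\<^sub>F h in at_right 0. aligned e (disp r (\<lambda>v. P v + h *\<^sub>R P' v) i) (\<tau> i)"
    proof
      assume "aligned e (disp r P i) (\<tau> i)"
      then show ?thesis unfolding d by (rule aligned_perturb)
    next
      assume i: "disp r P i = 0 \<and> aligned e (disp r P' i) (\<tau> i)"
      have "\<forall>\<^sub>F h :: real in at_right 0. h > 0" by (rule eventually_at_right_less)
      then show ?thesis unfolding d by eventually_elim (use i in \<open>simp add: aligned_scaleR\<close>)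
    qed
  qed
  then have "\<exists>h. \<forall>i\<in>S. aligned e (disp r (\<lambda>v. P v + h *\<^sub>R P' v) i) (\<tau> i)"
    by (rule eventually_happens'[rotated]) simp
  then show ?thesis by blast
qed

text \<open>
  All secants from \<open>\<gamma> 0\<close> lie on the half line spanned by the chord, and so does their limit, the initial
  velocity. The component orthogonal to the chord is constant, and the component along it is minimal at
  \<open>0\<close>.
\<close>

lemma straight_segment_tangent:
  fixes \<gamma> :: "real \<Rightarrow> 'a::euclidean_space"
  assumes imm: "immersion \<gamma>" and st: "straight_segment \<gamma>"
  shows "\<gamma> 1 \<noteq> \<gamma> 0" "\<gamma> 1 - \<gamma> 0 = norm (\<gamma> 1 - \<gamma> 0) *\<^sub>R outer_tangent \<gamma> 0"
proof -
  have C1: "C1 \<gamma>" and v0: "velocity \<gamma> 0 \<noteq> 0" using imm by (auto simp: immersion_def)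
  define d where "d = \<gamma> 1 - \<gamma> 0"
  have seg: "\<exists>k\<ge>0. \<gamma> t - \<gamma> 0 = k *\<^sub>R d" if "t \<in> {0..1}" for t
  proof -
    have "\<gamma> t \<in> closed_segment (\<gamma> 0) (\<gamma> 1)" using st that by (auto simp: straight_segment_def)
    then obtain k where "k \<ge> 0" "\<gamma> t = (1 - k) *\<^sub>R \<gamma> 0 + k *\<^sub>R \<gamma> 1" by (auto simp: in_segment)
    then show ?thesis by (intro exI[of _ k]) (simp add: d_def algebra_simps)
  qed
  have d0: "d \<noteq> 0"
  proof
    assume "d = 0"
    then have "\<gamma> t = \<gamma> 0" if "t \<in> {0..1}" for t using seg[OF that] by auto
    then have "singular_curve \<gamma>" unfolding singular_curve_def constant_on_def by blast
    then show False using singular_curve_velocity(2)[of \<gamma> 0] v0 by simp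
  qed
  define v where "v = velocity \<gamma> 0"
  have \<gamma>': "(\<gamma> has_vector_derivative v) (at 0 within {0..1})"
    unfolding v_def by (rule C1D(1)[OF C1]) simp
  let ?A = "\<lambda>t. (\<gamma> t - \<gamma> 0) - (((\<gamma> t - \<gamma> 0) \<bullet> d) / (d \<bullet> d)) *\<^sub>R d"
  have "?A t = 0" if "t \<in> {0..1}" for t
    using seg[OF that] d0 by auto
  then have "singular_curve ?A" unfolding singular_curve_def constant_on_def by blast
  then have "velocity ?A 0 = 0" using singular_curve_velocity(2)[of ?A 0] by simp
  moreover have "velocity ?A 0 = v - ((v \<bullet> d) / (d \<bullet> d)) *\<^sub>R d"
  proof (rule velocity_eqI)
    have "(?A has_derivative (\<lambda>h. h *\<^sub>R v - (((h *\<^sub>R v) \<bullet> d) / (d \<bullet> d)) *\<^sub>R d)) (at 0 within {0..1})"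
      using \<gamma>' unfolding has_vector_derivative_def
      by (auto intro!: derivative_eq_intros simp: d0)
    then show "(?A has_vector_derivative v - ((v \<bullet> d) / (d \<bullet> d)) *\<^sub>R d) (at 0 within {0..1})"
      unfolding has_vector_derivative_def by (simp add: scaleR_diff_right)
  qed simp
  ultimately have v: "v = ((v \<bullet> d) / (d \<bullet> d)) *\<^sub>R d" by simp
  have "0 \<le> v \<bullet> d"
  proof (rule tendsto_lowerbound)
    have "((\<lambda>t. \<gamma> t \<bullet> d) has_derivative (\<lambda>h. (h *\<^sub>R v) \<bullet> d)) (at 0 within {0..1})"
      using \<gamma>' unfolding has_vector_derivative_def by (rule has_derivative_inner_left)
    then have "((\<lambda>t. \<gamma> t \<bullet> d) has_field_derivative (v \<bullet> d)) (at 0 within {0..1})"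
      by (rule has_derivative_imp_has_field_derivative) simp
    then show "((\<lambda>t. (\<gamma> t \<bullet> d - \<gamma> 0 \<bullet> d) / (t - 0)) \<longlongrightarrow> v \<bullet> d) (at 0 within {0..1})"
      by (simp add: has_field_derivative_iff)
    have "0 \<le> (\<gamma> t \<bullet> d - \<gamma> 0 \<bullet> d) / (t - 0)" if "t \<in> {0..1}" for t
    proof -
      have "0 \<le> (\<gamma> t - \<gamma> 0) \<bullet> d" using seg[OF that] by auto
      then show ?thesis using that by (simp add: inner_diff_left)
    qed
    then show "\<forall>\<^sub>F t in at 0 within {0..1}. 0 \<le> (\<gamma> t \<bullet> d - \<gamma> 0 \<bullet> d) / (t - 0)"
      by (simp add: eventually_at_filter)
  qed (simp add: trivial_limit_within islimpt_Icc)
  moreover define k where "k = (v \<bullet> d) / (d \<bullet> d)"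
  ultimately have k: "k \<ge> 0" "v = k *\<^sub>R d" using v by simp_all
  then have "k > 0" using v0 v_def by (cases "k = 0") auto
  then have "outer_tangent \<gamma> 0 = d /\<^sub>R norm d"
    using k v_def by (simp add: outer_tangent_def unit_tangent_def)
  then have "d = norm d *\<^sub>R outer_tangent \<gamma> 0" using d0 by simp
  then show "\<gamma> 1 - \<gamma> 0 = norm (\<gamma> 1 - \<gamma> 0) *\<^sub>R outer_tangent \<gamma> 0" unfolding d_def .
  show "\<gamma> 1 \<noteq> \<gamma> 0" using d0 by (simp add: d_def)
qed

text \<open>
  The edges of the first stratum are exactly aligned by \<open>\<Sigma> 0\<close>, and all others have displacement zero there. A
  small multiple of an approximate realization of the deeper strata aligns the latter.
\<close>

lemma stratified_imp_approx_straight: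
  fixes \<tau> :: "point \<Rightarrow> real ^ 'd"
  assumes "stratified_straight_with N r D S \<tau>"
  shows "approx_straight r S \<tau>"
proof -
  have "approx_straight r (H 0) \<tau>"
    if "H q = {}" and "\<forall>j<q. H (Suc j) \<subset> H j
           \<and> network N r (H j) (\<Sigma> j)
           \<and> angle_condition_with r D (H j) (\<Sigma> j) \<tau>
           \<and> (\<forall>i\<in>H j. regular_curve (edge_curve r (\<Sigma> j) i) \<longrightarrow>
                straight_segment (edge_curve r (\<Sigma> j) i))
           \<and> H (Suc j) = Sing r (H j) (\<Sigma> j)"
    for q H and \<Sigma> :: "nat \<Rightarrow> point set \<Rightarrow> real ^ 'd"
    using that
  proof (induction q arbitrary: H \<Sigma>)
    case 0
    then show ?case by (simp add: approx_straight_def)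
  next
    case (Suc q)
    have IH: "approx_straight r (H (Suc 0)) \<tau>"
    proof (rule Suc.IH[of "\<lambda>j. H (Suc j)" "\<lambda>j. \<Sigma> (Suc j)"])
      show "H (Suc q) = {}" by (rule Suc.prems(1))
    qed (use Suc.prems(2) in \<open>metis Suc_less_eq\<close>)
    have 0: "network N r (H 0) (\<Sigma> 0)" "angle_condition_with r D (H 0) (\<Sigma> 0) \<tau>"
      "\<And>i. i \<in> H 0 \<Longrightarrow> regular_curve (edge_curve r (\<Sigma> 0) i) \<Longrightarrow> straight_segment (edge_curve r (\<Sigma> 0) i)"
      "H (Suc 0) = Sing r (H 0) (\<Sigma> 0)"
      using Suc.prems(2) by auto
    have fin: "finite (H 0)" using 0(1) finite_subset by (fastforce simp: network_def)
    show ?case unfolding approx_straight_def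
    proof (intro allI impI)
      fix e :: real assume e: "e > 0"
      obtain P' where P': "\<And>i. i \<in> H (Suc 0) \<Longrightarrow> aligned e (disp r P' i) (\<tau> (0, i))"
        using IH e unfolding approx_straight_def by blast
      show "\<exists>P. \<forall>i\<in>H 0. aligned e (disp r P i) (\<tau> (0, i))"
      proof (rule aligned_merge[OF fin])
        fix i assume i: "i \<in> H 0"
        let ?c = "edge_curve r (\<Sigma> 0) i"
        have d: "disp r (\<Sigma> 0) i = ?c 1 - ?c 0" by (simp add: disp_def edge_curve_def)
        show "aligned e (disp r (\<Sigma> 0) i) (\<tau> (0, i)) \<or>
            (disp r (\<Sigma> 0) i = 0 \<and> aligned e (disp r P' i) (\<tau> (0, i)))"
        proof (cases "singular_curve ?c")
          case True
          then have "i \<in> H (Suc 0)" using i 0(4) by (simp add: Sing_def)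
          moreover have "?c 1 = ?c 0" using True by (auto simp: singular_curve_def constant_on_def)
          ultimately show ?thesis using P' d by simp
        next
          case False
          then have reg: "regular_curve ?c" using 0(1) i by (auto simp: network_def)
          then have imm: "immersion ?c" by (simp add: regular_curve_def)
          have "\<tau> (0, i) = outer_tangent ?c 0"
            using 0(2) i reg by (auto simp: angle_condition_with_def)
          with straight_segment_tangent[OF imm 0(3)[OF i reg]] e show ?thesis
            unfolding d aligned_def by simp
        qed
      qed
    qed
  qed
  then show ?thesis using assms unfolding stratified_straight_with_def by blast
qed

definition angles_at_vertices ::
    "(point \<times> point) set \<Rightarrow> (point \<Rightarrow> real ^ 'd) \<Rightarrow> nat set \<Rightarrow> (point \<Rightarrow> real ^ 'd) \<Rightarrow> bool" where
  "angles_at_vertices r D S \<tau> \<longleftrightarrow> (\<forall>p\<in>proj r ` end_points S. \<exists>R :: real ^ 'd ^ 'd. rotation_matrix R \<and>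
        (\<forall>x\<in>end_points S. proj r x = p \<longrightarrow> \<tau> x = R *v D x))"

lemma angles_at_vertices_subset:
  assumes "angles_at_vertices r D S \<tau>" "T \<subseteq> S" shows "angles_at_vertices r D T \<tau>"
proof -
  have "end_points T \<subseteq> end_points S" using assms(2) by (auto simp: end_points_def)
  then show ?thesis using assms(1) unfolding angles_at_vertices_def
    by (metis (no_types, opaque_lifting) image_mono subsetD)
qed

lemma linear_curve:
  fixes a d :: "'a::euclidean_space"
  assumes eq: "\<And>t. t \<in> {0..1} \<Longrightarrow> u t = a + t *\<^sub>R d"
  shows "t \<in> {0..1} \<Longrightarrow> velocity u t = d" "C1 u"
    "d = 0 \<Longrightarrow> singular_curve u"
    "d \<noteq> 0 \<Longrightarrow> regular_curve u" "straight_segment u"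
    "singular_curve u \<Longrightarrow> d = 0"
proof -
  have deriv: "(u has_vector_derivative d) (at t within {0..1})" if "t \<in> {0..1}" for t
  proof (rule has_vector_derivative_transform[OF that eq])
    show "((\<lambda>t. a + t *\<^sub>R d) has_vector_derivative d) (at t within {0..1})"
      by (auto intro!: derivative_eq_intros)
  qed
  show v: "velocity u t = d" if "t \<in> {0..1}" for t by (rule velocity_eqI[OF deriv[OF that] that])
  show C1: "C1 u" by (rule C1I[OF deriv]) auto
  show "d = 0 \<Longrightarrow> singular_curve u" using eq by (auto simp: singular_curve_def constant_on_def)
  show "d = 0" if "singular_curve u"
    using singular_curve_velocity(2)[OF that, of 0] v[of 0] by simp
  show "regular_curve u" if "d \<noteq> 0"
    by (rule regular_curveI[OF C1, of "\<lambda>_. 0"]) (use v that in \<open>auto simp: dominated_def\<close>)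
  have "u ` {0..1} = (\<lambda>t. (1 - t) *\<^sub>R u 0 + t *\<^sub>R u 1) ` {0..1}"
    by (rule image_cong) (use eq in \<open>auto simp: algebra_simps\<close>)
  then show "straight_segment u" by (simp add: straight_segment_def closed_segment_image_interval)
qed

lemma straight_network:
  fixes Q :: "point set \<Rightarrow> real ^ 'd"
  assumes G: "N_graph N r" and S: "S \<subseteq> {1..N}"
    and Q: "\<And>i. i \<in> S \<Longrightarrow> disp r Q i = l i *\<^sub>R \<tau> (0, i)" and l: "\<And>i. i \<in> S \<Longrightarrow> l i \<ge> 0"
    and \<tau>: "\<And>i. i \<in> S \<Longrightarrow> norm (\<tau> (0, i)) = 1" "\<And>i. i \<in> S \<Longrightarrow> \<tau> (1, i) = - \<tau> (0, i)"
    and ang: "angles_at_vertices r D S \<tau>"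
  obtains \<Sigma> where "network N r S \<Sigma>" "angle_condition_with r D S \<Sigma> \<tau>"
    "\<And>i. i \<in> S \<Longrightarrow> straight_segment (edge_curve r \<Sigma> i)" "Sing r S \<Sigma> = {i \<in> S. l i = 0}"
proof -
  define c where "c i t = Q (proj r (0, i)) + t *\<^sub>R disp r Q i" for i and t :: real
  obtain \<Sigma> where \<Sigma>: "continuous_map (graph_topology N r) euclidean \<Sigma>"
    "\<And>i t. i \<in> {1..N} \<Longrightarrow> t \<in> {0..1} \<Longrightarrow> edge_curve r \<Sigma> i t = c i t"
  proof (rule glue_curves[OF G, of c Q])
    show "continuous_on {0..1} (c i)" for i unfolding c_def by (intro continuous_intros)
  qed (auto simp: c_def disp_def)
  have e: "edge_curve r \<Sigma> i t = Q (proj r (0, i)) + t *\<^sub>R disp r Q i" if "i \<in> S" "t \<in> {0..1}" for i t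
    using \<Sigma>(2)[of i t] that S by (auto simp: c_def)
  note lin = linear_curve[of "edge_curve r \<Sigma> _", OF e]
  have zero: "disp r Q i = 0 \<longleftrightarrow> l i = 0" if "i \<in> S" for i
    using Q[OF that] \<tau>(1)[OF that] by auto
  have net: "network N r S \<Sigma>"
    unfolding network_def
  proof (intro conjI ballI S)
    show "continuous_map (subtopology (graph_topology N r) (subgraph_points r S)) euclidean \<Sigma>"
      by (rule continuous_map_from_subtopology[OF \<Sigma>(1)])
    show "singular_curve (edge_curve r \<Sigma> i) \<or> regular_curve (edge_curve r \<Sigma> i)" if "i \<in> S" for i
      using lin(3,4)[OF that] by blast
  qed
  have sing: "singular_curve (edge_curve r \<Sigma> i) \<longleftrightarrow> l i = 0" if "i \<in> S" for i
    using lin(3)[OF that] lin(6)[OF that] zero[OF that] by blast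
  have ac: "angle_condition_with r D S \<Sigma> \<tau>"
    unfolding angle_condition_with_def
  proof (intro conjI ballI impI)
    fix i z assume i: "i \<in> S" and reg: "regular_curve (edge_curve r \<Sigma> i)" and z: "z \<in> {0, 1::real}"
    have "\<not> singular_curve (edge_curve r \<Sigma> i)" using reg singular_not_regular by blast
    then have li: "l i > 0" using sing[OF i] l[OF i] by auto
    have "velocity (edge_curve r \<Sigma> i) z = l i *\<^sub>R \<tau> (0, i)"
      using lin(1)[OF i, of z] z Q[OF i] by auto
    then have "unit_tangent (edge_curve r \<Sigma> i) z = \<tau> (0, i)"
      using li \<tau>(1)[OF i] by (simp add: unit_tangent_def)
    then show "\<tau> (z, i) = outer_tangent (edge_curve r \<Sigma> i) z"
      using z \<tau>(2)[OF i] by (auto simp: outer_tangent_def)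
  next
    show "\<exists>R. rotation_matrix R \<and> (\<forall>x\<in>end_points S. proj r x = p \<longrightarrow> \<tau> x = R *v D x)"
      if "p \<in> proj r ` end_points S" for p
      using ang that unfolding angles_at_vertices_def by blast
  qed (use \<tau> in auto)
  show thesis
    by (rule that[OF net ac]) (use lin(5) sing in \<open>auto simp: Sing_def\<close>)
qed

text \<open>
  Take realizations with alignment errors tending to zero and scale the total length of their
  displacements to one. In the limit along a subsequence every displacement \<open>l i *\<^sub>R \<tau> (0, i)\<close> points in the
  prescribed direction and some \<open>l i\<close> are positive: this is the first stratum. The edges with \<open>l i = 0\<close>, which
  are shorter by an order of magnitude, are realized by the same sequence and fewer in number.
\<close>

theorem approx_straight_imp_stratified:
  fixes \<tau> :: "point \<Rightarrow> real ^ 'd"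
  assumes G: "N_graph N r"
  shows "S \<subseteq> {1..N} \<Longrightarrow> approx_straight r S \<tau> \<Longrightarrow> (\<And>i. i \<in> S \<Longrightarrow> norm (\<tau> (0, i)) = 1) \<Longrightarrow>
    (\<And>i. i \<in> S \<Longrightarrow> \<tau> (1, i) = - \<tau> (0, i)) \<Longrightarrow> angles_at_vertices r D S \<tau> \<Longrightarrow>
    stratified_straight_with N r D S \<tau>"
proof (induction "card S" arbitrary: S rule: less_induct)
  case less
  have fin: "finite S" using less.prems(1) finite_subset by blast
  show ?case
  proof (cases "S = {}")
    case True
    then show ?thesis unfolding stratified_straight_with_def by (intro exI[of _ 0] exI[of _ "\<lambda>_. {}"]) simp
  next
    case False
    have "\<exists>P. \<forall>i\<in>S. aligned (1 / real (Suc n)) (disp r P i) (\<tau> (0, i))" for n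
      using less.prems(2) by (simp add: approx_straight_def)
    then obtain P where P: "\<And>n i. i \<in> S \<Longrightarrow> aligned (1 / real (Suc n)) (disp r (P n) i) (\<tau> (0, i))"
      by metis
    define L where "L n = (\<Sum>i\<in>S. norm (disp r (P n) i))" for n
    have L: "L n > 0" for n
      unfolding L_def using fin False aligned_nonzero[OF P] by (intro sum_pos) auto
    define R where "R n v = (1 / L n) *\<^sub>R P n v" for n v
    have dR: "disp r (R n) i = (1 / L n) *\<^sub>R disp r (P n) i" for n i
      by (simp add: disp_def R_def scaleR_diff_right)
    have RA: "aligned (1 / real (Suc n)) (disp r (R n) i) (\<tau> (0, i))" if "i \<in> S" for n i
      unfolding dR using P[OF that] L by (simp add: aligned_scaleR)
    have sum1: "(\<Sum>i\<in>S. norm (disp r (R n) i)) = 1" for n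
      using L[of n] by (simp add: dR L_def flip: sum_divide_distrib)
    have le1: "norm (disp r (R n) i) \<in> {0..1}" if "i \<in> S" for n i
      using member_le_sum[OF that _ fin, of "\<lambda>i. norm (disp r (R n) i)"] sum1[of n] by simp
    obtain s l where s: "strict_mono s" and l01: "\<And>i. i \<in> S \<Longrightarrow> l i \<in> {0..1::real}"
      and l: "\<And>i. i \<in> S \<Longrightarrow> (\<lambda>n. norm (disp r (R (s n)) i)) \<longlonglongrightarrow> l i"
      by (rule finite_compact_subseq[where f="\<lambda>n i. norm (disp r (R n) i)" and K="\<lambda>_. {0..1}",
            OF fin le1 compact_Icc]) blast+
    have suml: "(\<Sum>i\<in>S. l i) = 1"
    proof (rule LIMSEQ_unique)
      show "(\<lambda>n. \<Sum>i\<in>S. norm (disp r (R (s n)) i)) \<longlonglongrightarrow> (\<Sum>i\<in>S. l i)"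
        by (intro tendsto_sum l)
    qed (simp add: sum1)
    have dlim: "(\<lambda>n. disp r (R (s n)) i) \<longlonglongrightarrow> l i *\<^sub>R \<tau> (0, i)" if i: "i \<in> S" for i
    proof -
      have "(\<lambda>n. disp r (R (s n)) i - norm (disp r (R (s n)) i) *\<^sub>R \<tau> (0, i)) \<longlonglongrightarrow> 0"
      proof (rule Lim_null_comparison)
        show "(\<lambda>n. 1 / real (Suc n)) \<longlonglongrightarrow> 0" by (rule LIMSEQ_Suc[OF lim_1_over_n])
        show "\<forall>\<^sub>F n in sequentially. norm (disp r (R (s n)) i - norm (disp r (R (s n)) i) *\<^sub>R \<tau> (0, i)) \<le> 1 / real (Suc n)"
        proof (intro always_eventually allI)
          fix n
          have "norm (disp r (R (s n)) i - norm (disp r (R (s n)) i) *\<^sub>R \<tau> (0, i))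
              \<le> 1 / real (Suc (s n)) * norm (disp r (R (s n)) i)"
            using RA[OF i, of "s n"] by (simp add: aligned_def)
          also have "\<dots> \<le> 1 / real (Suc (s n)) * 1"
            using le1[OF i, of "s n"] by (intro mult_left_mono) auto
          also have "\<dots> \<le> 1 / real (Suc n)"
            using seq_suble[OF s, of n] by (simp add: frac_le)
          finally show "norm (disp r (R (s n)) i - norm (disp r (R (s n)) i) *\<^sub>R \<tau> (0, i)) \<le> 1 / real (Suc n)" .
        qed
      qed
      from tendsto_add[OF this tendsto_scaleR[OF l[OF i] tendsto_const[of "\<tau> (0, i)"]]]
      show ?thesis by simp
    qed
    have "convergent (\<lambda>n. disp r (R (s n)) i)" if "i \<in> S" for i
      using dlim[OF that] by (auto simp: convergent_def)
    from disp_limit[OF fin this] obtain Q Q'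
      where Q: "\<And>n i. i \<in> S \<Longrightarrow> disp r (Q n) i = disp r (R (s n)) i"
        and Q': "\<And>v. (\<lambda>n. Q n v) \<longlonglongrightarrow> Q' v" by blast
    have dQ: "disp r Q' i = l i *\<^sub>R \<tau> (0, i)" if i: "i \<in> S" for i
    proof (rule LIMSEQ_unique)
      show "(\<lambda>n. disp r (Q n) i) \<longlonglongrightarrow> disp r Q' i"
        unfolding disp_def by (intro tendsto_diff Q')
      show "(\<lambda>n. disp r (Q n) i) \<longlonglongrightarrow> l i *\<^sub>R \<tau> (0, i)"
        unfolding Q[OF i] by (rule dlim[OF i])
    qed
    have l_nonneg: "l i \<ge> 0" if "i \<in> S" for i using l01[OF that] by simp
    obtain \<Sigma>0 where \<Sigma>0: "network N r S \<Sigma>0" "angle_condition_with r D S \<Sigma>0 \<tau>"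
      "\<And>i. i \<in> S \<Longrightarrow> straight_segment (edge_curve r \<Sigma>0 i)" "Sing r S \<Sigma>0 = {i \<in> S. l i = 0}"
      using straight_network[OF G less.prems(1) dQ l_nonneg less.prems(3,4,5)] by blast
    define T where "T = {i \<in> S. l i = 0}"
    have T: "T \<subset> S"
    proof -
      have "\<not> (\<forall>i\<in>S. l i = 0)" using suml by (metis sum.neutral zero_neq_one)
      then show ?thesis by (auto simp: T_def)
    qed
    have "stratified_straight_with N r D T \<tau>"
    proof (rule less.hyps)
      show "card T < card S" by (rule psubset_card_mono[OF fin T])
      show "approx_straight r T \<tau>" using less.prems(2) T unfolding approx_straight_def by blast
      show "angles_at_vertices r D T \<tau>" using angles_at_vertices_subset[OF less.prems(5)] T by blast
    qed (use less.prems T in auto)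
    then obtain q :: nat and H :: "nat \<Rightarrow> nat set" and \<Sigma> :: "nat \<Rightarrow> point set \<Rightarrow> real ^ 'd"
      where H: "H 0 = T" "H q = {}" and HS: "\<forall>j<q. H (Suc j) \<subset> H j
           \<and> network N r (H j) (\<Sigma> j)
           \<and> angle_condition_with r D (H j) (\<Sigma> j) \<tau>
           \<and> (\<forall>i\<in>H j. regular_curve (edge_curve r (\<Sigma> j) i) \<longrightarrow>
                straight_segment (edge_curve r (\<Sigma> j) i))
           \<and> H (Suc j) = Sing r (H j) (\<Sigma> j)"
      unfolding stratified_straight_with_def by blast
    define H' where "H' = case_nat S H"
    define \<Sigma>' where "\<Sigma>' = case_nat \<Sigma>0 \<Sigma>"
    have H': "H' 0 = S" "\<And>k. H' (Suc k) = H k" and \<Sigma>': "\<Sigma>' 0 = \<Sigma>0" "\<And>k. \<Sigma>' (Suc k) = \<Sigma> k"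
      by (simp_all add: H'_def \<Sigma>'_def)
    have strata: "\<forall>j<Suc q. H' (Suc j) \<subset> H' j
           \<and> network N r (H' j) (\<Sigma>' j)
           \<and> angle_condition_with r D (H' j) (\<Sigma>' j) \<tau>
           \<and> (\<forall>i\<in>H' j. regular_curve (edge_curve r (\<Sigma>' j) i) \<longrightarrow>
                straight_segment (edge_curve r (\<Sigma>' j) i))
           \<and> H' (Suc j) = Sing r (H' j) (\<Sigma>' j)"
    proof (intro allI impI)
      fix j assume j: "j < Suc q"
      show "H' (Suc j) \<subset> H' j
           \<and> network N r (H' j) (\<Sigma>' j)
           \<and> angle_condition_with r D (H' j) (\<Sigma>' j) \<tau>
           \<and> (\<forall>i\<in>H' j. regular_curve (edge_curve r (\<Sigma>' j) i) \<longrightarrow>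
                straight_segment (edge_curve r (\<Sigma>' j) i))
           \<and> H' (Suc j) = Sing r (H' j) (\<Sigma>' j)"
      proof (cases j)
        case 0
        have "T = Sing r S \<Sigma>0" using \<Sigma>0(4) by (simp only: T_def)
        then show ?thesis unfolding 0 H' \<Sigma>' H(1) using T \<Sigma>0(1-3) by blast
      next
        case (Suc k)
        then have k: "k < q" using j by simp
        show ?thesis unfolding Suc H' \<Sigma>' by (rule HS[rule_format, OF k])
      qed
    qed
    have last: "H' (Suc q) = {}" using H(2) H'(2) by simp
    show ?thesis unfolding stratified_straight_with_def
      by (rule exI[of _ "Suc q"], rule exI[of _ H'], rule exI[of _ \<Sigma>'])
        (rule conjI[OF H'(1) conjI[OF last strata]])
  qed
qed

section \<open>Limits of angles, alignment and primitives\<close>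

lemma orthogonal_matrix_entry:
  fixes R :: "real ^ 'd ^ 'd"
  assumes "orthogonal_matrix R"
  shows "\<bar>R $ i $ j\<bar> \<le> 1"
proof -
  have "transpose R ** R = mat 1" using assms by (simp add: orthogonal_matrix)
  then have "(transpose R ** R) $ j $ j = 1" by (simp add: mat_def)
  then have "(\<Sum>k\<in>UNIV. (R $ k $ j)\<^sup>2) = 1"
    by (simp add: matrix_matrix_mult_def transpose_def power2_eq_square)
  moreover have "(R $ i $ j)\<^sup>2 \<le> (\<Sum>k\<in>UNIV. (R $ k $ j)\<^sup>2)"
    by (rule member_le_sum) auto
  ultimately have "(R $ i $ j)\<^sup>2 \<le> 1" by simp
  then show ?thesis by (simp add: abs_square_le_1)
qed

text \<open>
  The entries of an orthogonal matrix lie in \<open>[-1, 1]\<close>, and the defining equations are closed.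
\<close>

lemma rotation_matrix_subseq:
  fixes R :: "nat \<Rightarrow> real ^ 'd ^ 'd"
  assumes R: "\<And>n. rotation_matrix (R n)"
  obtains s :: "nat \<Rightarrow> nat" and R' where "strict_mono s" "(\<lambda>n. R (s n)) \<longlonglongrightarrow> R'" "rotation_matrix R'"
proof -
  have orth: "orthogonal_matrix (R n)" "det (R n) = 1" for n using R by (auto simp: rotation_matrix_def)
  have mem: "R n $ fst x $ snd x \<in> {-1..1}" for n and x :: "'d \<times> 'd"
    using orthogonal_matrix_entry[OF orth(1), of n "fst x" "snd x"] by (simp add: abs_le_iff)
  obtain s :: "nat \<Rightarrow> nat" and l :: "'d \<times> 'd \<Rightarrow> real" where s: "strict_mono s"
    and l: "\<And>x. (\<lambda>n. R (s n) $ fst x $ snd x) \<longlonglongrightarrow> l x"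
    by (rule finite_compact_subseq[where f="\<lambda>n x. R n $ fst x $ snd x" and K="\<lambda>_. {-1..1}" and A=UNIV])
      (use mem in auto)
  define R' :: "real ^ 'd ^ 'd" where "R' = (\<chi> i j. l (i, j))"
  have entry: "(\<lambda>n. R (s n) $ i $ j) \<longlonglongrightarrow> R' $ i $ j" for i j
    using l[of "(i, j)"] by (simp add: R'_def)
  have lim: "(\<lambda>n. R (s n)) \<longlonglongrightarrow> R'"
    by (intro vec_tendstoI entry)
  have "transpose R' ** R' = mat 1"
  proof (simp only: vec_eq_iff, intro allI)
    fix i j
    have "(\<lambda>n. (transpose (R (s n)) ** R (s n)) $ i $ j) \<longlonglongrightarrow> (transpose R' ** R') $ i $ j"
      by (simp add: matrix_matrix_mult_def transpose_def) (intro tendsto_sum tendsto_mult entry)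
    moreover have "(transpose (R (s n)) ** R (s n)) $ i $ j = mat 1 $ i $ j" for n
      using orth(1)[of "s n"] by (simp add: orthogonal_matrix)
    ultimately show "(transpose R' ** R') $ i $ j = mat 1 $ i $ j"
      by (simp add: LIMSEQ_const_iff)
  qed
  moreover have "det R' = 1"
  proof (rule LIMSEQ_unique)
    show "(\<lambda>n. det (R (s n))) \<longlonglongrightarrow> det R'"
      unfolding det_def by (intro tendsto_sum tendsto_mult tendsto_prod tendsto_const entry)
  qed (simp add: orth)
  ultimately have "rotation_matrix R'" by (simp add: rotation_matrix_def orthogonal_matrix)
  with s lim show thesis by (rule that)
qed

lemma angles_at_vertices_limit:
  fixes \<tau> :: "nat \<Rightarrow> point \<Rightarrow> real ^ 'd"
  assumes ang: "\<And>n. angles_at_vertices r D S (\<tau> n)"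
    and lim: "\<And>x. x \<in> end_points S \<Longrightarrow> (\<lambda>n. \<tau> n x) \<longlonglongrightarrow> \<tau>' x"
  shows "angles_at_vertices r D S \<tau>'"
  unfolding angles_at_vertices_def
proof
  fix p assume p: "p \<in> proj r ` end_points S"
  then have "\<exists>R :: real ^ 'd ^ 'd. rotation_matrix R \<and> (\<forall>x\<in>end_points S. proj r x = p \<longrightarrow> \<tau> n x = R *v D x)" for n
    using ang[of n] unfolding angles_at_vertices_def by blast
  then obtain R :: "nat \<Rightarrow> real ^ 'd ^ 'd" where R: "\<And>n. rotation_matrix (R n)"
    "\<And>n x. x \<in> end_points S \<Longrightarrow> proj r x = p \<Longrightarrow> \<tau> n x = R n *v D x" by metis
  obtain s R' where s: "strict_mono s" and R': "(\<lambda>n. R (s n)) \<longlonglongrightarrow> R'" "rotation_matrix R'"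
    using rotation_matrix_subseq[OF R(1)] .
  have "\<tau>' x = R' *v D x" if x: "x \<in> end_points S" "proj r x = p" for x
  proof (rule LIMSEQ_unique)
    show "(\<lambda>n. \<tau> (s n) x) \<longlonglongrightarrow> \<tau>' x" using LIMSEQ_subseq_LIMSEQ[OF lim[OF x(1)] s] by (simp add: o_def)
    have "(\<lambda>n. R (s n) *v D x) \<longlonglongrightarrow> R' *v D x"
    proof (rule vec_tendstoI)
      fix i
      show "(\<lambda>n. (R (s n) *v D x) $ i) \<longlonglongrightarrow> (R' *v D x) $ i"
        unfolding matrix_vector_mult_def
        by simp (intro tendsto_sum tendsto_mult tendsto_const tendsto_vec_nth R'(1))
    qed
    then show "(\<lambda>n. \<tau> (s n) x) \<longlonglongrightarrow> R' *v D x" using R(2)[OF x] by simp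
  qed
  with R'(2) show "\<exists>R. rotation_matrix R \<and> (\<forall>x\<in>end_points S. proj r x = p \<longrightarrow> \<tau>' x = R *v D x)" by blast
qed

text \<open>
  If \<open>\<delta>\<close> is within \<open>h l\<close> of \<open>l \<tau>\<close>, the error of alignment is at most \<open>2 h l\<close> and \<open>|\<delta>| \<ge> (1 - h) l\<close>; the
  condition on \<open>h\<close> says that \<open>2 h < e (1 - h)\<close>.
\<close>

lemma aligned_of_near:
  fixes \<delta> \<tau> :: "'a::real_normed_vector"
  assumes \<tau>: "norm \<tau> = 1" and l: "l > 0" and near: "norm (\<delta> - l *\<^sub>R \<tau>) \<le> h * l" and h: "h * (2 + e) < e"
    and e0: "e > 0"
  shows "aligned e \<delta> \<tau>"
proof -
  have n: "\<bar>norm \<delta> - l\<bar> \<le> h * l"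
    using norm_triangle_ineq3[of \<delta> "l *\<^sub>R \<tau>"] near \<tau> l by simp
  have "\<delta> - norm \<delta> *\<^sub>R \<tau> = (\<delta> - l *\<^sub>R \<tau>) + (l - norm \<delta>) *\<^sub>R \<tau>" by (simp add: algebra_simps)
  then have "norm (\<delta> - norm \<delta> *\<^sub>R \<tau>) \<le> norm (\<delta> - l *\<^sub>R \<tau>) + norm ((l - norm \<delta>) *\<^sub>R \<tau>)"
    by (metis norm_triangle_ineq)
  also have "\<dots> = norm (\<delta> - l *\<^sub>R \<tau>) + \<bar>l - norm \<delta>\<bar>" using \<tau> by simp
  also have "\<dots> \<le> 2 * h * l" using near n by linarith
  also have "\<dots> < e * norm \<delta>"
  proof -
    have "2 * h < e * (1 - h)" using h by (simp add: algebra_simps)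
    then have "2 * h * l < e * (1 - h) * l" using l by (rule mult_strict_right_mono)
    also have "\<dots> = e * (l - h * l)" by (simp add: algebra_simps)
    also have "\<dots> \<le> e * norm \<delta>" using n e0 by (intro mult_left_mono) auto
    finally show ?thesis .
  qed
  finally show ?thesis by (simp add: aligned_def)
qed

lemma aligned_change_direction:
  fixes \<delta> \<tau> :: "'a::real_normed_vector"
  assumes "aligned (e / 2) \<delta> \<tau>" "norm (\<tau> - \<tau>') \<le> e / 2"
  shows "aligned e \<delta> \<tau>'"
proof -
  have "\<delta> - norm \<delta> *\<^sub>R \<tau>' = (\<delta> - norm \<delta> *\<^sub>R \<tau>) + norm \<delta> *\<^sub>R (\<tau> - \<tau>')" by (simp add: algebra_simps)
  then have "norm (\<delta> - norm \<delta> *\<^sub>R \<tau>') \<le> norm (\<delta> - norm \<delta> *\<^sub>R \<tau>) + norm (norm \<delta> *\<^sub>R (\<tau> - \<tau>'))"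
    by (metis norm_triangle_ineq)
  also have "\<dots> = norm (\<delta> - norm \<delta> *\<^sub>R \<tau>) + norm \<delta> * norm (\<tau> - \<tau>')" by simp
  also have "\<dots> < e / 2 * norm \<delta> + norm \<delta> * (e / 2)"
    using assms by (intro add_less_le_mono mult_left_mono) (auto simp: aligned_def)
  finally show ?thesis by (simp add: aligned_def)
qed

lemma uniform_limit_antideriv:
  fixes f :: "nat \<Rightarrow> real \<Rightarrow> 'a::euclidean_space"
  assumes f: "\<And>n. continuous_on {0..1} (f n)" and g: "continuous_on {0..1} g"
    and lim: "uniform_limit {0..1} f g sequentially"
  shows "uniform_limit {0..1} (\<lambda>n. antideriv (f n)) (antideriv g) sequentially"
proof (rule uniform_limitI)
  fix e :: real assume e: "e > 0"
  then have "e / 2 > 0" by simp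
  from uniform_limitD[OF lim this]
  show "\<forall>\<^sub>F n in sequentially. \<forall>t\<in>{0..1}. dist (antideriv (f n) t) (antideriv g t) < e"
  proof eventually_elim
    case (elim n)
    show ?case
    proof
      fix t :: real assume t: "t \<in> {0..1}"
      let ?d = "\<lambda>s. indicator {0..t} s *\<^sub>R (f n s - g s)"
      have i: "integrable leb01 ?d"
        using t by (intro integrable_mult_indicator continuous_on_integrable_leb01 continuous_on_diff f g) auto
      have "antideriv (f n) t - antideriv g t = (LINT s:{0..t}|leb01. f n s - g s)"
        unfolding antideriv_def using t
        by (intro set_integral_diff(2)[symmetric] set_integrable_leb01_sub continuous_on_integrable_leb01 f g) auto
      also have "norm \<dots> \<le> (LINT s|leb01. e / 2)"
        unfolding set_lebesgue_integral_def
      proof (rule Bochner_Integration.integral_norm_bound_integral[OF i])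
        fix s assume "s \<in> space leb01"
        then have "norm (f n s - g s) \<le> e / 2" using elim by (auto simp: dist_norm less_imp_le)
        then show "norm (?d s) \<le> e / 2" using e by (simp split: split_indicator)
      qed simp
      also have "\<dots> = e / 2" using measure_leb01_Icc[of 0 1] by simp
      finally show "dist (antideriv (f n) t) (antideriv g t) < e" using e by (simp add: dist_norm)
    qed
  qed
qed

section \<open>The limit network\<close>

lemma edge_curve_translate:
  "edge_curve r (\<lambda>p. \<Gamma> p + v) i \<circ> \<sigma> = (\<lambda>t. (edge_curve r \<Gamma> i \<circ> \<sigma>) t + v)"
  by (simp add: edge_curve_def fun_eq_iff)

lemma C1_translate:
  fixes c :: "real \<Rightarrow> 'a::euclidean_space"
  assumes "C1 c"
  shows "C1 (\<lambda>t. c t + v)" "t \<in> {0..1} \<Longrightarrow> velocity (\<lambda>t. c t + v) t = velocity c t"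
proof -
  have d: "((\<lambda>t. c t + v) has_vector_derivative velocity c t) (at t within {0..1})" if "t \<in> {0..1}" for t
    using C1D(1)[OF assms that] by (auto intro!: derivative_eq_intros)
  show "C1 (\<lambda>t. c t + v)" by (rule C1I[OF d C1D(2)[OF assms]])
  show "t \<in> {0..1} \<Longrightarrow> velocity (\<lambda>t. c t + v) t = velocity c t" by (rule velocity_eqI[OF d])
qed

text \<open>
  The situation after the extraction of all subsequences. The edges \<open>c n i\<close> of \<open>\<Gamma> n\<close> have constant speed
  \<open>l n i\<close> and their velocities converge uniformly to \<open>g i\<close>; the real or virtual tangents converge to \<open>\<tau>'\<close>. An
  edge of the limit is singular if and only if its limit length \<open>l' i\<close> is zero.
\<close>

locale converging_networks =
  fixes N :: nat and r :: "(point \<times> point) set" and D :: "point \<Rightarrow> real ^ 'd"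
    and \<Gamma> :: "nat \<Rightarrow> point set \<Rightarrow> real ^ 'd" and \<tau> :: "nat \<Rightarrow> point \<Rightarrow> real ^ 'd"
    and \<sigma> :: "nat \<Rightarrow> nat \<Rightarrow> real \<Rightarrow> real" and l :: "nat \<Rightarrow> nat \<Rightarrow> real" and K :: real
    and l' :: "nat \<Rightarrow> real" and \<tau>' :: "point \<Rightarrow> real ^ 'd" and g :: "nat \<Rightarrow> real \<Rightarrow> real ^ 'd"
  assumes G: "N_graph N r" and conn: "connected_space (graph_topology N r)"
    and strat: "\<And>n. stratified_straight_with N r D (Sing r {1..N} (\<Gamma> n)) (\<tau> n)"
    and ang: "\<And>n. angles_at_vertices r D {1..N} (\<tau> n)"
    and rep: "\<And>n i. i \<in> {1..N} \<Longrightarrow> reparam (\<sigma> n i)"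
    and cs: "\<And>n i. i \<in> {1..N} \<Longrightarrow>
      const_speed (edge_curve r (\<Gamma> n) i \<circ> \<sigma> n i) (l n i) K (\<tau> n (0, i)) (\<tau> n (1, i))"
    and sing: "\<And>n i. i \<in> {1..N} \<Longrightarrow> singular_curve (edge_curve r (\<Gamma> n) i) \<longleftrightarrow> l n i = 0"
    and K: "K \<ge> 0" and lK: "\<And>n i. i \<in> {1..N} \<Longrightarrow> l n i \<le> K"
    and unit: "\<And>n x. x \<in> end_points {1..N} \<Longrightarrow> norm (\<tau> n x) = 1"
    and opp: "\<And>n i. i \<in> {1..N} \<Longrightarrow> (norm (\<tau> n (0, i) + \<tau> n (1, i)))\<^sup>2 \<le> l n i * K"
    and l_lim: "\<And>i. i \<in> {1..N} \<Longrightarrow> (\<lambda>n. l n i) \<longlonglongrightarrow> l' i"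
    and \<tau>_lim: "\<And>x. x \<in> end_points {1..N} \<Longrightarrow> (\<lambda>n. \<tau> n x) \<longlonglongrightarrow> \<tau>' x"
    and g_lim: "\<And>i. i \<in> {1..N} \<Longrightarrow>
      uniform_limit {0..1} (\<lambda>n. velocity (edge_curve r (\<Gamma> n) i \<circ> \<sigma> n i)) (g i) sequentially"
begin

abbreviation c :: "nat \<Rightarrow> nat \<Rightarrow> real \<Rightarrow> real ^ 'd" where
  "c n i \<equiv> edge_curve r (\<Gamma> n) i \<circ> \<sigma> n i"

lemma end01: "i \<in> {1..N} \<Longrightarrow> (0, i) \<in> end_points {1..N}" "i \<in> {1..N} \<Longrightarrow> (1, i) \<in> end_points {1..N}"
  by (auto simp: end_points_def)

lemma c_C1: "i \<in> {1..N} \<Longrightarrow> C1 (c n i)"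
  using cs by (simp add: const_speed_def)

lemma l_nonneg: "i \<in> {1..N} \<Longrightarrow> l n i \<ge> 0"
  using cs by (simp add: const_speed_def)

lemma l'_nonneg: "i \<in> {1..N} \<Longrightarrow> l' i \<ge> 0"
  by (rule LIMSEQ_le_const[OF l_lim]) (use l_nonneg in auto)

lemma c_ends:
  assumes "i \<in> {1..N}"
  shows "c n i 0 = \<Gamma> n (proj r (0, i))" "c n i 1 = \<Gamma> n (proj r (1, i))"
  using rep[OF assms, of n] by (simp_all add: reparam_def edge_curve_def)

lemma disp_c: "i \<in> {1..N} \<Longrightarrow> disp r (\<Gamma> n) i = c n i 1 - c n i 0"
  using c_ends by (simp add: disp_def)

lemma g_cont: "i \<in> {1..N} \<Longrightarrow> continuous_on {0..1} (g i)"
  by (rule uniform_limit_theorem[OF _ g_lim]) (auto intro!: always_eventually C1D(2) c_C1)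

lemma antideriv_c: "i \<in> {1..N} \<Longrightarrow> t \<in> {0..1} \<Longrightarrow> antideriv (velocity (c n i)) t = c n i t - c n i 0"
  using C1_primitive[OF c_C1] by (simp add: primitive_def)

lemma antideriv_lim:
  "i \<in> {1..N} \<Longrightarrow> uniform_limit {0..1} (\<lambda>n. antideriv (velocity (c n i))) (antideriv (g i)) sequentially"
  by (intro uniform_limit_antideriv C1D(2) c_C1 g_cont g_lim)

lemma disp_lim: "i \<in> {1..N} \<Longrightarrow> (\<lambda>n. disp r (\<Gamma> n) i) \<longlonglongrightarrow> antideriv (g i) 1"
  using tendsto_uniform_limitI[OF antideriv_lim, of i 1] by (simp add: disp_c antideriv_c)

lemma g_val:
  assumes "i \<in> {1..N}"
  shows "t \<in> {0..1} \<Longrightarrow> norm (g i t) = l' i" "g i 0 = l' i *\<^sub>R \<tau>' (0, i)" "g i 1 = - (l' i *\<^sub>R \<tau>' (1, i))"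
proof -
  note lim = tendsto_uniform_limitI[OF g_lim[OF assms]]
  have csd: "t \<in> {0..1} \<Longrightarrow> norm (velocity (c n i) t) = l n i" "velocity (c n i) 0 = l n i *\<^sub>R \<tau> n (0, i)"
    "velocity (c n i) 1 = - (l n i *\<^sub>R \<tau> n (1, i))" for n t
    using cs[OF assms, of n] by (auto simp: const_speed_def)
  show "norm (g i t) = l' i" if t: "t \<in> {0..1}"
    using LIMSEQ_unique[OF tendsto_norm[OF lim[OF t]]] l_lim[OF assms] csd(1)[OF t] by simp
  have "(\<lambda>n. velocity (c n i) 0) \<longlonglongrightarrow> g i 0" by (rule lim) simp
  moreover have "(\<lambda>n. velocity (c n i) 0) \<longlonglongrightarrow> l' i *\<^sub>R \<tau>' (0, i)"
    unfolding csd(2) by (intro tendsto_intros l_lim \<tau>_lim end01 assms)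
  ultimately show "g i 0 = l' i *\<^sub>R \<tau>' (0, i)" by (rule LIMSEQ_unique)
  have "(\<lambda>n. velocity (c n i) 1) \<longlonglongrightarrow> g i 1" by (rule lim) simp
  moreover have "(\<lambda>n. velocity (c n i) 1) \<longlonglongrightarrow> - (l' i *\<^sub>R \<tau>' (1, i))"
    unfolding csd(3) by (intro tendsto_intros l_lim \<tau>_lim end01 assms)
  ultimately show "g i 1 = - (l' i *\<^sub>R \<tau>' (1, i))" by (rule LIMSEQ_unique)
qed

lemma \<tau>'_unit: "x \<in> end_points {1..N} \<Longrightarrow> norm (\<tau>' x) = 1"
  using LIMSEQ_unique[OF tendsto_norm[OF \<tau>_lim]] unit by (auto simp: LIMSEQ_const_iff)

lemma \<tau>'_opp: assumes i: "i \<in> {1..N}" and "l' i = 0" shows "\<tau>' (1, i) = - \<tau>' (0, i)"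
proof -
  have "(norm (\<tau>' (0, i) + \<tau>' (1, i)))\<^sup>2 \<le> l' i * K"
    by (rule LIMSEQ_le[where X="\<lambda>n. (norm (\<tau> n (0, i) + \<tau> n (1, i)))\<^sup>2" and Y="\<lambda>n. l n i * K"])
      (auto intro!: tendsto_intros l_lim \<tau>_lim end01 opp i)
  then show ?thesis using assms(2) by (simp add: add_eq_0_iff)
qed

text \<open>
  Displacements along edges converge, and on a connected graph they determine the positions up to a
  translation of the whole network.
\<close>

lemma vertices_converge:
  obtains v P where "\<And>x. x \<in> end_points {1..N} \<Longrightarrow> (\<lambda>n. \<Gamma> n (proj r x) + v n) \<longlonglongrightarrow> P (proj r x)"
proof -
  have "\<exists>Q Q'. (\<forall>n. \<forall>i\<in>{1..N}. disp r (Q n) i = disp r (\<Gamma> n) i) \<and> (\<forall>v. (\<lambda>n. Q n v) \<longlonglongrightarrow> Q' v)"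
    by (rule disp_limit) (use disp_lim in \<open>auto simp: convergent_def\<close>)
  then obtain Q Q' where Q: "\<And>n i. i \<in> {1..N} \<Longrightarrow> disp r (Q n) i = disp r (\<Gamma> n) i"
    and Q': "\<And>v. (\<lambda>n. Q n v) \<longlonglongrightarrow> Q' v" by blast
  have N: "(0, 1) \<in> end_points {1..N}" using G by (auto simp: N_graph_def end_points_def)
  define v where "v n = Q n (proj r (0, 1)) - \<Gamma> n (proj r (0, 1))" for n
  have "\<Gamma> n (proj r x) + v n = Q n (proj r x)" if x: "x \<in> end_points {1..N}" for n x
  proof -
    have "(\<lambda>p. \<Gamma> n p - Q n p) (proj r x) = (\<lambda>p. \<Gamma> n p - Q n p) (proj r (0, 1))"
    proof (rule connected_graph_constant[OF G conn _ x N])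
      show "disp r (\<lambda>p. \<Gamma> n p - Q n p) i = 0" if "i \<in> {1..N}" for i
        using Q[OF that, of n] by (simp add: disp_def algebra_simps)
    qed
    then show ?thesis by (simp add: v_def algebra_simps)
  qed
  then show thesis using Q' by (intro that[of v Q']) simp
qed

text \<open>
  The limit edges are the primitives of the \<open>g i\<close> that start at the limits of the vertices. An edge whose
  length tends to zero has an almost straight approximation in \<open>\<Gamma> n\<close>, which makes the singular part of the
  limit approximately straight.
\<close>

theorem limit_network:
  obtains v \<Gamma>' where "C_Deg N r D \<Gamma>'"
    "\<And>i. i \<in> {1..N} \<Longrightarrow> weak_H2_conv (\<lambda>n. edge_curve r (\<lambda>p. \<Gamma> n p + v n) i \<circ> \<sigma> n i) (edge_curve r \<Gamma>' i)"
    "\<And>i \<alpha>. i \<in> {1..N} \<Longrightarrow> \<alpha> \<in> {0<..<1/2} \<Longrightarrow>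
      C1_holder_conv \<alpha> (\<lambda>n. edge_curve r (\<lambda>p. \<Gamma> n p + v n) i \<circ> \<sigma> n i) (edge_curve r \<Gamma>' i)"
proof -
  obtain v P where P: "\<And>x. x \<in> end_points {1..N} \<Longrightarrow> (\<lambda>n. \<Gamma> n (proj r x) + v n) \<longlonglongrightarrow> P (proj r x)"
    by (rule vertices_converge) blast
  have dP: "P (proj r (0, i)) + antideriv (g i) 1 = P (proj r (1, i))" if i: "i \<in> {1..N}" for i
  proof (rule LIMSEQ_unique)
    have "(\<lambda>n. (\<Gamma> n (proj r (0, i)) + v n) + disp r (\<Gamma> n) i) \<longlonglongrightarrow> P (proj r (0, i)) + antideriv (g i) 1"
      by (intro tendsto_add[OF P] disp_lim end01 i)
    then show "(\<lambda>n. \<Gamma> n (proj r (1, i)) + v n) \<longlonglongrightarrow> P (proj r (0, i)) + antideriv (g i) 1"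
      by (simp add: disp_def algebra_simps)
    show "(\<lambda>n. \<Gamma> n (proj r (1, i)) + v n) \<longlonglongrightarrow> P (proj r (1, i))" by (rule P[OF end01(2)[OF i]])
  qed
  define c' where "c' i t = P (proj r (0, i)) + antideriv (g i) t" for i t
  obtain \<Gamma>' where \<Gamma>'c: "continuous_map (graph_topology N r) euclidean \<Gamma>'"
    and \<Gamma>': "\<And>i t. i \<in> {1..N} \<Longrightarrow> t \<in> {0..1} \<Longrightarrow> edge_curve r \<Gamma>' i t = c' i t"
  proof (rule glue_curves[OF G, of c' P])
    show "continuous_on {0..1} (c' i)" if "i \<in> {1..N}" for i
      unfolding c'_def
      by (intro continuous_intros continuous_on_antideriv continuous_on_integrable_leb01 g_cont that)
  qed (simp_all add: c'_def dP)
  let ?e = "\<lambda>i. edge_curve r \<Gamma>' i"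
  have e_deriv: "(?e i has_vector_derivative g i t) (at t within {0..1})" if i: "i \<in> {1..N}" and t: "t \<in> {0..1}" for i t
  proof (rule has_vector_derivative_transform[OF t])
    show "?e i s = c' i s" if "s \<in> {0..1}" for s by (rule \<Gamma>'[OF i that])
    show "(c' i has_vector_derivative g i t) (at t within {0..1})"
      unfolding c'_def using antideriv_has_vector_derivative[OF g_cont[OF i] t]
      by (auto intro!: derivative_eq_intros)
  qed
  have e_C1: "C1 (?e i)" if "i \<in> {1..N}" for i by (rule C1I[OF e_deriv[OF that] g_cont[OF that]])
  have e_vel: "velocity (?e i) t = g i t" if "i \<in> {1..N}" "t \<in> {0..1}" for i t
    by (rule velocity_eqI[OF e_deriv[OF that] that(2)])

  let ?u = "\<lambda>n i. edge_curve r (\<lambda>p. \<Gamma> n p + v n) i \<circ> \<sigma> n i"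
  have conv: "weak_H2_conv (\<lambda>n. ?u n i) (?e i)" "\<alpha> \<in> {0<..<1/2} \<Longrightarrow> C1_holder_conv \<alpha> (\<lambda>n. ?u n i) (?e i)"
    "H2 (?e i)" if i: "i \<in> {1..N}" for i \<alpha>
  proof -
    have u: "?u n i = (\<lambda>t. c n i t + v n)" for n by (rule edge_curve_translate)
    have C1: "C1 (?u n i)" for n unfolding u by (rule C1_translate(1)[OF c_C1[OF i]])
    have vel: "velocity (?u n i) t = velocity (c n i) t" if "t \<in> {0..1}" for n t
      unfolding u by (rule C1_translate(2)[OF c_C1[OF i] that])
    have "\<exists>\<Phi>. dominated (velocity (?u n i)) \<Phi> \<and> \<Phi> 1 - \<Phi> 0 \<le> K ^ 3 * K" for n
    proof -
      obtain \<Phi> where \<Phi>: "dominated (velocity (c n i)) \<Phi>" "\<Phi> 1 - \<Phi> 0 \<le> l n i ^ 3 * K"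
        using cs[OF i, of n] by (auto simp: const_speed_def)
      have "l n i ^ 3 * K \<le> K ^ 3 * K"
        using lK[OF i] l_nonneg[OF i] K by (intro mult_right_mono power_mono) auto
      moreover have "dominated (velocity (?u n i)) \<Phi>" using \<Phi>(1) vel by (simp add: dominated_def)
      ultimately show ?thesis using \<Phi>(2) by (intro exI[of _ \<Phi>]) simp
    qed
    then obtain \<Phi> where \<Phi>: "\<And>n. dominated (velocity (?u n i)) (\<Phi> n)" "\<And>n. \<Phi> n 1 - \<Phi> n 0 \<le> K ^ 3 * K"
      by metis
    have vlim: "uniform_limit {0..1} (\<lambda>n. velocity (?u n i)) (velocity (?e i)) sequentially"
      by (rule uniform_limit_cong'[THEN iffD1, OF _ _ g_lim[OF i]]) (simp_all add: vel e_vel[OF i])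
    have "uniform_limit {0..1} (\<lambda>n t. (\<Gamma> n (proj r (0, i)) + v n) + antideriv (velocity (c n i)) t) (c' i) sequentially"
      unfolding c'_def
    proof (rule uniform_limit_add[OF _ antideriv_lim[OF i]])
      show "uniform_limit {0..1} (\<lambda>n t. \<Gamma> n (proj r (0, i)) + v n) (\<lambda>t. P (proj r (0, i))) sequentially"
        using tendstoD[OF P[OF end01(1)[OF i]]] by (auto simp: uniform_limit_iff elim: eventually_mono)
    qed
    then have lim: "uniform_limit {0..1} (\<lambda>n. ?u n i) (?e i) sequentially"
    proof (rule uniform_limit_cong'[THEN iffD1, rotated 2])
      show "\<Gamma> n (proj r (0, i)) + v n + antideriv (velocity (c n i)) t = ?u n i t" if "t \<in> {0..1}" for n t
        unfolding u antideriv_c[OF i that] using c_ends(1)[OF i, of n] by simp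
      show "c' i t = ?e i t" if "t \<in> {0..1}" for t using \<Gamma>'[OF i that] by simp
    qed
    show "weak_H2_conv (\<lambda>n. ?u n i) (?e i)" "H2 (?e i)"
      by (rule H2_holder_convergence[OF C1 e_C1[OF i] \<Phi> lim vlim])+
    show "C1_holder_conv \<alpha> (\<lambda>n. ?u n i) (?e i)" if "\<alpha> \<in> {0<..<1/2}"
      by (rule H2_holder_convergence(2)[OF C1 e_C1[OF i] \<Phi> lim vlim that])
  qed

  have e_reg: "regular_curve (?e i)" if i: "i \<in> {1..N}" and "l' i > 0" for i
    unfolding regular_curve_def immersion_def
    using e_C1[OF i] conv(3)[OF i] e_vel[OF i] g_val(1)[OF i] that(2) by fastforce
  have e_sing: "singular_curve (?e i) \<longleftrightarrow> l' i = 0" if i: "i \<in> {1..N}" for i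
  proof
    assume "singular_curve (?e i)"
    then have "velocity (?e i) 0 = 0" using singular_curve_velocity(2)[of "?e i" 0] by simp
    then show "l' i = 0" using e_vel[OF i, of 0] g_val(1)[OF i, of 0] by simp
  next
    assume "l' i = 0"
    then have g0: "g i t = 0" if "t \<in> {0..1}" for t using g_val(1)[OF i that] by simp
    have "antideriv (g i) t = 0" if "t \<in> {0..1}" for t
    proof -
      have "antideriv (g i) t = (LINT s|leb01. 0)"
        unfolding antideriv_def set_lebesgue_integral_def
        by (rule Bochner_Integration.integral_cong) (use g0 in auto)
      then show ?thesis by simp
    qed
    then have "?e i t = P (proj r (0, i))" if "t \<in> {0..1}" for t
      using \<Gamma>'[OF i that] that by (simp add: c'_def)
    then show "singular_curve (?e i)" unfolding singular_curve_def constant_on_def by blast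
  qed
  have net: "network N r {1..N} \<Gamma>'"
    unfolding network_def
  proof (intro conjI ballI)
    show "continuous_map (subtopology (graph_topology N r) (subgraph_points r {1..N})) euclidean \<Gamma>'"
      by (rule continuous_map_from_subtopology[OF \<Gamma>'c])
    show "singular_curve (?e i) \<or> regular_curve (?e i)" if "i \<in> {1..N}" for i
      using e_reg[OF that] e_sing[OF that] l'_nonneg[OF that] by (cases "l' i = 0") auto
  qed simp
  have ang': "angles_at_vertices r D {1..N} \<tau>'" by (rule angles_at_vertices_limit[OF ang \<tau>_lim])
  have ac: "angle_condition_with r D {1..N} \<Gamma>' \<tau>'"
    unfolding angle_condition_with_def
  proof (intro conjI ballI impI)
    fix i z assume i: "i \<in> {1..N}" and reg: "regular_curve (?e i)" and z: "z \<in> {0, 1::real}"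
    have "\<not> singular_curve (?e i)" using reg singular_not_regular by blast
    then have li: "l' i > 0" using e_sing[OF i] l'_nonneg[OF i] by auto
    show "\<tau>' (z, i) = outer_tangent (?e i) z"
    proof (cases "z = 0")
      case True
      then show ?thesis using li e_vel[OF i, of 0] g_val(2)[OF i] \<tau>'_unit[OF end01(1)[OF i]]
        by (simp add: outer_tangent_def unit_tangent_def)
    next
      case False
      then have "z = 1" using z by simp
      then show ?thesis using li e_vel[OF i, of 1] g_val(3)[OF i] \<tau>'_unit[OF end01(2)[OF i]]
        by (simp add: outer_tangent_def unit_tangent_def)
    qed
  next
    fix i assume i: "i \<in> {1..N}" and s: "singular_curve (?e i)"
    then have "l' i = 0" using e_sing by simp
    then show "\<tau>' (0, i) = - \<tau>' (1, i)" using \<tau>'_opp[OF i] by simp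
    show "norm (\<tau>' (0, i)) = 1" "norm (\<tau>' (1, i)) = 1" using \<tau>'_unit end01[OF i] by auto
  next
    show "\<exists>R. rotation_matrix R \<and> (\<forall>x\<in>end_points {1..N}. proj r x = p \<longrightarrow> \<tau>' x = R *v D x)"
      if "p \<in> proj r ` end_points {1..N}" for p
      using ang' that unfolding angles_at_vertices_def by blast
  qed

  \<comment> \<open>The vertex positions of \<open>\<Gamma> n\<close> almost align the short edges with the limit tangents; the edges that
    are already singular in \<open>\<Gamma> n\<close> are aligned by a small perturbation, which exists because \<open>\<Gamma> n\<close>
    is itself degenerate.\<close>
  define S where "S = Sing r {1..N} \<Gamma>'"
  have S: "i \<in> {1..N}" "l' i = 0" if "i \<in> S" for i
    using that e_sing by (auto simp: S_def Sing_def)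
  have fin: "finite S" by (simp add: S_def Sing_def)
  have approx: "approx_straight r S \<tau>'"
    unfolding approx_straight_def
  proof (intro allI impI)
    fix e :: real assume e: "e > 0"
    define h where "h n i = sqrt (l n i * K) + norm (\<tau> n (0, i) - \<tau>' (0, i))" for n i
    have "\<forall>\<^sub>F n in sequentially. \<forall>i\<in>S. h n i * (2 + e) < e \<and> norm (\<tau> n (0, i) - \<tau>' (0, i)) \<le> e / 2"
    proof (rule eventually_ball_finite[OF fin], rule ballI)
      fix i assume iS: "i \<in> S"
      note i = S(1)[OF iS]
      have td: "(\<lambda>n. norm (\<tau> n (0, i) - \<tau>' (0, i))) \<longlonglongrightarrow> 0"
        by (rule tendsto_norm_zero) (rule LIM_zero[OF \<tau>_lim[OF end01(1)[OF i]]])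
      have "(\<lambda>n. h n i * (2 + e)) \<longlonglongrightarrow> (sqrt (l' i * K) + 0) * (2 + e)"
        unfolding h_def by (intro tendsto_intros l_lim[OF i] td)
      then have "\<forall>\<^sub>F n in sequentially. h n i * (2 + e) < e"
        using S(2)[OF iS] e by (intro order_tendstoD(2)) auto
      moreover have "\<forall>\<^sub>F n in sequentially. norm (\<tau> n (0, i) - \<tau>' (0, i)) < e / 2"
        using e by (intro order_tendstoD(2)[OF td]) simp
      ultimately show "\<forall>\<^sub>F n in sequentially. h n i * (2 + e) < e \<and> norm (\<tau> n (0, i) - \<tau>' (0, i)) \<le> e / 2"
        by eventually_elim simp
    qed
    then obtain n where n: "\<And>i. i \<in> S \<Longrightarrow> h n i * (2 + e) < e"
      "\<And>i. i \<in> S \<Longrightarrow> norm (\<tau> n (0, i) - \<tau>' (0, i)) \<le> e / 2"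
      using eventually_happens'[OF sequentially_bot] by blast
    have "e / 2 > 0" using e by simp
    then obtain P' where P': "\<And>i. i \<in> Sing r {1..N} (\<Gamma> n) \<Longrightarrow> aligned (e / 2) (disp r P' i) (\<tau> n (0, i))"
      using stratified_imp_approx_straight[OF strat[of n]] unfolding approx_straight_def by blast
    show "\<exists>P. \<forall>i\<in>S. aligned e (disp r P i) (\<tau>' (0, i))"
    proof (rule aligned_merge[OF fin])
      fix i assume iS: "i \<in> S"
      note i = S(1)[OF iS]
      show "aligned e (disp r (\<Gamma> n) i) (\<tau>' (0, i)) \<or> (disp r (\<Gamma> n) i = 0 \<and> aligned e (disp r P' i) (\<tau>' (0, i)))"
      proof (cases "l n i = 0")
        case True
        then have s: "singular_curve (edge_curve r (\<Gamma> n) i)" using sing[OF i] by simp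
        then have "edge_curve r (\<Gamma> n) i 1 = edge_curve r (\<Gamma> n) i 0"
          by (auto simp: singular_curve_def constant_on_def)
        then have "disp r (\<Gamma> n) i = 0" by (simp add: disp_def edge_curve_def)
        moreover have "i \<in> Sing r {1..N} (\<Gamma> n)" using s i by (simp add: Sing_def)
        ultimately show ?thesis using aligned_change_direction[OF P' n(2)[OF iS]] by blast
      next
        case False
        then have li: "l n i > 0" using l_nonneg[OF i, of n] by simp
        let ?\<delta> = "disp r (\<Gamma> n) i"
        have "(norm (?\<delta> - l n i *\<^sub>R \<tau> n (0, i)))\<^sup>2 \<le> l n i ^ 3 * K"
          using const_speed_chord[OF cs[OF i] li] by (simp add: disp_c[OF i])
        also have "\<dots> = (l n i * sqrt (l n i * K))\<^sup>2"
          using li K by (simp add: power_mult_distrib power2_eq_square power3_eq_cube)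
        finally have "norm (?\<delta> - l n i *\<^sub>R \<tau> n (0, i)) \<le> l n i * sqrt (l n i * K)"
          by (rule power2_le_imp_le) (use li K in simp)
        moreover have "norm (l n i *\<^sub>R (\<tau> n (0, i) - \<tau>' (0, i))) = l n i * norm (\<tau> n (0, i) - \<tau>' (0, i))"
          using li by simp
        moreover have "?\<delta> - l n i *\<^sub>R \<tau>' (0, i) = (?\<delta> - l n i *\<^sub>R \<tau> n (0, i)) + l n i *\<^sub>R (\<tau> n (0, i) - \<tau>' (0, i))"
          by (simp add: algebra_simps)
        ultimately have "norm (?\<delta> - l n i *\<^sub>R \<tau>' (0, i)) \<le> h n i * l n i"
          using norm_triangle_ineq[of "?\<delta> - l n i *\<^sub>R \<tau> n (0, i)" "l n i *\<^sub>R (\<tau> n (0, i) - \<tau>' (0, i))"]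
          by (simp add: h_def algebra_simps)
        then have "aligned e ?\<delta> (\<tau>' (0, i))"
          by (rule aligned_of_near[OF \<tau>'_unit[OF end01(1)[OF i]] li _ n(1)[OF iS] e])
        then show ?thesis ..
      qed
    qed
  qed
  have SN: "S \<subseteq> {1..N}" using S by blast
  have "stratified_straight_with N r D S \<tau>'"
  proof (rule approx_straight_imp_stratified[OF G SN approx])
    show "norm (\<tau>' (0, i)) = 1" "\<tau>' (1, i) = - \<tau>' (0, i)" if "i \<in> S" for i
      using \<tau>'_unit[OF end01(1)[OF S(1)[OF that]]] \<tau>'_opp[OF S[OF that]] by auto
    show "angles_at_vertices r D S \<tau>'" by (rule angles_at_vertices_subset[OF ang' SN])
  qed
  then have "C_Deg N r D \<Gamma>'" using net ac by (auto simp: C_Deg_def S_def)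
  then show thesis using conv(1,2) by (rule that)
qed

end

section \<open>Compactness\<close>

lemma energy_edge_bounds:
  assumes "energy N r \<Gamma> \<le> K" "i \<in> {1..N}" "regular_curve (edge_curve r \<Gamma> i)"
  shows "bending_energy (edge_curve r \<Gamma> i) \<le> K" "curve_length (edge_curve r \<Gamma> i) \<le> K"
proof -
  have nonneg: "bending_energy u \<ge> 0" "curve_length u \<ge> 0" for u :: "real \<Rightarrow> 'a::euclidean_space"
    unfolding bending_energy_def curve_length_def lint_leb01 by simp_all
  have "bending_energy (edge_curve r \<Gamma> i) + curve_length (edge_curve r \<Gamma> i) \<le> energy N r \<Gamma>"
    unfolding energy_def
    by (rule member_le_sum[where f="\<lambda>i. bending_energy (edge_curve r \<Gamma> i) + curve_length (edge_curve r \<Gamma> i)"])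
      (use assms nonneg in auto)
  then show "bending_energy (edge_curve r \<Gamma> i) \<le> K" "curve_length (edge_curve r \<Gamma> i) \<le> K"
    using assms(1) nonneg[of "edge_curve r \<Gamma> i"] by linarith+
qed

lemma unit_tangent_norm: "immersion \<gamma> \<Longrightarrow> t \<in> {0..1} \<Longrightarrow> norm (unit_tangent \<gamma> t) = 1"
  by (simp add: immersion_def unit_tangent_def)

lemma network_const_speed:
  fixes \<Gamma> :: "point set \<Rightarrow> real ^ 'd"
  assumes net: "network N r {1..N} \<Gamma>" and ac: "angle_condition_with r D {1..N} \<Gamma> \<tau>"
    and E: "energy N r \<Gamma> \<le> K" and K: "K \<ge> 0" and i: "i \<in> {1..N}"
  shows "norm (\<tau> (0, i)) = 1" "norm (\<tau> (1, i)) = 1"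
    and "\<exists>\<sigma> l. reparam \<sigma> \<and> const_speed (edge_curve r \<Gamma> i \<circ> \<sigma>) l K (\<tau> (0, i)) (\<tau> (1, i))
      \<and> (singular_curve (edge_curve r \<Gamma> i) \<longleftrightarrow> l = 0) \<and> l \<in> {0..K}
      \<and> (norm (\<tau> (0, i) + \<tau> (1, i)))\<^sup>2 \<le> l * K"
proof -
  let ?c = "edge_curve r \<Gamma> i"
  have "norm (\<tau> (0, i)) = 1 \<and> norm (\<tau> (1, i)) = 1 \<and> (\<exists>\<sigma> l. reparam \<sigma> \<and> const_speed (?c \<circ> \<sigma>) l K (\<tau> (0, i)) (\<tau> (1, i))
      \<and> (singular_curve ?c \<longleftrightarrow> l = 0) \<and> l \<in> {0..K} \<and> (norm (\<tau> (0, i) + \<tau> (1, i)))\<^sup>2 \<le> l * K)"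
  proof (cases "singular_curve ?c")
    case True
    then have t: "norm (\<tau> (0, i)) = 1" "norm (\<tau> (1, i)) = 1" "\<tau> (0, i) = - \<tau> (1, i)"
      using ac i by (auto simp: angle_condition_with_def)
    have "const_speed (?c \<circ> (\<lambda>t. t)) 0 K (\<tau> (0, i)) (\<tau> (1, i))"
      using singular_curve_const_speed[OF True] by (simp add: o_def)
    with t True reparam_id K show ?thesis
      by (intro conjI exI[of _ "\<lambda>t. t"] exI[of _ 0]) auto
  next
    case False
    then have reg: "regular_curve ?c" using net i by (auto simp: network_def)
    have t: "\<tau> (0, i) = outer_tangent ?c 0" "\<tau> (1, i) = outer_tangent ?c 1"
      using ac i reg by (auto simp: angle_condition_with_def)
    have imm: "immersion ?c" using reg by (simp add: regular_curve_def)
    have n: "norm (\<tau> (0, i)) = 1" "norm (\<tau> (1, i)) = 1"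
      unfolding t using unit_tangent_norm[OF imm] by (auto simp: outer_tangent_def)
    obtain \<sigma> where \<sigma>: "reparam \<sigma>" "curve_length ?c > 0"
      "const_speed (?c \<circ> \<sigma>) (curve_length ?c) K (outer_tangent ?c 0) (outer_tangent ?c 1)"
      using regular_curve_const_speed[OF reg energy_edge_bounds(1)[OF E i reg]] .
    have "(norm (\<tau> (0, i) + \<tau> (1, i)))\<^sup>2 \<le> curve_length ?c * K"
      unfolding t by (rule const_speed_tangents[OF \<sigma>(3,2)])
    then have "reparam \<sigma> \<and> const_speed (?c \<circ> \<sigma>) (curve_length ?c) K (\<tau> (0, i)) (\<tau> (1, i))
      \<and> (singular_curve ?c \<longleftrightarrow> curve_length ?c = 0) \<and> curve_length ?c \<in> {0..K}
      \<and> (norm (\<tau> (0, i) + \<tau> (1, i)))\<^sup>2 \<le> curve_length ?c * K"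
      using \<sigma> False energy_edge_bounds(2)[OF E i reg] unfolding t by auto
    with n show ?thesis by blast
  qed
  then show "norm (\<tau> (0, i)) = 1" "norm (\<tau> (1, i)) = 1"
    and "\<exists>\<sigma> l. reparam \<sigma> \<and> const_speed (?c \<circ> \<sigma>) l K (\<tau> (0, i)) (\<tau> (1, i))
      \<and> (singular_curve ?c \<longleftrightarrow> l = 0) \<and> l \<in> {0..K} \<and> (norm (\<tau> (0, i) + \<tau> (1, i)))\<^sup>2 \<le> l * K"
    by blast+
qed

text \<open>
  The bounds on \<open>l n\<close> and on the second derivatives make the velocities bounded and equicontinuous, so the
  theorem of Arzela and Ascoli applies.
\<close>

lemma const_speed_subseq:
  fixes c :: "nat \<Rightarrow> real \<Rightarrow> 'a::euclidean_space"
  assumes cs: "\<And>n. const_speed (c n) (l n) K (a n) (b n)" and l: "\<And>n. l n \<in> {0..K}" and K: "K \<ge> 0"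
  shows "\<exists>s g. strict_mono (s :: nat \<Rightarrow> nat) \<and> uniform_limit {0..1} (\<lambda>n. velocity (c (s n))) g sequentially"
proof -
  have hold: "(norm (velocity (c n) t - velocity (c n) s))\<^sup>2 \<le> K ^ 3 * K * \<bar>t - s\<bar>"
    if "s \<in> {0..1}" "t \<in> {0..1}" for n s t
  proof -
    have "(norm (velocity (c n) t - velocity (c n) s))\<^sup>2 \<le> l n ^ 3 * K * \<bar>t - s\<bar>"
      by (rule const_speed_velocity_diff[OF cs that])
    also have "\<dots> \<le> K ^ 3 * K * \<bar>t - s\<bar>"
      using l[of n] K by (intro mult_right_mono power_mono) auto
    finally show ?thesis .
  qed
  obtain g k where "strict_mono (k :: nat \<Rightarrow> nat)"
    and g: "\<And>e. 0 < e \<Longrightarrow> \<exists>M. \<forall>n x. n \<ge> M \<and> x \<in> {0..1} \<longrightarrow> norm (velocity (c (k n)) x - g x) < e"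
  proof (rule Arzela_Ascoli[of "{0..1::real}" "\<lambda>n. velocity (c n)" K])
    show "norm (velocity (c n) x) \<le> K" if "x \<in> {0..1}" for n x
      using cs[of n] l[of n] that by (simp add: const_speed_def)
    fix x e :: real assume x: "x \<in> {0..1}" and e: "0 < e"
    define d where "d = e\<^sup>2 / (K ^ 3 * K + 1)"
    have KK: "K ^ 3 * K \<ge> 0" using K by simp
    have d: "d > 0" using e KK by (simp add: d_def)
    have "norm (velocity (c n) x - velocity (c n) y) < e" if y: "y \<in> {0..1}" "norm (x - y) < d" for n y
    proof -
      have "(norm (velocity (c n) x - velocity (c n) y))\<^sup>2 \<le> K ^ 3 * K * \<bar>x - y\<bar>" by (rule hold[OF y(1) x])
      also have "\<dots> \<le> (K ^ 3 * K) * d" using y(2) KK by (intro mult_left_mono) auto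
      also have "\<dots> < (K ^ 3 * K + 1) * d" using d by (simp add: algebra_simps)
      also have "\<dots> = e\<^sup>2" using KK by (simp add: d_def)
      finally show ?thesis by (rule power2_less_imp_less) (use e in simp)
    qed
    with d show "\<exists>d. 0 < d \<and> (\<forall>n y. y \<in> {0..1} \<and> norm (x - y) < d \<longrightarrow> norm (velocity (c n) x - velocity (c n) y) < e)"
      by blast
  qed (use that in auto)
  have "uniform_limit {0..1} (\<lambda>n. velocity (c (k n))) g sequentially"
    unfolding uniform_limit_sequentially_iff dist_norm using g by blast
  with \<open>strict_mono k\<close> show ?thesis by blast
qed

lemma uniform_limit_subseq:
  assumes "uniform_limit S f g sequentially" "strict_mono (s :: nat \<Rightarrow> nat)"
  shows "uniform_limit S (\<lambda>n. f (s n)) g sequentially"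
  using filterlim_compose[OF assms(1) filterlim_subseq[OF assms(2)]] .

text \<open>
  The energy bound holds for all but finitely many \<open>n\<close>, and the first terms are discarded. Lengths and
  tangents at the ends of the edges stay in compact sets; together with the velocities they converge along
  a common subsequence of the finitely many edges.
\<close>

theorem bounded_energy_compactness:
  fixes N :: nat and r :: "(point \<times> point) set" and D :: "point \<Rightarrow> real ^ 'd"
    and \<Gamma> :: "nat \<Rightarrow> point set \<Rightarrow> real ^ 'd"
  assumes G: "N_graph N r" and conn: "connected_space (graph_topology N r)"
    and deg: "\<And>n. C_Deg N r D (\<Gamma> n)"
    and E: "limsup (\<lambda>n. ereal (energy N r (\<Gamma> n))) \<le> ereal C"
  shows "\<exists>(s :: nat \<Rightarrow> nat) v \<Gamma>'. strict_mono s \<and> C_Deg N r D \<Gamma>' \<and>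
    network_conv (\<lambda>u u'. weak_H2_conv u u' \<and> (\<forall>\<alpha>\<in>{0<..<1/2}. C1_holder_conv \<alpha> u u'))
      N r (\<lambda>n p. \<Gamma> (s n) p + v n) \<Gamma>'"
proof -
  define K where "K = max 0 (C + 1)"
  have K: "K \<ge> 0" "C < K" by (auto simp: K_def)
  have "limsup (\<lambda>n. ereal (energy N r (\<Gamma> n))) < ereal K"
    using E K(2) by (metis ereal_less_eq(3) le_less_trans less_ereal.simps(1))
  then have "\<forall>\<^sub>F n in sequentially. ereal (energy N r (\<Gamma> n)) < ereal K"
    by (rule Limsup_lessD)
  then obtain n0 where "\<forall>n\<ge>n0. ereal (energy N r (\<Gamma> n)) < ereal K"
    unfolding eventually_sequentially by blast
  then have n0: "energy N r (\<Gamma> n) \<le> K" if "n \<ge> n0" for n using that by (simp add: less_imp_le)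
  define \<Delta> where "\<Delta> n = \<Gamma> (n + n0)" for n
  have \<Delta>E: "energy N r (\<Delta> n) \<le> K" for n unfolding \<Delta>_def by (rule n0) simp
  have "\<forall>n. \<exists>\<tau>. angle_condition_with r D {1..N} (\<Delta> n) \<tau> \<and>
      stratified_straight_with N r D (Sing r {1..N} (\<Delta> n)) \<tau>"
    using deg by (auto simp: C_Deg_def \<Delta>_def)
  then obtain \<tau> where ac: "\<And>n. angle_condition_with r D {1..N} (\<Delta> n) (\<tau> n)"
    and strat: "\<And>n. stratified_straight_with N r D (Sing r {1..N} (\<Delta> n)) (\<tau> n)" by metis
  have net: "network N r {1..N} (\<Delta> n)" for n using deg by (simp add: C_Deg_def \<Delta>_def)
  note edge = network_const_speed[OF net ac \<Delta>E K(1)]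
  have unit: "norm (\<tau> n x) = 1" if "x \<in> end_points {1..N}" for n x
    using that edge(1,2) by (auto simp: end_points_def)
  have "\<forall>n. \<forall>i\<in>{1..N}. \<exists>\<sigma> l. reparam \<sigma> \<and> const_speed (edge_curve r (\<Delta> n) i \<circ> \<sigma>) l K (\<tau> n (0, i)) (\<tau> n (1, i))
      \<and> (singular_curve (edge_curve r (\<Delta> n) i) \<longleftrightarrow> l = 0) \<and> l \<in> {0..K}
      \<and> (norm (\<tau> n (0, i) + \<tau> n (1, i)))\<^sup>2 \<le> l * K"
    using edge(3) by blast
  then obtain \<sigma> l where \<sigma>l: "\<And>n i. i \<in> {1..N} \<Longrightarrow> reparam (\<sigma> n i)"
    "\<And>n i. i \<in> {1..N} \<Longrightarrow> const_speed (edge_curve r (\<Delta> n) i \<circ> \<sigma> n i) (l n i) K (\<tau> n (0, i)) (\<tau> n (1, i))"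
    "\<And>n i. i \<in> {1..N} \<Longrightarrow> singular_curve (edge_curve r (\<Delta> n) i) \<longleftrightarrow> l n i = 0"
    "\<And>n i. i \<in> {1..N} \<Longrightarrow> l n i \<in> {0..K}"
    "\<And>n i. i \<in> {1..N} \<Longrightarrow> (norm (\<tau> n (0, i) + \<tau> n (1, i)))\<^sup>2 \<le> l n i * K"
    by metis
  let ?c = "\<lambda>n i. edge_curve r (\<Delta> n) i \<circ> \<sigma> n i"
  have "\<exists>s. strict_mono s \<and> (\<forall>i\<in>{1..N}. \<exists>g. uniform_limit {0..1} (\<lambda>n. velocity (?c (s n) i)) g sequentially)"
  proof (rule finite_common_subseq)
    fix i and s :: "nat \<Rightarrow> nat" assume i: "i \<in> {1..N}" and s: "strict_mono s"
    have "\<exists>s' g. strict_mono (s' :: nat \<Rightarrow> nat) \<and> uniform_limit {0..1} (\<lambda>n. velocity (?c (s (s' n)) i)) g sequentially"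
      by (rule const_speed_subseq[where c="\<lambda>n. ?c (s n) i", OF \<sigma>l(2)[OF i] \<sigma>l(4)[OF i] K(1)])
    then show "\<exists>s'. strict_mono s' \<and> (\<exists>g. uniform_limit {0..1} (\<lambda>n. velocity (?c ((s \<circ> s') n) i)) g sequentially)"
      unfolding o_apply by blast
  next
    fix i and s s' :: "nat \<Rightarrow> nat"
    assume "\<exists>g. uniform_limit {0..1} (\<lambda>n. velocity (?c (s n) i)) g sequentially" and s': "strict_mono s'"
    then obtain g where "uniform_limit {0..1} (\<lambda>n. velocity (?c (s n) i)) g sequentially" by blast
    from uniform_limit_subseq[OF this s']
    show "\<exists>g. uniform_limit {0..1} (\<lambda>n. velocity (?c ((s \<circ> s') n) i)) g sequentially"
      unfolding o_apply by blast
  qed simp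
  then obtain s1 where s1: "strict_mono s1"
    and "\<forall>i\<in>{1..N}. \<exists>g. uniform_limit {0..1} (\<lambda>n. velocity (?c (s1 n) i)) g sequentially" by blast
  from bchoice[OF this(2)] obtain g
    where g: "\<And>i. i \<in> {1..N} \<Longrightarrow> uniform_limit {0..1} (\<lambda>n. velocity (?c (s1 n) i)) (g i) sequentially" by blast
  let ?T = "{0..K} \<times> sphere (0 :: real ^ 'd) 1 \<times> sphere (0 :: real ^ 'd) 1"
  obtain s2 and lim :: "nat \<Rightarrow> real \<times> (real ^ 'd) \<times> (real ^ 'd)" where s2: "strict_mono (s2 :: nat \<Rightarrow> nat)"
    and lim: "\<And>i. i \<in> {1..N} \<Longrightarrow>
      (\<lambda>n. (l (s1 (s2 n)) i, \<tau> (s1 (s2 n)) (0, i), \<tau> (s1 (s2 n)) (1, i))) \<longlonglongrightarrow> lim i"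
  proof (rule finite_compact_subseq[where A="{1..N}" and K="\<lambda>_. ?T"
        and f="\<lambda>n i. (l (s1 n) i, \<tau> (s1 n) (0, i), \<tau> (s1 n) (1, i))"])
    show "(l (s1 n) i, \<tau> (s1 n) (0, i), \<tau> (s1 n) (1, i)) \<in> ?T" if "i \<in> {1..N}" for n i
      using \<sigma>l(4)[OF that] edge(1,2)[OF that] by simp
    show "compact ?T" by (intro compact_Times) auto
  qed (use that in auto)
  define t where "t n = s1 (s2 n)" for n
  define \<tau>' where "\<tau>' x = (if fst x = 0 then fst (snd (lim (snd x))) else snd (snd (lim (snd x))))" for x :: point
  interpret converging_networks N r D "\<lambda>n. \<Delta> (t n)" "\<lambda>n. \<tau> (t n)" "\<lambda>n. \<sigma> (t n)" "\<lambda>n. l (t n)" K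
    "\<lambda>i. fst (lim i)" \<tau>' g
  proof
    show "N_graph N r" "connected_space (graph_topology N r)" "0 \<le> K" by fact+
    show "stratified_straight_with N r D (Sing r {1..N} (\<Delta> (t n))) (\<tau> (t n))" for n by (rule strat)
    show "angles_at_vertices r D {1..N} (\<tau> (t n))" for n
      using ac[of "t n"] unfolding angle_condition_with_def angles_at_vertices_def by blast
    fix i n assume i: "i \<in> {1..N}"
    show "reparam (\<sigma> (t n) i)"
      "const_speed (edge_curve r (\<Delta> (t n)) i \<circ> \<sigma> (t n) i) (l (t n) i) K (\<tau> (t n) (0, i)) (\<tau> (t n) (1, i))"
      "(norm (\<tau> (t n) (0, i) + \<tau> (t n) (1, i)))\<^sup>2 \<le> l (t n) i * K"
      by (rule \<sigma>l[OF i])+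
    show "singular_curve (edge_curve r (\<Delta> (t n)) i) = (l (t n) i = 0)" by (rule \<sigma>l(3)[OF i])
    show "l (t n) i \<le> K" using \<sigma>l(4)[OF i, of "t n"] by simp
  next
    show "norm (\<tau> (t n) x) = 1" if "x \<in> end_points {1..N}" for n x by (rule unit[OF that])
    show "(\<lambda>n. l (t n) i) \<longlonglongrightarrow> fst (lim i)" if "i \<in> {1..N}" for i
      using tendsto_fst[OF lim[OF that]] by (simp add: t_def)
    show "(\<lambda>n. \<tau> (t n) x) \<longlonglongrightarrow> \<tau>' x" if "x \<in> end_points {1..N}" for x
      using that tendsto_fst[OF tendsto_snd[OF lim]] tendsto_snd[OF tendsto_snd[OF lim]]
      by (auto simp: end_points_def \<tau>'_def t_def)
    show "uniform_limit {0..1} (\<lambda>n. velocity (edge_curve r (\<Delta> (t n)) i \<circ> \<sigma> (t n) i)) (g i) sequentially"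
      if "i \<in> {1..N}" for i
      unfolding t_def by (rule uniform_limit_subseq[OF g[OF that] s2])
  qed
  obtain v \<Gamma>' where lim_net: "C_Deg N r D \<Gamma>'"
    "\<And>i. i \<in> {1..N} \<Longrightarrow> weak_H2_conv (\<lambda>n. edge_curve r (\<lambda>p. \<Delta> (t n) p + v n) i \<circ> \<sigma> (t n) i) (edge_curve r \<Gamma>' i)"
    "\<And>i \<alpha>. i \<in> {1..N} \<Longrightarrow> \<alpha> \<in> {0<..<1/2} \<Longrightarrow>
      C1_holder_conv \<alpha> (\<lambda>n. edge_curve r (\<lambda>p. \<Delta> (t n) p + v n) i \<circ> \<sigma> (t n) i) (edge_curve r \<Gamma>' i)"
    by (rule limit_network) blast
  define s where "s n = t n + n0" for n
  have "strict_mono s" using s1 s2 by (simp add: s_def t_def strict_mono_def)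
  moreover have "network_conv (\<lambda>u u'. weak_H2_conv u u' \<and> (\<forall>\<alpha>\<in>{0<..<1/2}. C1_holder_conv \<alpha> u u'))
      N r (\<lambda>n p. \<Gamma> (s n) p + v n) \<Gamma>'"
    unfolding network_conv_def
  proof (intro ballI exI conjI allI)
    fix i assume i: "i \<in> {1..N}"
    show "reparam (\<sigma> (t n) i)" for n by (rule \<sigma>l(1)[OF i])
    show "weak_H2_conv (\<lambda>n. edge_curve r (\<lambda>p. \<Gamma> (s n) p + v n) i \<circ> \<sigma> (t n) i) (edge_curve r \<Gamma>' i)"
      using lim_net(2)[OF i] by (simp add: s_def \<Delta>_def)
    show "C1_holder_conv \<alpha> (\<lambda>n. edge_curve r (\<lambda>p. \<Gamma> (s n) p + v n) i \<circ> \<sigma> (t n) i) (edge_curve r \<Gamma>' i)"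
      if "\<alpha> \<in> {0<..<1/2}" for \<alpha>
      using lim_net(3)[OF i that] by (simp add: s_def \<Delta>_def)
  qed
  ultimately show ?thesis using lim_net(1) by blast
qed

lemma C_Reg_imp_C_Deg: "C_Reg N r D \<Gamma> \<Longrightarrow> C_Deg N r D \<Gamma>"
proof -
  assume reg: "C_Reg N r D \<Gamma>"
  then obtain \<tau> where "angle_condition_with r D {1..N} \<Gamma> \<tau>"
    by (auto simp: C_Reg_def angle_condition_def)
  moreover have "stratified_straight_with N r D {} \<tau>"
    unfolding stratified_straight_with_def by (intro exI[of _ 0] exI[of _ "\<lambda>_. {}"]) simp
  ultimately show ?thesis using reg by (auto simp: C_Reg_def C_Deg_def)
qed

lemma network_conv_mono:
  assumes "network_conv conv N r \<Gamma> \<Gamma>'" "\<And>u u'. conv u u' \<Longrightarrow> conv' u u'"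
  shows "network_conv conv' N r \<Gamma> \<Gamma>'"
  using assms unfolding network_conv_def by meson

theorem proposition3p9:
  fixes N :: nat
    and r :: "(point \<times> point) set"
    and D :: "point \<Rightarrow> real ^ 'd"
  assumes "CARD('d) \<ge> 2"
    and "N_graph N r"
    and "connected_space (graph_topology N r)"
    and "angle_assignment N D"
  shows "(\<forall>(\<Gamma> :: nat \<Rightarrow> point set \<Rightarrow> real ^ 'd) (C :: real).
           (\<forall>n. C_Deg N r D (\<Gamma> n)) \<longrightarrow>
           limsup (\<lambda>n. ereal (energy N r (\<Gamma> n))) \<le> ereal C \<longrightarrow>
           (\<exists>(s :: nat \<Rightarrow> nat) (v :: nat \<Rightarrow> real ^ 'd) (\<Gamma>' :: point set \<Rightarrow> real ^ 'd).
              strict_mono s \<and> C_Deg N r D \<Gamma>' \<and>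
              network_conv
                (\<lambda>u u'. weak_H2_conv u u' \<and> (\<forall>\<alpha>\<in>{0<..<1/2}. C1_holder_conv \<alpha> u u'))
                N r (\<lambda>n p. \<Gamma> (s n) p + v n) \<Gamma>'))
       \<and> (\<forall>(\<Gamma> :: nat \<Rightarrow> point set \<Rightarrow> real ^ 'd) (C :: real).
           (\<forall>n. C_Reg N r D (\<Gamma> n)) \<longrightarrow>
           limsup (\<lambda>n. ereal (energy N r (\<Gamma> n))) \<le> ereal C \<longrightarrow>
           (\<exists>(s :: nat \<Rightarrow> nat) (v :: nat \<Rightarrow> real ^ 'd) (\<Gamma>' :: point set \<Rightarrow> real ^ 'd).
              strict_mono s \<and> C_Deg N r D \<Gamma>' \<and>
              network_conv weak_H2_conv N r (\<lambda>n p. \<Gamma> (s n) p + v n) \<Gamma>'))"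
proof (intro conjI allI impI)
  fix \<Gamma> :: "nat \<Rightarrow> point set \<Rightarrow> real ^ 'd" and C :: real
  assume E: "limsup (\<lambda>n. ereal (energy N r (\<Gamma> n))) \<le> ereal C"
  note main = bounded_energy_compactness[OF assms(2,3) _ E]
  show "\<exists>s v \<Gamma>'. strict_mono s \<and> C_Deg N r D \<Gamma>' \<and>
      network_conv (\<lambda>u u'. weak_H2_conv u u' \<and> (\<forall>\<alpha>\<in>{0<..<1/2}. C1_holder_conv \<alpha> u u'))
        N r (\<lambda>n p. \<Gamma> (s n) p + v n) \<Gamma>'" if "\<forall>n. C_Deg N r D (\<Gamma> n)"
    by (rule main) (use that in blast)
  assume "\<forall>n. C_Reg N r D (\<Gamma> n)"
  then have "\<And>n. C_Deg N r D (\<Gamma> n)" using C_Reg_imp_C_Deg by blast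
  from main[OF this] obtain s v \<Gamma>' where *: "strict_mono (s :: nat \<Rightarrow> nat)" "C_Deg N r D \<Gamma>'"
    "network_conv (\<lambda>u u'. weak_H2_conv u u' \<and> (\<forall>\<alpha>\<in>{0<..<1/2}. C1_holder_conv \<alpha> u u'))
        N r (\<lambda>n p. \<Gamma> (s n) p + v n) \<Gamma>'" by blast
  from network_conv_mono[OF *(3), of weak_H2_conv] *(1,2)
  show "\<exists>s v \<Gamma>'. strict_mono s \<and> C_Deg N r D \<Gamma>' \<and>
      network_conv weak_H2_conv N r (\<lambda>n p. \<Gamma> (s n) p + v n) \<Gamma>'" by blast
qed

end
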